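(* Let $w\in\mathrm{pr}_\circ(\Omega)$ have order $|w|\ge 3$. Let $a,b,c\in\mathbf{N}$ be the common sizes of the fibers of the projections $\mathrm{pr}_{0,1},\mathrm{pr}_{1,0},\mathrm{pr}_{1,1}$ (from $\Sigma_{R,S}$ to $\mathcal{F}_{0,1},\mathcal{F}_{1,0},\mathcal{F}_{1,1}$), respectively. Let $h$ be the Coxeter number of $\Phi$. Then $a+b+c=h$, $a=c$, and $$h\cdot F_w(\cdot)=c\cdot\big[\mathrm{Ht}(\cdot)-2\,\mathrm{Ht}(w(\cdot))+\mathrm{Ht}(w^2(\cdot))\big]$$ as functions on $\Phi$ (equivalently, as linear functionals on $V$), where $F_w=\sum_{\beta\in\mathcal{F}(w)}\langle\cdot,\beta^\vee\rangle$ and $\mathcal{F}(w)=\{\beta>0 : w(\beta)<0,\ w^2(\beta)>0\}$.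
   Context: Setting. $K$ is a non-archimedean local field of characteristic $0$, $G$ a split connected reductive affine algebraic $K$-group, $T\subset G$ a $K$-split maximal torus, $W_\circ=N_G(T)(K)/T(K)$ the finite Weyl group, $\Phi$ the root system of $(G,T)$, assumed irreducible. $V$ is the real span of $\Phi$ in $X^*(T)\otimes\mathbf{R}$, $V^*$ its dual, $\langle\cdot,\cdot\rangle$ the pairing, $\beta^\vee$ the coroot of $\beta\in\Phi$. Fix a simple system $\Delta$ with positive system $\Pi$; write $\beta>0$ (resp. $\beta<0$) for $\beta\in\Pi$ (resp. $-\Pi$). $\eta$ is the highest root, $\widetilde\Delta=\Delta\cup\{-\eta\}$, and $\mathrm{Ht}:\Phi\to\mathbf{Z}$, $\sum_i m_i\alpha_i\mapsto\sum_i m_i$ ($\alpha_i\in\Delta$), is the height function (extended linearly to $V$). Let $T_c\subset T(K)$ be the maximal compact subgroup and $W=N_G(T)(K)/T_c\cong X_*(T)\rtimes W_\circ$ the extended affine Weyl group, with projection $\mathrm{pr}_\circ:W\to W_\circ$. $W$ acts on $V^*$ (the apartment of $T_{\mathrm{ad}}$ with a chosen hyperspecial origin): $W_\circ$ acts linearly and $X_*(T)$ by translations via $X_*(T)\to V^*$. $\Omega\subset W$ is the stabilizer of the alcove $\{x\in V^*:\alpha(x)>0\ (\alpha\in\Delta),\ \eta(x)<1\}$. The group $\mathrm{pr}_\circ(\Omega)$ permutes $\widetilde\Delta$. For $w\in\mathrm{pr}_\circ(\Omega)$ with $|w|\ge3$ there are (unique) $R,S\in\Delta$ with $w(S)=R$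 and $w(R)=-\eta$. For $\beta\in\Phi$ and $\alpha\in\Delta$, $\beta_\alpha$ is the $\alpha$-coefficient of $\beta$ in the basis $\Delta$. For $i,j\in\{0,1\}$, $\mathcal{F}_{i,j}=\{\beta>0:\beta_R=i,\ \beta_S=j\}$. $\Sigma_{R,S}\subset\mathcal{F}_{0,1}\times\mathcal{F}_{1,0}\times\mathcal{F}_{1,1}$ is the set of triples $(\alpha,\beta,\gamma)$ with $\alpha+\beta=\gamma$, and $\mathrm{pr}_{0,1},\mathrm{pr}_{1,0},\mathrm{pr}_{1,1}$ are its projections to the three factors. It is known that for each of these three projections all fibers (over all elements of its target) have the same size. *)

theory Defs
  imports "HOL-Analysis.Analysis"
begin

text \<open>
  A split pair \<open>(G, T)\<close> enters only through its root datum. We fix a basis of the character lattice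
  and the dual basis of the cocharacter lattice: both lattices are the integral vectors of
  \<open>real ^ 'n\<close>, both \<open>X\<^sup>*(T) \<otimes> \<real>\<close> and \<open>X\<^sub>*(T) \<otimes> \<real>\<close> are \<open>real ^ 'n\<close>, and the perfect pairing
  between them is the dot product. No invariance of the dot product under the Weyl group is assumed.
\<close>

definition integral_vectors :: "(real ^ 'n) set"
  where "integral_vectors = {x. \<forall>i. x $ i \<in> \<int>}"

definition reflection :: "(real ^ 'n \<Rightarrow> real ^ 'n) \<Rightarrow> real ^ 'n \<Rightarrow> real ^ 'n \<Rightarrow> real ^ 'n"
  where "reflection coroot \<alpha> x = x - (x \<bullet> coroot \<alpha>) *\<^sub>R \<alpha>"

definition coreflection :: "(real ^ 'n \<Rightarrow> real ^ 'n) \<Rightarrow> real ^ 'n \<Rightarrow> real ^ 'n \<Rightarrow> real ^ 'n"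
  where "coreflection coroot \<alpha> y = y - (\<alpha> \<bullet> y) *\<^sub>R coroot \<alpha>"

locale root_datum =
  fixes \<Phi> :: "(real ^ 'n) set" and coroot :: "real ^ 'n \<Rightarrow> real ^ 'n"
  assumes finite_roots: "finite \<Phi>"
    and roots_integral: "\<Phi> \<subseteq> integral_vectors"
    and coroots_integral: "coroot ` \<Phi> \<subseteq> integral_vectors"
    and inj_coroot: "inj_on coroot \<Phi>"
    and root_coroot: "\<alpha> \<in> \<Phi> \<Longrightarrow> \<alpha> \<bullet> coroot \<alpha> = 2"
    and reflection_roots: "\<alpha> \<in> \<Phi> \<Longrightarrow> reflection coroot \<alpha> ` \<Phi> \<subseteq> \<Phi>"
    and coreflection_coroots:
      "\<alpha> \<in> \<Phi> \<Longrightarrow> coreflection coroot \<alpha> ` coroot ` \<Phi> \<subseteq> coroot ` \<Phi>"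
    and reduced: "\<alpha> \<in> \<Phi> \<Longrightarrow> 2 *\<^sub>R \<alpha> \<notin> \<Phi>"

definition irreducible_roots :: "(real ^ 'n) set \<Rightarrow> (real ^ 'n \<Rightarrow> real ^ 'n) \<Rightarrow> bool"
  where "irreducible_roots \<Phi> coroot \<longleftrightarrow> \<Phi> \<noteq> {} \<and>
    \<not> (\<exists>A B. A \<noteq> {} \<and> B \<noteq> {} \<and> A \<union> B = \<Phi> \<and> A \<inter> B = {} \<and>
        (\<forall>\<alpha>\<in>A. \<forall>\<beta>\<in>B. \<alpha> \<bullet> coroot \<beta> = 0 \<and> \<beta> \<bullet> coroot \<alpha> = 0))"

definition simple_system :: "(real ^ 'n) set \<Rightarrow> (real ^ 'n) set \<Rightarrow> bool"
  where "simple_system \<Phi> \<Delta> \<longleftrightarrow> \<Delta> \<subseteq> \<Phi> \<and> independent \<Delta> \<and>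
    (\<forall>\<beta>\<in>\<Phi>. \<beta> \<in> span \<Delta> \<and> (\<forall>\<alpha>\<in>\<Delta>. representation \<Delta> \<beta> \<alpha> \<in> \<int>) \<and>
      ((\<forall>\<alpha>\<in>\<Delta>. representation \<Delta> \<beta> \<alpha> \<ge> 0) \<or> (\<forall>\<alpha>\<in>\<Delta>. representation \<Delta> \<beta> \<alpha> \<le> 0)))"

definition pos_roots :: "(real ^ 'n) set \<Rightarrow> (real ^ 'n) set \<Rightarrow> (real ^ 'n) set"
  where "pos_roots \<Phi> \<Delta> = {\<beta> \<in> \<Phi>. \<forall>\<alpha>\<in>\<Delta>. representation \<Delta> \<beta> \<alpha> \<ge> 0}"

definition neg_roots :: "(real ^ 'n) set \<Rightarrow> (real ^ 'n) set \<Rightarrow> (real ^ 'n) set"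
  where "neg_roots \<Phi> \<Delta> = uminus ` pos_roots \<Phi> \<Delta>"

definition height :: "(real ^ 'n) set \<Rightarrow> real ^ 'n \<Rightarrow> real"
  where "height \<Delta> v = (\<Sum>\<alpha>\<in>\<Delta>. representation \<Delta> v \<alpha>)"

definition highest_root :: "(real ^ 'n) set \<Rightarrow> (real ^ 'n) set \<Rightarrow> real ^ 'n"
  where "highest_root \<Phi> \<Delta> =
    (THE \<eta>. \<eta> \<in> \<Phi> \<and> (\<forall>\<beta>\<in>\<Phi>. \<forall>\<alpha>\<in>\<Delta>. representation \<Delta> \<beta> \<alpha> \<le> representation \<Delta> \<eta> \<alpha>))"

text \<open>Since \<open>G\<close> is split, \<open>N\<^sub>G(T)(K) / T(K)\<close> is the group generated by the root reflections.\<close>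

inductive_set weyl_group ::
    "(real ^ 'n) set \<Rightarrow> (real ^ 'n \<Rightarrow> real ^ 'n) \<Rightarrow> (real ^ 'n \<Rightarrow> real ^ 'n) set"
  for \<Phi> :: "(real ^ 'n) set" and coroot :: "real ^ 'n \<Rightarrow> real ^ 'n"
  where
    one: "id \<in> weyl_group \<Phi> coroot"
  | step: "\<alpha> \<in> \<Phi> \<Longrightarrow> u \<in> weyl_group \<Phi> coroot \<Longrightarrow> reflection coroot \<alpha> \<circ> u \<in> weyl_group \<Phi> coroot"

definition elt_order :: "('a \<Rightarrow> 'a) \<Rightarrow> nat"
  where "elt_order u = (LEAST k. k > 0 \<and> u ^^ k = id)"

definition coxeter_element ::
    "(real ^ 'n \<Rightarrow> real ^ 'n) \<Rightarrow> (real ^ 'n) set \<Rightarrow> (real ^ 'n \<Rightarrow> real ^ 'n) \<Rightarrow> bool"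
  where "coxeter_element coroot \<Delta> u \<longleftrightarrow>
    (\<exists>\<alpha>s. distinct \<alpha>s \<and> set \<alpha>s = \<Delta> \<and> u = foldr (\<circ>) (map (reflection coroot) \<alpha>s) id)"

text \<open>All Coxeter elements are conjugate, so the choice below is immaterial.\<close>

definition coxeter_number :: "(real ^ 'n \<Rightarrow> real ^ 'n) \<Rightarrow> (real ^ 'n) set \<Rightarrow> nat"
  where "coxeter_number coroot \<Delta> = elt_order (SOME u. coxeter_element coroot \<Delta> u)"

text \<open>The dual \<open>V\<^sup>*\<close> of \<open>V = span \<Phi>\<close>, its elements being functions with domain \<open>V\<close>.\<close>

definition dual_space :: "(real ^ 'n) set \<Rightarrow> (real ^ 'n \<Rightarrow> real) set"
  where "dual_space V = {f \<in> extensional V.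
    (\<forall>x\<in>V. \<forall>y\<in>V. f (x + y) = f x + f y) \<and> (\<forall>r. \<forall>x\<in>V. f (r *\<^sub>R x) = r * f x)}"

definition alcove :: "(real ^ 'n) set \<Rightarrow> (real ^ 'n) set \<Rightarrow> (real ^ 'n \<Rightarrow> real) set"
  where "alcove \<Phi> \<Delta> =
    {f \<in> dual_space (span \<Phi>). (\<forall>\<alpha>\<in>\<Delta>. f \<alpha> > 0) \<and> f (highest_root \<Phi> \<Delta>) < 1}"

text \<open>
  An element of \<open>W = X\<^sub>*(T) \<rtimes> W\<^sub>\<circ>\<close> is a pair \<open>(y, u)\<close>, standing for \<open>u\<close> followed by the translation
  by \<open>y\<close>; the projection to \<open>W\<^sub>\<circ>\<close> is \<^term>\<open>snd\<close>. The group \<open>W\<^sub>\<circ>\<close> acts on \<open>V\<^sup>*\<close> contragrediently.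
\<close>

definition ext_affine_weyl_group ::
    "(real ^ 'n) set \<Rightarrow> (real ^ 'n \<Rightarrow> real ^ 'n) \<Rightarrow> ((real ^ 'n) \<times> (real ^ 'n \<Rightarrow> real ^ 'n)) set"
  where "ext_affine_weyl_group \<Phi> coroot = integral_vectors \<times> weyl_group \<Phi> coroot"

definition affine_action :: "(real ^ 'n) set \<Rightarrow> (real ^ 'n) \<times> (real ^ 'n \<Rightarrow> real ^ 'n) \<Rightarrow>
    (real ^ 'n \<Rightarrow> real) \<Rightarrow> real ^ 'n \<Rightarrow> real"
  where "affine_action V g f = (\<lambda>x\<in>V. f (inv (snd g) x) + x \<bullet> fst g)"

definition alcove_stabilizer :: "(real ^ 'n) set \<Rightarrow> (real ^ 'n \<Rightarrow> real ^ 'n) \<Rightarrow> (real ^ 'n) set \<Rightarrow>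
    ((real ^ 'n) \<times> (real ^ 'n \<Rightarrow> real ^ 'n)) set"
  where "alcove_stabilizer \<Phi> coroot \<Delta> = {g \<in> ext_affine_weyl_group \<Phi> coroot.
    affine_action (span \<Phi>) g ` alcove \<Phi> \<Delta> = alcove \<Phi> \<Delta>}"

definition coeff_roots :: "(real ^ 'n) set \<Rightarrow> (real ^ 'n) set \<Rightarrow> real ^ 'n \<Rightarrow> real ^ 'n \<Rightarrow>
    nat \<Rightarrow> nat \<Rightarrow> (real ^ 'n) set"
  where "coeff_roots \<Phi> \<Delta> R S i j =
    {\<beta> \<in> pos_roots \<Phi> \<Delta>. representation \<Delta> \<beta> R = real i \<and> representation \<Delta> \<beta> S = real j}"

definition root_triples :: "(real ^ 'n) set \<Rightarrow> (real ^ 'n) set \<Rightarrow> real ^ 'n \<Rightarrow> real ^ 'n \<Rightarrow>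
    ((real ^ 'n) \<times> (real ^ 'n) \<times> (real ^ 'n)) set"
  where "root_triples \<Phi> \<Delta> R S = {(\<alpha>, \<beta>, \<gamma>).
    \<alpha> \<in> coeff_roots \<Phi> \<Delta> R S 0 1 \<and> \<beta> \<in> coeff_roots \<Phi> \<Delta> R S 1 0 \<and>
    \<gamma> \<in> coeff_roots \<Phi> \<Delta> R S 1 1 \<and> \<alpha> + \<beta> = \<gamma>}"

definition sign_roots :: "(real ^ 'n) set \<Rightarrow> (real ^ 'n) set \<Rightarrow> (real ^ 'n \<Rightarrow> real ^ 'n) \<Rightarrow>
    (real ^ 'n) set"
  where "sign_roots \<Phi> \<Delta> w =
    {\<beta> \<in> pos_roots \<Phi> \<Delta>. w \<beta> \<in> neg_roots \<Phi> \<Delta> \<and> w (w \<beta>) \<in> pos_roots \<Phi> \<Delta>}"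

definition sign_functional :: "(real ^ 'n) set \<Rightarrow> (real ^ 'n \<Rightarrow> real ^ 'n) \<Rightarrow> (real ^ 'n) set \<Rightarrow>
    (real ^ 'n \<Rightarrow> real ^ 'n) \<Rightarrow> real ^ 'n \<Rightarrow> real"
  where "sign_functional \<Phi> coroot \<Delta> w v = (\<Sum>\<beta>\<in>sign_roots \<Phi> \<Delta> w. v \<bullet> coroot \<beta>)"

end

theory Submission
  imports Defs
begin

text \<open>
  All lengths are measured with the invariant form \<open>rform x y = \<Sum>\<^sub>\<beta> \<langle>x, \<beta>\<^sup>\<or>\<rangle> \<langle>y, \<beta>\<^sup>\<or>\<rangle>\<close>, rescaled to \<open>ip\<close> so that
  \<open>\<eta>\<close> has square length 2.

  The vectors \<open>E i j\<close>, the sums of the roots in \<open>F i j\<close>, are orthogonal to all simple roots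
  except \<open>R\<close> and \<open>S\<close>. Since \<open>R\<close>, \<open>S\<close>, \<open>\<eta>\<close> are conjugate, hence long, counting the fibres over \<open>S\<close>,
  \<open>R\<close> and \<open>\<eta>\<close> computes the remaining pairings of \<open>E 0 1\<close> and \<open>E 1 0\<close> in terms of \<open>a\<close>, \<open>b\<close>, \<open>c\<close>. If
  \<open>wt R\<close>, \<open>wt S\<close> are the dual basis vectors, then \<open>wt S\<close> is the sum of \<open>wt R\<close> and its image under
  the inverse of \<open>w\<close>; as \<open>E 1 0\<close> is orthogonal to \<open>wt S\<close>, this forces \<open>a = c\<close>. A short root in
  \<open>F 1 1\<close> would have too few decompositions, so \<open>\<Phi>\<close> is simply laced; then \<open>E 1 0 + E 1 1\<close> is
  \<open>(a + b + c) wt R\<close>, and \<open>\<Sum>\<^sub>\<beta>\<^sub>>\<^sub>0 ip x \<beta> ip y \<beta>\<close> is \<open>(a + b + c) ip x y\<close>. Taking traces gives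
  \<open>2 |\<Phi>\<^sup>+| = (a + b + c) |\<Delta>|\<close>.

  That \<open>2 |\<Phi>\<^sup>+| = h |\<Delta>|\<close> for the order \<open>h\<close> of an arbitrary Coxeter element \<open>u\<close> is proved without the
  Coxeter plane. The positive roots that \<open>u\<close> makes out of negative ones are the
  \<open>gam \<alpha> = wt \<alpha> - u (wt \<alpha>)\<close>. If the orbit of \<open>gam \<alpha>\<close> first becomes negative after \<open>d \<alpha>\<close> steps, it
  does so at some \<open>- gam \<alpha>'\<close>, and since \<open>1 - u\<close> is injective, \<open>u\<^sup>d\<close> maps \<open>wt \<alpha>\<close> to \<open>- wt \<alpha>'\<close>. Hence
  \<open>\<alpha> \<mapsto> \<alpha>'\<close> is an involution, and the power of \<open>u\<close> with exponent \<open>d \<alpha> + d \<alpha>'\<close> fixes \<open>wt \<alpha>\<close>. It then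
  fixes the weights at the neighbours of \<open>\<alpha>\<close> as well, so by irreducibility it is the identity,
  and \<open>d \<alpha> + d \<alpha>' = h\<close> for every \<open>\<alpha>\<close>.
\<close>

section \<open>The invariant form of a root datum\<close>

lemma linear_reflection: "linear (reflection coroot \<alpha>)"
  by (rule linearI) (simp_all add: reflection_def inner_add_left algebra_simps)

lemma reflection_inner:
  "reflection coroot \<alpha> x \<bullet> y = x \<bullet> coreflection coroot \<alpha> y"
  by (simp add: reflection_def coreflection_def inner_diff_left inner_diff_right inner_commute)

lemma integral_vectors_inner:
  fixes x y :: "real ^ 'n"
  assumes "x \<in> integral_vectors" "y \<in> integral_vectors"
  shows "x \<bullet> y \<in> \<int>"
  using assms by (auto simp: integral_vectors_def inner_vec_def intro!: Ints_sum Ints_mult)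

lemma Ints_ge_one: "x \<in> \<int> \<Longrightarrow> x > 0 \<Longrightarrow> x \<ge> (1::real)"
  by (auto elim!: Ints_cases)

lemma Ints_less_two: "x \<in> \<int> \<Longrightarrow> x < 2 \<Longrightarrow> x \<le> (1::real)"
  by (auto elim!: Ints_cases)

context root_datum
begin

lemma inner_coroot_Ints: "\<alpha> \<in> \<Phi> \<Longrightarrow> \<beta> \<in> \<Phi> \<Longrightarrow> \<alpha> \<bullet> coroot \<beta> \<in> \<int>"
  using roots_integral coroots_integral by (intro integral_vectors_inner) auto

lemma root_nonzero: "\<alpha> \<in> \<Phi> \<Longrightarrow> \<alpha> \<noteq> 0"
  using root_coroot by fastforce

lemma reflection_reflection:
  "\<alpha> \<in> \<Phi> \<Longrightarrow> reflection coroot \<alpha> (reflection coroot \<alpha> x) = x"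
  by (simp add: reflection_def inner_diff_left root_coroot algebra_simps scaleR_2)

lemma coreflection_coreflection:
  "\<alpha> \<in> \<Phi> \<Longrightarrow> coreflection coroot \<alpha> (coreflection coroot \<alpha> x) = x"
  by (simp add: coreflection_def inner_diff_right root_coroot algebra_simps scaleR_2)

lemma reflection_self: "\<alpha> \<in> \<Phi> \<Longrightarrow> reflection coroot \<alpha> \<alpha> = - \<alpha>"
  by (simp add: reflection_def root_coroot scaleR_2)

lemma reflection_root: "\<alpha> \<in> \<Phi> \<Longrightarrow> \<beta> \<in> \<Phi> \<Longrightarrow> reflection coroot \<alpha> \<beta> \<in> \<Phi>"
  using reflection_roots by auto

lemma uminus_root: "\<alpha> \<in> \<Phi> \<Longrightarrow> - \<alpha> \<in> \<Phi>"
  using reflection_root[of \<alpha> \<alpha>] by (simp add: reflection_self)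

lemma uminus_root_iff: "- \<alpha> \<in> \<Phi> \<longleftrightarrow> \<alpha> \<in> \<Phi>"
  using uminus_root[of \<alpha>] uminus_root[of "- \<alpha>"] by auto

lemma reflection_image_roots: "\<alpha> \<in> \<Phi> \<Longrightarrow> bij_betw (reflection coroot \<alpha>) \<Phi> \<Phi>"
  by (rule bij_betw_byWitness[where f' = "reflection coroot \<alpha>"])
    (auto simp: reflection_reflection reflection_root)

lemma coreflection_image_coroots:
  "\<alpha> \<in> \<Phi> \<Longrightarrow> bij_betw (coreflection coroot \<alpha>) (coroot ` \<Phi>) (coroot ` \<Phi>)"
  using coreflection_coroots[of \<alpha>]
  by (intro bij_betw_byWitness[where f' = "coreflection coroot \<alpha>"])
    (auto simp: coreflection_coreflection)

text \<open>It stands in for the dot product, which need not be Weyl invariant. Vectors killed by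
  all coroots are isotropic for it, so definiteness is claimed only on
  \<open>span \<Phi>\<close>.\<close>

definition rform :: "real ^ 'n \<Rightarrow> real ^ 'n \<Rightarrow> real"
  where "rform x y = (\<Sum>\<beta>\<in>\<Phi>. (x \<bullet> coroot \<beta>) * (y \<bullet> coroot \<beta>))"

lemma rform_commute: "rform x y = rform y x"
  by (simp add: rform_def mult.commute)

lemma rform_add_left: "rform (x + y) z = rform x z + rform y z"
  by (simp add: rform_def inner_add_left distrib_right sum.distrib)

lemma rform_diff_left: "rform (x - y) z = rform x z - rform y z"
  by (simp add: rform_def inner_diff_left left_diff_distrib sum_subtractf)

lemma rform_minus_left: "rform (- x) z = - rform x z"
  by (simp add: rform_def sum_negf)

lemma rform_scale_left: "rform (r *\<^sub>R x) z = r * rform x z"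
  by (simp add: rform_def sum_distrib_left mult.assoc)

lemma rform_zero_left: "rform 0 z = 0"
  by (simp add: rform_def)

lemma rform_sum_left: "rform (sum f A) z = (\<Sum>i\<in>A. rform (f i) z)"
  by (induction A rule: infinite_finite_induct) (auto simp: rform_add_left rform_zero_left)

lemma rform_add_right: "rform z (x + y) = rform z x + rform z y"
  by (simp add: rform_commute[of z] rform_add_left)

lemma rform_diff_right: "rform z (x - y) = rform z x - rform z y"
  by (simp add: rform_commute[of z] rform_diff_left)

lemma rform_minus_right: "rform z (- x) = - rform z x"
  by (simp add: rform_commute[of z] rform_minus_left)

lemma rform_scale_right: "rform z (r *\<^sub>R x) = r * rform z x"
  by (simp add: rform_commute[of z] rform_scale_left)

lemma rform_zero_right: "rform z 0 = 0"
  by (simp add: rform_def)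

lemmas rform_linear = rform_add_left rform_diff_left rform_minus_left rform_scale_left
  rform_add_right rform_diff_right rform_minus_right rform_scale_right
  rform_zero_left rform_zero_right

lemma rform_nonneg: "rform x x \<ge> 0"
  by (simp add: rform_def sum_nonneg)

lemma rform_root_pos:
  assumes "\<alpha> \<in> \<Phi>" shows "rform \<alpha> \<alpha> > 0"
proof -
  have "(\<alpha> \<bullet> coroot \<alpha>) * (\<alpha> \<bullet> coroot \<alpha>) \<le> rform \<alpha> \<alpha>"
    unfolding rform_def using assms finite_roots by (intro member_le_sum) auto
  then show ?thesis using root_coroot[OF assms] by simp
qed

text \<open>As \<open>coroot\<close> is injective, the sum runs over the set of coroots, and this
  set is permuted by the coreflection, the adjoint of the reflection.\<close>

lemma rform_reflection:
  assumes "\<alpha> \<in> \<Phi>"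
  shows "rform (reflection coroot \<alpha> x) (reflection coroot \<alpha> y) = rform x y"
proof -
  have *: "rform u v = (\<Sum>z\<in>coroot ` \<Phi>. (u \<bullet> z) * (v \<bullet> z))" for u v
    unfolding rform_def by (subst sum.reindex[OF inj_coroot]) simp
  have "(\<Sum>z\<in>coroot ` \<Phi>. (x \<bullet> coreflection coroot \<alpha> z) * (y \<bullet> coreflection coroot \<alpha> z))
      = (\<Sum>z\<in>coroot ` \<Phi>. (x \<bullet> z) * (y \<bullet> z))"
    by (rule sum.reindex_bij_betw[OF coreflection_image_coroots[OF assms]])
  then show ?thesis by (simp add: * reflection_inner)
qed

text \<open>Invariance is applied to \<open>x\<close> and \<open>\<alpha>\<close>, which its own
  reflection negates; expanding the reflection of \<open>x\<close> leaves this relation.\<close>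

lemma inner_coroot_rform:
  assumes "\<alpha> \<in> \<Phi>"
  shows "(x \<bullet> coroot \<alpha>) * rform \<alpha> \<alpha> = 2 * rform x \<alpha>"
proof -
  have "rform (reflection coroot \<alpha> x) \<alpha> = rform (reflection coroot \<alpha> x) (reflection coroot \<alpha> (- \<alpha>))"
    using assms by (simp add: linear_neg[OF linear_reflection] reflection_self)
  also have "\<dots> = - rform x \<alpha>" by (simp only: rform_reflection[OF assms] rform_minus_right)
  finally show ?thesis by (simp add: reflection_def rform_linear)
qed

lemma inner_coroot_eq:
  "\<alpha> \<in> \<Phi> \<Longrightarrow> x \<bullet> coroot \<alpha> = 2 * rform x \<alpha> / rform \<alpha> \<alpha>"
  using inner_coroot_rform[of \<alpha> x] rform_root_pos[of \<alpha>] by (simp add: field_simps)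

text \<open>
  The form \<open>C\<close> on the coroot side is invariant because the reflections permute \<open>\<Phi>\<close>. It turns
  \<open>x = \<Sum> r \<beta> \<beta>\<close> into the functional \<open>C z\<close> with \<open>z\<close> in the span of the coroots, so that \<open>x\<close>
  vanishing on all coroots gives \<open>C z z = 0\<close>.
\<close>

lemma rform_definite:
  assumes "x \<in> span \<Phi>" and "rform x x = 0"
  shows "x = 0"
proof -
  define C where "C = (\<lambda>y z. \<Sum>\<gamma>\<in>\<Phi>. (\<gamma> \<bullet> y) * (\<gamma> \<bullet> z))"
  have Cadd: "C y (u + v) = C y u + C y v" for y u v
    by (simp add: C_def inner_add_right distrib_left sum.distrib)
  have Cscale: "C y (r *\<^sub>R u) = r * C y u" for y u r
    by (simp add: C_def sum_distrib_left mult_ac)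
  have Csum: "C y (sum f A) = (\<Sum>i\<in>A. C y (f i))" for y and f :: "_ \<Rightarrow> real^'n" and A
    by (induction A rule: infinite_finite_induct) (auto simp: Cadd, auto simp: C_def)
  have Ccomm: "C y z = C z y" for y z by (simp add: C_def mult.commute)
  have Cinv: "C (coreflection coroot \<alpha> y) (coreflection coroot \<alpha> z) = C y z" if "\<alpha> \<in> \<Phi>" for \<alpha> y z
  proof -
    have "(\<Sum>\<gamma>\<in>\<Phi>. (reflection coroot \<alpha> \<gamma> \<bullet> y) * (reflection coroot \<alpha> \<gamma> \<bullet> z)) = C y z"
      unfolding C_def by (rule sum.reindex_bij_betw[OF reflection_image_roots[OF that]])
    then show ?thesis by (simp add: C_def reflection_inner)
  qed
  have Cpos: "C (coroot \<alpha>) (coroot \<alpha>) > 0" if "\<alpha> \<in> \<Phi>" for \<alpha>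
  proof -
    have "(\<alpha> \<bullet> coroot \<alpha>) * (\<alpha> \<bullet> coroot \<alpha>) \<le> C (coroot \<alpha>) (coroot \<alpha>)"
      unfolding C_def using that finite_roots by (intro member_le_sum) auto
    then show ?thesis using root_coroot[OF that] by simp
  qed
  \<comment> \<open>As for \<open>rform\<close>, invariance under the coreflection that negates
    \<open>coroot \<alpha>\<close> turns pairing with \<open>\<alpha>\<close> into \<open>C\<close>
    against a multiple of \<open>coroot \<alpha>\<close>.\<close>
  have key: "\<alpha> \<bullet> y = C y ((2 / C (coroot \<alpha>) (coroot \<alpha>)) *\<^sub>R coroot \<alpha>)" if a: "\<alpha> \<in> \<Phi>" for \<alpha> y
  proof -
    have "coreflection coroot \<alpha> ((-1) *\<^sub>R coroot \<alpha>) = coroot \<alpha>"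
      using a by (simp add: coreflection_def root_coroot algebra_simps scaleR_2)
    then have "C (coreflection coroot \<alpha> y) (coroot \<alpha>) = C y ((-1) *\<^sub>R coroot \<alpha>)"
      using Cinv[OF a, of y "(-1) *\<^sub>R coroot \<alpha>"] by simp
    then have "C (coroot \<alpha>) (y + (- (\<alpha> \<bullet> y)) *\<^sub>R coroot \<alpha>) = - C y (coroot \<alpha>)"
      by (simp add: coreflection_def Ccomm[of _ "coroot \<alpha>"] Cscale[of _ "-1", simplified])
    then have "(\<alpha> \<bullet> y) * C (coroot \<alpha>) (coroot \<alpha>) = 2 * C y (coroot \<alpha>)"
      unfolding Cadd Cscale by (simp add: Ccomm[of "coroot \<alpha>" y])
    then show ?thesis using Cpos[OF a] by (simp add: Cscale field_simps)
  qed
  obtain r where r: "x = (\<Sum>\<beta>\<in>\<Phi>. r \<beta> *\<^sub>R \<beta>)"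
    using assms(1) by (auto simp: span_finite[OF finite_roots])
  define z where "z = (\<Sum>\<beta>\<in>\<Phi>. r \<beta> *\<^sub>R ((2 / C (coroot \<beta>) (coroot \<beta>)) *\<^sub>R coroot \<beta>))"
  have xz: "x \<bullet> y = C y z" for y
    unfolding r z_def Csum Cscale inner_sum_left inner_scaleR_left
    by (intro sum.cong refl) (simp add: key[of _ y] Cscale)
  have "x \<bullet> coroot \<beta> = 0" if "\<beta> \<in> \<Phi>" for \<beta>
    using assms(2) that finite_roots by (simp add: rform_def sum_nonneg_eq_0_iff)
  then have "x \<bullet> z = 0" by (simp add: z_def inner_sum_right)
  then have "C z z = 0" by (simp add: xz)
  then have "\<gamma> \<bullet> z = 0" if "\<gamma> \<in> \<Phi>" for \<gamma>
    using that finite_roots by (simp add: C_def sum_nonneg_eq_0_iff)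
  then have "C y z = 0" for y by (simp add: C_def)
  then have "x \<bullet> x = 0" by (simp add: xz)
  then show ?thesis by simp
qed

section \<open>Differences and multiples of roots\<close>

lemma rform_pos: "x \<in> span \<Phi> \<Longrightarrow> x \<noteq> 0 \<Longrightarrow> rform x x > 0"
  using rform_definite[of x] rform_nonneg[of x] by force

text \<open>If both Cartan integers were at least 2, then \<open>\<beta> - \<gamma>\<close> would
  have nonpositive square length. So one of them is 1, and the corresponding reflection produces the
  difference up to sign.\<close>

lemma diff_root:
  assumes "\<beta> \<in> \<Phi>" "\<gamma> \<in> \<Phi>" "\<beta> \<noteq> \<gamma>" "rform \<beta> \<gamma> > 0"
  shows "\<beta> - \<gamma> \<in> \<Phi>"
proof -
  have m: "\<beta> \<bullet> coroot \<gamma> > 0" "\<gamma> \<bullet> coroot \<beta> > 0"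
    using assms rform_root_pos by (auto simp: inner_coroot_eq rform_commute[of \<gamma> \<beta>])
  have "\<beta> \<bullet> coroot \<gamma> = 1 \<or> \<gamma> \<bullet> coroot \<beta> = 1"
  proof (rule ccontr)
    assume "\<not> ?thesis"
    then have "\<beta> \<bullet> coroot \<gamma> \<ge> 2" "\<gamma> \<bullet> coroot \<beta> \<ge> 2"
      using m Ints_less_two[OF inner_coroot_Ints] Ints_ge_one[OF inner_coroot_Ints] assms
      by (metis linorder_not_less order_antisym)+
    then have "rform \<beta> \<gamma> \<ge> rform \<gamma> \<gamma>" "rform \<gamma> \<beta> \<ge> rform \<beta> \<beta>"
      using assms rform_root_pos by (auto simp: inner_coroot_eq field_simps)
    then have "rform (\<beta> - \<gamma>) (\<beta> - \<gamma>) \<le> 0" by (simp add: rform_linear rform_commute[of \<gamma> \<beta>])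
    moreover have "\<beta> - \<gamma> \<in> span \<Phi>" using assms by (simp add: span_base span_diff)
    ultimately show False using rform_pos[of "\<beta> - \<gamma>"] assms(3) by simp
  qed
  then show ?thesis
  proof
    assume "\<beta> \<bullet> coroot \<gamma> = 1"
    then show ?thesis using reflection_root[of \<gamma> \<beta>] assms by (simp add: reflection_def)
  next
    assume "\<gamma> \<bullet> coroot \<beta> = 1"
    then have "\<gamma> - \<beta> \<in> \<Phi>" using reflection_root[of \<beta> \<gamma>] assms by (simp add: reflection_def)
    then show ?thesis using uminus_root by fastforce
  qed
qed

lemma inner_coroot_long_le:
  assumes "\<beta> \<in> \<Phi>" "\<gamma> \<in> \<Phi>" "\<beta> \<noteq> \<gamma>" "rform \<beta> \<beta> \<le> rform \<gamma> \<gamma>"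
  shows "\<beta> \<bullet> coroot \<gamma> \<le> 1"
proof (rule ccontr)
  assume "\<not> ?thesis"
  then have "\<beta> \<bullet> coroot \<gamma> \<ge> 2"
    using Ints_less_two[OF inner_coroot_Ints] assms by (metis linorder_not_less)
  then have "rform \<beta> \<gamma> \<ge> rform \<gamma> \<gamma>"
    using assms rform_root_pos[of \<gamma>] by (simp add: inner_coroot_eq field_simps)
  then have "rform (\<beta> - \<gamma>) (\<beta> - \<gamma>) \<le> 0"
    using assms(4) by (simp add: rform_linear rform_commute[of \<gamma> \<beta>])
  moreover have "\<beta> - \<gamma> \<in> span \<Phi>" using assms by (simp add: span_base span_diff)
  ultimately show False using rform_pos[of "\<beta> - \<gamma>"] assms(3) by simp
qed

text \<open>Pairing \<open>k *\<^sub>R \<alpha>\<close> with its own coroot writes 2 as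
  \<open>k\<close> times an integer, so \<open>k\<close> is 1 or 2, and 2 is excluded by
  \<open>reduced\<close>.\<close>

lemma multiple_root_eq_1:
  assumes "\<alpha> \<in> \<Phi>" "k *\<^sub>R \<alpha> \<in> \<Phi>" "k \<in> \<int>" "k > 0"
  shows "k = 1"
proof -
  have "k * (\<alpha> \<bullet> coroot (k *\<^sub>R \<alpha>)) = 2"
    using root_coroot[OF assms(2)] by simp
  moreover have "\<alpha> \<bullet> coroot (k *\<^sub>R \<alpha>) \<in> \<int>" using inner_coroot_Ints assms by blast
  ultimately obtain a b :: int where ab: "real_of_int a * real_of_int b = 2" "k = a"
    using assms(3) by (auto elim!: Ints_cases)
  then have "a * b = 2" by (metis of_int_eq_iff of_int_mult of_int_numeral)
  moreover have "a > 0" using ab assms(4) by simp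
  ultimately have "a \<le> 2" by (metis dvd_triv_left zdvd_imp_le zero_less_numeral)
  then have "a = 1 \<or> a = 2" using \<open>a > 0\<close> by linarith
  then show ?thesis using ab reduced[OF assms(1)] assms(2) by auto
qed

end

section \<open>Simple systems and the highest root\<close>

locale based_root_datum = root_datum \<Phi> coroot
  for \<Phi> :: "(real ^ 'n) set" and coroot :: "real ^ 'n \<Rightarrow> real ^ 'n" +
  fixes \<Delta> :: "(real ^ 'n) set"
  assumes irreducible: "irreducible_roots \<Phi> coroot"
    and simple: "simple_system \<Phi> \<Delta>"
begin

abbreviation cf :: "real ^ 'n \<Rightarrow> real ^ 'n \<Rightarrow> real"
  where "cf \<equiv> representation \<Delta>"

abbreviation pos :: "(real ^ 'n) set"
  where "pos \<equiv> pos_roots \<Phi> \<Delta>"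

abbreviation refl :: "real ^ 'n \<Rightarrow> real ^ 'n \<Rightarrow> real ^ 'n"
  where "refl \<equiv> reflection coroot"

section \<open>Coefficients and heights with respect to the simple roots\<close>

lemma simple_root: "\<alpha> \<in> \<Delta> \<Longrightarrow> \<alpha> \<in> \<Phi>"
  using simple by (auto simp: simple_system_def)

lemma independent_simple: "independent \<Delta>"
  using simple by (auto simp: simple_system_def)

lemma finite_simple: "finite \<Delta>"
  by (rule finite_subset[OF _ finite_roots]) (auto simp: simple_root)

lemma span_simple: "span \<Delta> = span \<Phi>"
proof
  show "span \<Delta> \<subseteq> span \<Phi>" by (rule span_mono) (auto simp: simple_root)
  show "span \<Phi> \<subseteq> span \<Delta>"
    using simple by (intro span_minimal) (auto simp: simple_system_def)
qed

lemma root_in_span: "\<beta> \<in> \<Phi> \<Longrightarrow> \<beta> \<in> span \<Phi>"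
  by (rule span_base)

lemma simple_in_span: "\<alpha> \<in> \<Delta> \<Longrightarrow> \<alpha> \<in> span \<Phi>"
  by (simp add: root_in_span simple_root)

lemma cf_Ints: "\<beta> \<in> \<Phi> \<Longrightarrow> \<alpha> \<in> \<Delta> \<Longrightarrow> cf \<beta> \<alpha> \<in> \<int>"
  using simple by (auto simp: simple_system_def)

lemma cf_expand: "x \<in> span \<Phi> \<Longrightarrow> (\<Sum>\<alpha>\<in>\<Delta>. cf x \<alpha> *\<^sub>R \<alpha>) = x"
  using real_vector.sum_representation_eq[OF independent_simple _ finite_simple] by (simp add: span_simple)

lemma cf_add: "x \<in> span \<Phi> \<Longrightarrow> y \<in> span \<Phi> \<Longrightarrow> cf (x + y) \<alpha> = cf x \<alpha> + cf y \<alpha>"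
  using real_vector.representation_add[OF independent_simple, of y x] by (simp add: span_simple)

lemma cf_diff: "x \<in> span \<Phi> \<Longrightarrow> y \<in> span \<Phi> \<Longrightarrow> cf (x - y) \<alpha> = cf x \<alpha> - cf y \<alpha>"
  using real_vector.representation_diff[OF independent_simple, of y x] by (simp add: span_simple)

lemma cf_minus: "x \<in> span \<Phi> \<Longrightarrow> cf (- x) \<alpha> = - cf x \<alpha>"
  using real_vector.representation_neg[OF independent_simple, of x] by (simp add: span_simple)

lemma cf_scale: "x \<in> span \<Phi> \<Longrightarrow> cf (r *\<^sub>R x) \<alpha> = r * cf x \<alpha>"
  using real_vector.representation_scale[OF independent_simple, of x r] by (simp add: span_simple)

lemma cf_zero: "cf 0 \<alpha> = 0"
  by (simp add: real_vector.representation_zero)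

lemma cf_sum: "(\<And>i. i \<in> I \<Longrightarrow> f i \<in> span \<Phi>) \<Longrightarrow> cf (sum f I) \<alpha> = (\<Sum>i\<in>I. cf (f i) \<alpha>)"
  by (induction I rule: infinite_finite_induct) (auto simp: cf_zero cf_add span_sum)

lemma cf_simple: "\<alpha> \<in> \<Delta> \<Longrightarrow> cf \<alpha> \<beta> = (if \<beta> = \<alpha> then 1 else 0)"
  using real_vector.representation_basis[OF independent_simple] by simp

lemma cf_eqI:
  assumes "x \<in> span \<Phi>" "y \<in> span \<Phi>" "\<And>\<alpha>. \<alpha> \<in> \<Delta> \<Longrightarrow> cf x \<alpha> = cf y \<alpha>"
  shows "x = y"
  using cf_expand[OF assms(1)] cf_expand[OF assms(2)] assms(3) by (metis (mono_tags, lifting) sum.cong)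

lemma linear_expand:
  assumes "linear f" "x \<in> span \<Phi>"
  shows "f x = (\<Sum>\<alpha>\<in>\<Delta>. cf x \<alpha> *\<^sub>R f \<alpha>)"
proof -
  have "f x = f (\<Sum>\<alpha>\<in>\<Delta>. cf x \<alpha> *\<^sub>R \<alpha>)" by (simp add: cf_expand assms(2))
  then show ?thesis by (simp add: linear_sum[OF assms(1)] linear_scale[OF assms(1)])
qed

lemma rform_expand: "x \<in> span \<Phi> \<Longrightarrow> rform z x = (\<Sum>\<alpha>\<in>\<Delta>. cf x \<alpha> * rform z \<alpha>)"
  using linear_expand[of "rform z" x] by (simp add: linear_iff rform_linear)

lemma height_add: "x \<in> span \<Phi> \<Longrightarrow> y \<in> span \<Phi> \<Longrightarrow> height \<Delta> (x + y) = height \<Delta> x + height \<Delta> y"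
  by (simp add: height_def cf_add sum.distrib)

lemma height_diff: "x \<in> span \<Phi> \<Longrightarrow> y \<in> span \<Phi> \<Longrightarrow> height \<Delta> (x - y) = height \<Delta> x - height \<Delta> y"
  by (simp add: height_def cf_diff sum_subtractf)

lemma height_scale: "x \<in> span \<Phi> \<Longrightarrow> height \<Delta> (r *\<^sub>R x) = r * height \<Delta> x"
  by (simp add: height_def cf_scale sum_distrib_left)

lemma height_minus: "x \<in> span \<Phi> \<Longrightarrow> height \<Delta> (- x) = - height \<Delta> x"
  by (simp add: height_def cf_minus sum_negf)

lemma height_simple: "\<alpha> \<in> \<Delta> \<Longrightarrow> height \<Delta> \<alpha> = 1"
  by (simp add: height_def cf_simple finite_simple)

section \<open>Positive roots and simple reflections\<close>

lemma pos_iff: "\<beta> \<in> pos \<longleftrightarrow> \<beta> \<in> \<Phi> \<and> (\<forall>\<alpha>\<in>\<Delta>. cf \<beta> \<alpha> \<ge> 0)"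
  by (simp add: pos_roots_def)

lemma pos_root: "\<beta> \<in> pos \<Longrightarrow> \<beta> \<in> \<Phi>"
  by (simp add: pos_iff)

lemma finite_pos: "finite pos"
  by (rule finite_subset[OF _ finite_roots]) (auto simp: pos_iff)

lemma root_cf_nonzero: "\<beta> \<in> \<Phi> \<Longrightarrow> \<exists>\<alpha>\<in>\<Delta>. cf \<beta> \<alpha> \<noteq> 0"
  using cf_eqI[of \<beta> 0] root_nonzero by (auto simp: root_in_span cf_zero span_zero)

lemma not_pos_iff: "\<beta> \<in> \<Phi> \<Longrightarrow> \<beta> \<notin> pos \<longleftrightarrow> - \<beta> \<in> pos"
proof -
  assume b: "\<beta> \<in> \<Phi>"
  have "(\<forall>\<alpha>\<in>\<Delta>. cf \<beta> \<alpha> \<ge> 0) \<or> (\<forall>\<alpha>\<in>\<Delta>. cf \<beta> \<alpha> \<le> 0)"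
    using b simple by (auto simp: simple_system_def)
  moreover have "- \<beta> \<in> pos \<longleftrightarrow> (\<forall>\<alpha>\<in>\<Delta>. cf \<beta> \<alpha> \<le> 0)"
    using b by (simp add: pos_iff uminus_root cf_minus root_in_span)
  moreover have "\<beta> \<in> pos \<longleftrightarrow> (\<forall>\<alpha>\<in>\<Delta>. cf \<beta> \<alpha> \<ge> 0)"
    using b by (simp add: pos_iff)
  ultimately show ?thesis using root_cf_nonzero[OF b] by (meson order_antisym)
qed

lemma pos_cf_pos: "\<beta> \<in> \<Phi> \<Longrightarrow> \<alpha> \<in> \<Delta> \<Longrightarrow> cf \<beta> \<alpha> > 0 \<Longrightarrow> \<beta> \<in> pos"
  using not_pos_iff[of \<beta>] by (force simp: pos_iff cf_minus root_in_span)

lemma neg_roots_iff: "\<beta> \<in> neg_roots \<Phi> \<Delta> \<longleftrightarrow> - \<beta> \<in> pos"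
  by (force simp: neg_roots_def)

lemma simple_pos: "\<alpha> \<in> \<Delta> \<Longrightarrow> \<alpha> \<in> pos"
  by (simp add: pos_iff simple_root cf_simple)

lemma refl_in_span: "\<alpha> \<in> \<Phi> \<Longrightarrow> x \<in> span \<Phi> \<Longrightarrow> refl \<alpha> x \<in> span \<Phi>"
  by (simp add: reflection_def span_diff span_scale root_in_span)

lemma cf_refl:
  assumes "\<alpha> \<in> \<Delta>" "x \<in> span \<Phi>"
  shows "cf (refl \<alpha> x) \<beta> = cf x \<beta> - (if \<beta> = \<alpha> then x \<bullet> coroot \<alpha> else 0)"
  using assms by (simp add: reflection_def cf_diff cf_scale span_scale simple_in_span cf_simple)

lemma height_refl:
  assumes "\<alpha> \<in> \<Delta>" "x \<in> span \<Phi>"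
  shows "height \<Delta> (refl \<alpha> x) = height \<Delta> x - x \<bullet> coroot \<alpha>"
  using assms by (simp add: reflection_def height_diff height_scale span_scale simple_in_span height_simple)

text \<open>A positive root supported on \<open>\<alpha>\<close> alone is a positive integral
  multiple of \<open>\<alpha>\<close>, hence \<open>\<alpha>\<close> itself by
  \<open>multiple_root_eq_1\<close>.\<close>

lemma pos_other_cf:
  assumes "\<alpha> \<in> \<Delta>" "\<beta> \<in> pos" "\<beta> \<noteq> \<alpha>"
  shows "\<exists>\<gamma>\<in>\<Delta> - {\<alpha>}. cf \<beta> \<gamma> > 0"
proof (rule ccontr)
  assume "\<not> ?thesis"
  then have z: "cf \<beta> \<gamma> = 0" if "\<gamma> \<in> \<Delta>" "\<gamma> \<noteq> \<alpha>" for \<gamma>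
    using that assms(2) by (force simp: pos_iff)
  have b: "\<beta> \<in> \<Phi>" using assms(2) by (rule pos_root)
  have eq: "\<beta> = cf \<beta> \<alpha> *\<^sub>R \<alpha>"
    using z assms by (intro cf_eqI)
      (auto simp: root_in_span b cf_scale simple_in_span span_scale cf_simple)
  have "cf \<beta> \<alpha> > 0" using root_cf_nonzero[OF b] z assms by (force simp: pos_iff less_le)
  then have "cf \<beta> \<alpha> = 1"
    using multiple_root_eq_1[of \<alpha> "cf \<beta> \<alpha>"] assms b eq by (simp add: cf_Ints simple_root)
  then show False using eq assms(3) by simp
qed

text \<open>The reflection changes only the \<open>\<alpha>\<close>-coefficient; some other
  coefficient is positive, and one positive coefficient makes a root positive.\<close>

lemma refl_pos:
  assumes "\<alpha> \<in> \<Delta>" "\<beta> \<in> pos" "\<beta> \<noteq> \<alpha>"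
  shows "refl \<alpha> \<beta> \<in> pos"
proof -
  obtain \<gamma> where "\<gamma> \<in> \<Delta> - {\<alpha>}" "cf \<beta> \<gamma> > 0" using pos_other_cf[OF assms] by blast
  then show ?thesis using assms
    by (intro pos_cf_pos[of _ \<gamma>]) (auto simp: reflection_root simple_root pos_root cf_refl root_in_span)
qed

lemma simple_rform_nonpos:
  assumes "\<alpha> \<in> \<Delta>" "\<beta> \<in> \<Delta>" "\<alpha> \<noteq> \<beta>"
  shows "rform \<alpha> \<beta> \<le> 0"
proof -
  have "refl \<beta> \<alpha> \<in> pos" using refl_pos[of \<beta> \<alpha>] assms simple_pos by blast
  then have "cf (refl \<beta> \<alpha>) \<beta> \<ge> 0" using assms by (simp add: pos_iff)
  then have "\<alpha> \<bullet> coroot \<beta> \<le> 0" using assms by (simp add: cf_refl simple_in_span cf_simple)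
  then show ?thesis using assms rform_root_pos[of \<beta>]
    by (simp add: inner_coroot_eq simple_root divide_le_0_iff)
qed

lemma simple_inner_coroot_nonpos:
  "\<alpha> \<in> \<Delta> \<Longrightarrow> \<beta> \<in> \<Delta> \<Longrightarrow> \<alpha> \<noteq> \<beta> \<Longrightarrow> \<alpha> \<bullet> coroot \<beta> \<le> 0"
  using simple_rform_nonpos[of \<alpha> \<beta>] rform_root_pos[of \<beta>]
  by (simp add: inner_coroot_eq simple_root divide_nonpos_pos)

section \<open>Connectedness of the Dynkin diagram\<close>

lemma simple_nonempty: "\<Delta> \<noteq> {}"
  using irreducible root_cf_nonzero by (force simp: irreducible_roots_def)

lemma pos_height_pos: "\<beta> \<in> pos \<Longrightarrow> height \<Delta> \<beta> \<ge> 1"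
proof -
  assume b: "\<beta> \<in> pos"
  then obtain \<alpha> where a: "\<alpha> \<in> \<Delta>" "cf \<beta> \<alpha> \<noteq> 0" using root_cf_nonzero pos_root by blast
  then have "cf \<beta> \<alpha> \<ge> 1" using b by (intro Ints_ge_one) (auto simp: cf_Ints pos_iff less_le)
  moreover have "cf \<beta> \<alpha> \<le> height \<Delta> \<beta>"
    unfolding height_def using a b finite_simple by (intro member_le_sum) (auto simp: pos_iff)
  ultimately show ?thesis by simp
qed

lemma height_Ints: "\<beta> \<in> \<Phi> \<Longrightarrow> height \<Delta> \<beta> \<in> \<int>"
  by (auto simp: height_def cf_Ints intro!: Ints_sum)

text \<open>
  A positive root of minimal height whose support meets both \<open>J\<close> and its complement could be
  lowered by a simple reflection, which would leave only one of its two orthogonal components.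
\<close>

lemma pos_support_component:
  assumes J: "J \<subseteq> \<Delta>" and orth: "\<And>\<alpha> \<beta>. \<alpha> \<in> J \<Longrightarrow> \<beta> \<in> \<Delta> - J \<Longrightarrow> rform \<alpha> \<beta> = 0"
    and "\<beta> \<in> pos"
  shows "(\<forall>\<alpha>\<in>J. cf \<beta> \<alpha> = 0) \<or> (\<forall>\<alpha>\<in>\<Delta> - J. cf \<beta> \<alpha> = 0)"
  using assms(3)
proof (induction "nat \<lfloor>height \<Delta> \<beta>\<rfloor>" arbitrary: \<beta> rule: less_induct)
  case less
  have b: "\<beta> \<in> \<Phi>" using less.prems by (rule pos_root)
  \<comment> \<open>The terms \<open>cf \<beta> \<alpha> * rform \<beta> \<alpha>\<close> add up to
    \<open>rform \<beta> \<beta> > 0\<close>, so one of them is positive.\<close>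
  have "\<exists>\<alpha>\<in>\<Delta>. rform \<beta> \<alpha> > 0 \<and> cf \<beta> \<alpha> > 0"
  proof (rule ccontr)
    assume "\<not> ?thesis"
    then have "cf \<beta> \<alpha> * rform \<beta> \<alpha> \<le> 0" if "\<alpha> \<in> \<Delta>" for \<alpha>
      using that less.prems by (cases "cf \<beta> \<alpha> = 0") (force simp: pos_iff mult_nonneg_nonpos)+
    then have "rform \<beta> \<beta> \<le> 0" using rform_expand[OF root_in_span[OF b]] by (simp add: sum_nonpos)
    then show False using rform_root_pos[OF b] by simp
  qed
  then obtain \<alpha> where a: "\<alpha> \<in> \<Delta>" "rform \<beta> \<alpha> > 0" "cf \<beta> \<alpha> > 0" by blast
  show ?case
  proof (cases "\<beta> = \<alpha>")
    case True
    then show ?thesis using a J by (auto simp: cf_simple)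
  next
    case False
    define \<beta>' where "\<beta>' = refl \<alpha> \<beta>"
    have k: "\<beta> \<bullet> coroot \<alpha> > 0" using a rform_root_pos[of \<alpha>] by (simp add: inner_coroot_eq simple_root)
    then have k1: "\<beta> \<bullet> coroot \<alpha> \<ge> 1" using b a by (intro Ints_ge_one inner_coroot_Ints) (auto simp: simple_root)
    have p: "\<beta>' \<in> pos" unfolding \<beta>'_def using refl_pos a less.prems False by blast
    have ht: "height \<Delta> \<beta>' \<le> height \<Delta> \<beta> - 1"
      using k1 a b by (simp add: \<beta>'_def height_refl root_in_span)
    then have "nat \<lfloor>height \<Delta> \<beta>'\<rfloor> < nat \<lfloor>height \<Delta> \<beta>\<rfloor>"
      using pos_height_pos[OF p] pos_height_pos[OF less.prems] by linarith
    then have IH: "(\<forall>\<alpha>\<in>J. cf \<beta>' \<alpha> = 0) \<or> (\<forall>\<alpha>\<in>\<Delta> - J. cf \<beta>' \<alpha> = 0)"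
      using less.hyps p by blast
    have cf': "cf \<beta>' \<gamma> = cf \<beta> \<gamma>" if "\<gamma> \<noteq> \<alpha>" for \<gamma>
      using that a b by (simp add: \<beta>'_def cf_refl root_in_span)
    \<comment> \<open>Hence the support of \<open>\<beta>'\<close> contains some
      \<open>\<delta>\<close> not orthogonal to \<open>\<alpha>\<close>, which lies on the same side
      of \<open>J\<close> as \<open>\<alpha>\<close> and decides which alternative of the induction
      hypothesis holds.\<close>
    have "rform \<beta>' \<alpha> \<noteq> 0"
    proof -
      have "rform \<beta>' \<alpha> = rform \<beta>' (refl \<alpha> (- \<alpha>))"
        using a by (simp add: linear_neg[OF linear_reflection] reflection_self simple_root)
      also have "\<dots> = - rform \<beta> \<alpha>"
        unfolding \<beta>'_def using a by (simp only: rform_reflection simple_root rform_minus_right)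
      finally show ?thesis using a by simp
    qed
    then obtain \<delta> where d: "\<delta> \<in> \<Delta>" "cf \<beta>' \<delta> \<noteq> 0" "rform \<alpha> \<delta> \<noteq> 0"
      using rform_expand[OF root_in_span[OF pos_root[OF p]], of \<alpha>]
      by (metis (no_types, lifting) mult_zero_left mult_zero_right rform_commute sum.neutral)
    show ?thesis
    proof (cases "\<alpha> \<in> J")
      case True
      then have "\<delta> \<in> J" using orth d by blast
      then have "\<forall>\<gamma>\<in>\<Delta> - J. cf \<beta>' \<gamma> = 0" using IH d by blast
      then have "\<forall>\<gamma>\<in>\<Delta> - J. cf \<beta> \<gamma> = 0" using cf' True by (metis DiffD2)
      then show ?thesis by blast
    next
      case False
      then have "\<delta> \<notin> J" using orth[of \<delta> \<alpha>] a d by (auto simp: rform_commute[of \<delta>])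
      then have "\<forall>\<gamma>\<in>J. cf \<beta>' \<gamma> = 0" using IH d by blast
      then show ?thesis using cf' False by metis
    qed
  qed
qed

text \<open>Otherwise the roots supported in \<open>J\<close> and those supported in its complement
  would split \<open>\<Phi>\<close> into two nonempty orthogonal parts. It serves as a propagation
  principle: a nonempty set of simple roots closed under passing to neighbours is all of
  \<open>\<Delta>\<close>.\<close>

lemma simple_connected:
  assumes J: "J \<subseteq> \<Delta>" and ne: "J \<noteq> {}"
    and orth: "\<And>\<alpha> \<beta>. \<alpha> \<in> J \<Longrightarrow> \<beta> \<in> \<Delta> - J \<Longrightarrow> rform \<alpha> \<beta> = 0"
  shows "J = \<Delta>"
proof (rule ccontr)
  assume "J \<noteq> \<Delta>"
  define A where "A = {\<beta>\<in>\<Phi>. \<forall>\<alpha>\<in>\<Delta> - J. cf \<beta> \<alpha> = 0}"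
  define A' where "A' = {\<beta>\<in>\<Phi>. \<forall>\<alpha>\<in>J. cf \<beta> \<alpha> = 0}"
  have "\<beta> \<in> A \<union> A'" if b: "\<beta> \<in> \<Phi>" for \<beta>
  proof (cases "\<beta> \<in> pos")
    case True
    then show ?thesis using pos_support_component[OF J orth, of \<beta>] b by (auto simp: A_def A'_def)
  next
    case False
    then show ?thesis using pos_support_component[OF J orth, of "- \<beta>"] b not_pos_iff[OF b]
      by (auto simp: A_def A'_def cf_minus root_in_span)
  qed
  then have un: "A \<union> A' = \<Phi>" by (auto simp: A_def A'_def)
  have dis: "A \<inter> A' = {}" using root_cf_nonzero by (fastforce simp: A_def A'_def)
  have B0: "rform \<beta> \<gamma> = 0" if "\<beta> \<in> A" "\<gamma> \<in> A'" for \<beta> \<gamma>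
  proof -
    have "rform \<beta> \<delta> = 0" if "\<delta> \<in> \<Delta> - J" for \<delta>
    proof -
      have "cf \<beta> \<epsilon> * rform \<delta> \<epsilon> = 0" if "\<epsilon> \<in> \<Delta>" for \<epsilon>
        using that \<open>\<beta> \<in> A\<close> \<open>\<delta> \<in> \<Delta> - J\<close> orth[of \<epsilon> \<delta>] by (auto simp: A_def rform_commute[of \<delta>])
      then have "(\<Sum>\<epsilon>\<in>\<Delta>. cf \<beta> \<epsilon> * rform \<delta> \<epsilon>) = 0" by (rule sum.neutral[rule_format])
      then have "rform \<delta> \<beta> = 0"
        using rform_expand[of \<beta> \<delta>] \<open>\<beta> \<in> A\<close> by (metis (no_types, lifting) A_def mem_Collect_eq root_in_span)
      then show ?thesis by (simp add: rform_commute)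
    qed
    then have "cf \<gamma> \<delta> * rform \<beta> \<delta> = 0" if "\<delta> \<in> \<Delta>" for \<delta>
      using that \<open>\<gamma> \<in> A'\<close> by (auto simp: A'_def)
    then have "(\<Sum>\<epsilon>\<in>\<Delta>. cf \<gamma> \<epsilon> * rform \<beta> \<epsilon>) = 0" by (rule sum.neutral[rule_format])
    then show ?thesis
      using rform_expand[of \<gamma> \<beta>] \<open>\<gamma> \<in> A'\<close> by (metis (no_types, lifting) A'_def mem_Collect_eq root_in_span)
  qed
  have "\<alpha> \<bullet> coroot \<beta> = 0 \<and> \<beta> \<bullet> coroot \<alpha> = 0" if "\<alpha> \<in> A" "\<beta> \<in> A'" for \<alpha> \<beta>
    using that B0[OF that] by (auto simp: inner_coroot_eq A_def A'_def rform_commute[of \<beta> \<alpha>])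
  moreover obtain \<alpha> \<alpha>' where "\<alpha> \<in> J" "\<alpha>' \<in> \<Delta> - J" using ne J \<open>J \<noteq> \<Delta>\<close> by blast
  then have "\<alpha> \<in> A" "\<alpha>' \<in> A'" using J by (auto simp: A_def A'_def cf_simple simple_root subset_iff)
  then have "A \<noteq> {}" "A' \<noteq> {}" by auto
  ultimately show False using irreducible un dis unfolding irreducible_roots_def by blast
qed

section \<open>Dominant roots and the highest root\<close>

definition dominant :: "real ^ 'n \<Rightarrow> bool"
  where "dominant x \<longleftrightarrow> x \<in> span \<Phi> \<and> (\<forall>\<alpha>\<in>\<Delta>. x \<bullet> coroot \<alpha> \<ge> 0)"

lemma dominant_rform: "dominant x \<Longrightarrow> \<alpha> \<in> \<Delta> \<Longrightarrow> rform x \<alpha> \<ge> 0"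
  using rform_root_pos[of \<alpha>]
  by (auto simp: dominant_def inner_coroot_eq simple_root zero_le_divide_iff)

lemma dominant_rform_nonneg:
  assumes "dominant x" "y \<in> span \<Phi>" "\<And>\<alpha>. \<alpha> \<in> \<Delta> \<Longrightarrow> cf y \<alpha> \<ge> 0"
  shows "rform x y \<ge> 0"
  using assms dominant_rform by (simp add: rform_expand sum_nonneg)

text \<open>For a simple root \<open>\<beta>\<close> outside the support \<open>J\<close> of
  \<open>\<mu>\<close>, every term in the expansion of \<open>rform \<beta> \<mu>\<close> is
  nonpositive, while dominance makes the sum nonnegative. So all terms vanish, \<open>J\<close> is
  orthogonal to its complement, and connectedness applies.\<close>

lemma dominant_root_full_support:
  assumes m: "\<mu> \<in> \<Phi>" and dom: "dominant \<mu>" and "\<alpha> \<in> \<Delta>"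
  shows "cf \<mu> \<alpha> \<ge> 1"
proof -
  have p: "\<mu> \<in> pos"
  proof (rule ccontr)
    assume "\<mu> \<notin> pos"
    then have "- \<mu> \<in> pos" using not_pos_iff m by blast
    then have "rform \<mu> (- \<mu>) \<ge> 0"
      using dominant_rform_nonneg[OF dom] root_in_span pos_root by (meson pos_iff)
    then show False using rform_root_pos[OF m] by (simp add: rform_linear)
  qed
  define J where "J = {\<alpha>\<in>\<Delta>. cf \<mu> \<alpha> \<noteq> 0}"
  have "J = \<Delta>"
  proof (rule simple_connected)
    show "J \<noteq> {}" using root_cf_nonzero[OF m] by (auto simp: J_def)
    show "rform \<gamma> \<beta> = 0" if "\<gamma> \<in> J" "\<beta> \<in> \<Delta> - J" for \<gamma> \<beta>
    proof -
      have np: "cf \<mu> \<delta> * rform \<beta> \<delta> \<le> 0" if "\<delta> \<in> \<Delta>" for \<delta>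
        using that p simple_rform_nonpos[of \<beta> \<delta>] \<open>\<beta> \<in> \<Delta> - J\<close>
        by (cases "\<delta> = \<beta>") (auto simp: J_def pos_iff mult_nonneg_nonpos)
      have "(\<Sum>\<delta>\<in>\<Delta>. cf \<mu> \<delta> * rform \<beta> \<delta>) \<ge> 0"
        using dominant_rform[OF dom, of \<beta>] that rform_expand[of \<mu> \<beta>] m
        by (simp add: root_in_span rform_commute[of \<beta> \<mu>])
      moreover have "(\<Sum>\<delta>\<in>\<Delta>. cf \<mu> \<delta> * rform \<beta> \<delta>) \<le> 0" using np by (simp add: sum_nonpos)
      ultimately have "(\<Sum>\<delta>\<in>\<Delta>. - (cf \<mu> \<delta> * rform \<beta> \<delta>)) = 0" by (simp add: sum_negf)
      then have "\<forall>\<delta>\<in>\<Delta>. - (cf \<mu> \<delta> * rform \<beta> \<delta>) = 0"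
        using np finite_simple by (subst (asm) sum_nonneg_eq_0_iff) auto
      then show ?thesis using that by (auto simp: J_def rform_commute[of \<gamma>])
    qed
  qed (auto simp: J_def)
  then have "cf \<mu> \<alpha> > 0" using p assms(3) by (force simp: J_def pos_iff less_le)
  then show ?thesis using m assms(3) by (intro Ints_ge_one cf_Ints)
qed

text \<open>An element of maximal height works: a negative pairing with a simple coroot would give a
  reflected element of \<open>X\<close> of larger height.\<close>

lemma ex_dominant_root:
  assumes "X \<subseteq> \<Phi>" "X \<noteq> {}"
    and up: "\<And>\<mu> \<alpha>. \<mu> \<in> X \<Longrightarrow> \<alpha> \<in> \<Delta> \<Longrightarrow> \<mu> \<bullet> coroot \<alpha> < 0 \<Longrightarrow> refl \<alpha> \<mu> \<in> X"
  obtains \<mu> where "\<mu> \<in> X" "dominant \<mu>" "\<And>\<beta>. \<beta> \<in> X \<Longrightarrow> height \<Delta> \<beta> \<le> height \<Delta> \<mu>"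
proof -
  have "finite X" using assms(1) finite_roots by (rule finite_subset)
  then have "Max (height \<Delta> ` X) \<in> height \<Delta> ` X" using assms(2) by simp
  then obtain \<mu> where "\<mu> \<in> X" and max: "Max (height \<Delta> ` X) = height \<Delta> \<mu>" by auto
  have m: "\<mu> \<in> X" "\<And>\<beta>. \<beta> \<in> X \<Longrightarrow> height \<Delta> \<beta> \<le> height \<Delta> \<mu>"
    using \<open>finite X\<close> \<open>\<mu> \<in> X\<close> by (auto simp flip: max)
  have "\<mu> \<bullet> coroot \<alpha> \<ge> 0" if "\<alpha> \<in> \<Delta>" for \<alpha>
  proof (rule ccontr)
    assume n: "\<not> ?thesis"
    then have "refl \<alpha> \<mu> \<in> X" using up[of \<mu> \<alpha>] m that by simp
    then have "height \<Delta> (refl \<alpha> \<mu>) \<le> height \<Delta> \<mu>" by (rule m)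
    then show False using n m assms(1) that by (auto simp: height_refl root_in_span)
  qed
  then have "dominant \<mu>" using m assms(1) by (auto simp: dominant_def root_in_span)
  then show thesis using that m by blast
qed

lemma ex_dominant_root_same_length:
  assumes "\<beta> \<in> \<Phi>"
  obtains \<mu> where "\<mu> \<in> \<Phi>" "dominant \<mu>" "rform \<mu> \<mu> = rform \<beta> \<beta>"
  by (rule ex_dominant_root[of "{\<mu>\<in>\<Phi>. rform \<mu> \<mu> = rform \<beta> \<beta>}"])
    (use assms in \<open>auto simp: reflection_root simple_root rform_reflection\<close>)

abbreviation \<eta> :: "real ^ 'n"
  where "\<eta> \<equiv> highest_root \<Phi> \<Delta>"

text \<open>Let \<open>\<theta>\<close> be a dominant root of maximal height. Every root lies
  coefficientwise below some dominant root \<open>\<mu>\<close>. As \<open>\<mu>\<close> has full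
  support, it pairs positively with \<open>\<theta>\<close>, so \<open>\<theta> - \<mu>\<close> is
  zero or a root, and maximality of the height makes that root positive.\<close>

lemma highest_root_props:
  shows highest_root: "\<eta> \<in> \<Phi>"
    and highest_root_ge: "\<And>\<beta> \<alpha>. \<beta> \<in> \<Phi> \<Longrightarrow> \<alpha> \<in> \<Delta> \<Longrightarrow> cf \<beta> \<alpha> \<le> cf \<eta> \<alpha>"
    and highest_root_dominant: "dominant \<eta>"
proof -
  have "\<Phi> \<noteq> {}" using irreducible by (simp add: irreducible_roots_def)
  then obtain \<theta> where t: "\<theta> \<in> \<Phi>" "dominant \<theta>" "\<And>\<beta>. \<beta> \<in> \<Phi> \<Longrightarrow> height \<Delta> \<beta> \<le> height \<Delta> \<theta>"
    using ex_dominant_root[of \<Phi>] by (metis order_refl reflection_root simple_root)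
  have ge: "\<forall>\<alpha>\<in>\<Delta>. cf \<beta> \<alpha> \<le> cf \<theta> \<alpha>" if b: "\<beta> \<in> \<Phi>" for \<beta>
  proof -
    obtain \<mu> where m: "\<mu> \<in> \<Phi>" "\<forall>\<alpha>\<in>\<Delta>. cf \<beta> \<alpha> \<le> cf \<mu> \<alpha>" "dominant \<mu>"
    proof (rule ex_dominant_root[of "{\<mu>\<in>\<Phi>. \<forall>\<alpha>\<in>\<Delta>. cf \<beta> \<alpha> \<le> cf \<mu> \<alpha>}"])
      fix \<mu> \<alpha> assume m: "\<mu> \<in> {\<mu>\<in>\<Phi>. \<forall>\<alpha>\<in>\<Delta>. cf \<beta> \<alpha> \<le> cf \<mu> \<alpha>}" "\<alpha> \<in> \<Delta>" "\<mu> \<bullet> coroot \<alpha> < 0"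
      have "cf \<beta> \<gamma> \<le> cf (refl \<alpha> \<mu>) \<gamma>" if "\<gamma> \<in> \<Delta>" for \<gamma>
      proof -
        have "cf \<beta> \<gamma> \<le> cf \<mu> \<gamma>" using m that by blast
        then show ?thesis using m by (auto simp: cf_refl root_in_span)
      qed
      then show "refl \<alpha> \<mu> \<in> {\<mu>\<in>\<Phi>. \<forall>\<alpha>\<in>\<Delta>. cf \<beta> \<alpha> \<le> cf \<mu> \<alpha>}"
        using m by (simp add: reflection_root simple_root)
    qed (use b in auto)
    show ?thesis
    proof (cases "\<mu> = \<theta>")
      case True then show ?thesis using m by blast
    next
      case False
      have "rform \<mu> \<theta> > 0"
      proof -
        have "rform \<theta> \<theta> = (\<Sum>\<alpha>\<in>\<Delta>. cf \<theta> \<alpha> * rform \<theta> \<alpha>)" using t by (simp add: rform_expand root_in_span)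
        moreover have "rform \<theta> \<theta> > 0" by (rule rform_root_pos[OF t(1)])
        ultimately obtain \<alpha> where a: "\<alpha> \<in> \<Delta>" "rform \<theta> \<alpha> \<noteq> 0"
          by (metis (no_types, lifting) less_irrefl mult_zero_right sum.neutral)
        have c: "cf \<mu> \<gamma> > 0" if "\<gamma> \<in> \<Delta>" for \<gamma>
          using dominant_root_full_support[OF m(1,3) that] by simp
        have "(\<Sum>\<alpha>\<in>\<Delta>. cf \<mu> \<alpha> * rform \<theta> \<alpha>) > 0"
        proof (rule sum_pos2[OF finite_simple a(1)])
          show "0 < cf \<mu> \<alpha> * rform \<theta> \<alpha>" using a c dominant_rform[OF t(2) a(1)] by simp
          show "0 \<le> cf \<mu> \<gamma> * rform \<theta> \<gamma>" if "\<gamma> \<in> \<Delta>" for \<gamma>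
            using c[OF that] dominant_rform[OF t(2) that] by simp
        qed
        then show ?thesis using m by (simp add: rform_expand root_in_span rform_commute[of \<mu> \<theta>])
      qed
      then have d: "\<theta> - \<mu> \<in> \<Phi>" using diff_root[of \<theta> \<mu>] t m False by (simp add: rform_commute)
      have "\<theta> - \<mu> \<in> pos"
      proof (rule ccontr)
        assume "\<theta> - \<mu> \<notin> pos"
        then have "\<mu> - \<theta> \<in> pos" using not_pos_iff[OF d] by simp
        then have "height \<Delta> (\<mu> - \<theta>) \<ge> 1" by (rule pos_height_pos)
        then show False using t(3)[OF m(1)] t m by (simp add: height_diff root_in_span)
      qed
      then show ?thesis using m t by (fastforce simp: pos_iff cf_diff root_in_span)
    qed
  qed
  have "\<eta> = \<theta>" unfolding highest_root_def
  proof (rule the_equality)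
    show "\<theta> \<in> \<Phi> \<and> (\<forall>\<beta>\<in>\<Phi>. \<forall>\<alpha>\<in>\<Delta>. cf \<beta> \<alpha> \<le> cf \<theta> \<alpha>)" using t ge by blast
    show "x = \<theta>" if "x \<in> \<Phi> \<and> (\<forall>\<beta>\<in>\<Phi>. \<forall>\<alpha>\<in>\<Delta>. cf \<beta> \<alpha> \<le> cf x \<alpha>)" for x
      using that ge t by (intro cf_eqI) (auto simp: root_in_span intro: order_antisym)
  qed
  then show "\<eta> \<in> \<Phi>" "\<And>\<beta> \<alpha>. \<beta> \<in> \<Phi> \<Longrightarrow> \<alpha> \<in> \<Delta> \<Longrightarrow> cf \<beta> \<alpha> \<le> cf \<eta> \<alpha>" "dominant \<eta>"
    using t ge by auto
qed

lemma highest_root_cf: "\<alpha> \<in> \<Delta> \<Longrightarrow> cf \<eta> \<alpha> \<ge> 1"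
  using dominant_root_full_support highest_root highest_root_dominant by blast

lemma highest_root_pos: "\<eta> \<in> pos"
  using highest_root highest_root_cf by (force simp: pos_iff)

text \<open>For a dominant \<open>\<mu>\<close> of the given length, \<open>\<eta> - \<mu>\<close>
  has nonnegative coefficients; pairing it with \<open>\<eta>\<close> and with \<open>\<mu>\<close>
  gives \<open>rform \<mu> \<mu> \<le> rform \<mu> \<eta> \<le> rform \<eta> \<eta>\<close>.\<close>

lemma highest_root_long:
  assumes "\<beta> \<in> \<Phi>" shows "rform \<beta> \<beta> \<le> rform \<eta> \<eta>"
proof -
  obtain \<mu> where m: "\<mu> \<in> \<Phi>" "dominant \<mu>" "rform \<mu> \<mu> = rform \<beta> \<beta>"
    using ex_dominant_root_same_length[OF assms] .
  have d: "\<eta> - \<mu> \<in> span \<Phi>" "\<And>\<alpha>. \<alpha> \<in> \<Delta> \<Longrightarrow> cf (\<eta> - \<mu>) \<alpha> \<ge> 0"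
    using m highest_root highest_root_ge by (auto simp: span_diff root_in_span cf_diff)
  have "rform \<eta> (\<eta> - \<mu>) \<ge> 0" "rform \<mu> (\<eta> - \<mu>) \<ge> 0"
    using dominant_rform_nonneg d m highest_root_dominant by blast+
  then show ?thesis using m(3) by (simp add: rform_linear rform_commute[of \<mu> \<eta>])
qed

end

section \<open>Words in reflections and fundamental weights\<close>

context based_root_datum
begin

definition word :: "(real ^ 'n) list \<Rightarrow> real ^ 'n \<Rightarrow> real ^ 'n"
  where "word xs = foldr (\<circ>) (map refl xs) id"

lemma word_Nil: "word [] x = x"
  by (simp add: word_def)

lemma word_Cons: "word (\<alpha> # xs) x = refl \<alpha> (word xs x)"
  by (simp add: word_def)

lemma word_append: "word (xs @ ys) x = word xs (word ys x)"
  by (induction xs) (auto simp: word_Nil word_Cons)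

lemma word_power: "(word xs ^^ k) x = word (concat (replicate k xs)) x"
  by (induction k) (auto simp: word_Nil word_append)

lemma linear_word: "linear (word xs)"
proof (induction xs)
  case Nil
  then show ?case by (simp add: linear_iff word_Nil)
next
  case (Cons \<alpha> xs)
  have "word (\<alpha> # xs) = refl \<alpha> \<circ> word xs" by (auto simp: word_Cons)
  then show ?case using linear_compose[OF Cons linear_reflection] by (simp only:)
qed

lemmas word_linear = linear_add[OF linear_word] linear_diff[OF linear_word]
  linear_neg[OF linear_word] linear_scale[OF linear_word] linear_sum[OF linear_word]
  linear_0[OF linear_word]

lemma word_root: "set xs \<subseteq> \<Phi> \<Longrightarrow> \<beta> \<in> \<Phi> \<Longrightarrow> word xs \<beta> \<in> \<Phi>"
  by (induction xs) (auto simp: word_Nil word_Cons reflection_root)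

lemma word_in_span: "set xs \<subseteq> \<Phi> \<Longrightarrow> x \<in> span \<Phi> \<Longrightarrow> word xs x \<in> span \<Phi>"
  by (induction xs) (auto simp: word_Nil word_Cons refl_in_span)

lemma rform_word: "set xs \<subseteq> \<Phi> \<Longrightarrow> rform (word xs x) (word xs y) = rform x y"
  by (induction xs) (auto simp: word_Nil word_Cons rform_reflection)

lemma word_rev_word: "set xs \<subseteq> \<Phi> \<Longrightarrow> word (rev xs) (word xs x) = x"
  by (induction xs arbitrary: x) (auto simp: word_Nil word_Cons word_append reflection_reflection)

lemma word_word_rev: "set xs \<subseteq> \<Phi> \<Longrightarrow> word xs (word (rev xs) x) = x"
  using word_rev_word[of "rev xs" x] by simp

lemma word_refl:
  assumes "set xs \<subseteq> \<Phi>" "\<alpha> \<in> \<Phi>"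
  shows "word xs (refl \<alpha> x) = refl (word xs \<alpha>) (word xs x)"
proof -
  have "word xs x \<bullet> coroot (word xs \<alpha>) = x \<bullet> coroot \<alpha>"
    using assms by (simp add: inner_coroot_eq word_root rform_word)
  then show ?thesis by (simp add: reflection_def word_linear)
qed

lemma simple_subset_roots: "set xs \<subseteq> \<Delta> \<Longrightarrow> set xs \<subseteq> \<Phi>"
  using simple_root by blast

lemma cf_word:
  assumes "set xs \<subseteq> \<Delta>" "\<alpha> \<notin> set xs" "x \<in> span \<Phi>"
  shows "cf (word xs x) \<alpha> = cf x \<alpha>"
  using assms
  by (induction xs) (auto simp: word_Nil word_Cons cf_refl word_in_span[OF simple_subset_roots])

text \<open>The exchange condition. Letters are applied from the right; where the image of
  \<open>\<alpha>\<close> turns negative, it must have been equal to the letter just applied, and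
  deleting that letter absorbs the reflection in \<open>\<alpha>\<close>.\<close>

lemma word_exchange:
  assumes "set xs \<subseteq> \<Delta>" "\<alpha> \<in> \<Delta>" "word xs \<alpha> \<notin> pos"
  shows "\<exists>ys. set ys \<subseteq> \<Delta> \<and> length ys < length xs \<and> (\<forall>x. word xs (refl \<alpha> x) = word ys x)"
  using assms
proof (induction xs)
  case Nil
  then show ?case by (simp add: word_Nil simple_pos)
next
  case (Cons \<beta> xs)
  have sub: "set xs \<subseteq> \<Phi>" using Cons.prems simple_root by auto
  show ?case
  proof (cases "word xs \<alpha> \<in> pos")
    case True
    then have "word xs \<alpha> = \<beta>" using Cons.prems refl_pos by (auto simp: word_Cons)
    then have "word (\<beta> # xs) (refl \<alpha> x) = word xs x" for x
      using Cons.prems sub by (simp add: word_Cons word_refl simple_root reflection_reflection)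
    then show ?thesis using Cons.prems by (intro exI[of _ xs]) auto
  next
    case False
    then obtain ys where "set ys \<subseteq> \<Delta>" "length ys < length xs" "\<forall>x. word xs (refl \<alpha> x) = word ys x"
      using Cons by auto
    then show ?thesis using Cons.prems by (intro exI[of _ "\<beta> # ys"]) (auto simp: word_Cons)
  qed
qed

section \<open>The cone of the simple roots\<close>

definition cone :: "(real ^ 'n) set"
  where "cone = {x \<in> span \<Phi>. \<forall>\<alpha>\<in>\<Delta>. cf x \<alpha> \<ge> 0}"

lemma pos_cone: "\<beta> \<in> pos \<Longrightarrow> \<beta> \<in> cone"
  by (simp add: cone_def pos_iff root_in_span)

lemma root_pos_iff_cone: "\<beta> \<in> \<Phi> \<Longrightarrow> \<beta> \<in> pos \<longleftrightarrow> \<beta> \<in> cone"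
  by (simp add: cone_def pos_iff root_in_span)

lemma cone_add: "x \<in> cone \<Longrightarrow> y \<in> cone \<Longrightarrow> x + y \<in> cone"
  by (simp add: cone_def span_add cf_add)

lemma cone_scale: "r \<ge> 0 \<Longrightarrow> x \<in> cone \<Longrightarrow> r *\<^sub>R x \<in> cone"
  by (simp add: cone_def span_scale cf_scale)

lemma cone_antisym: "x \<in> cone \<Longrightarrow> - x \<in> cone \<Longrightarrow> x = 0"
  by (rule cf_eqI) (auto simp: cone_def cf_minus cf_zero span_zero intro: order_antisym)

lemma cone_sum_eq_0:
  assumes "finite I" "\<And>i. i \<in> I \<Longrightarrow> f i \<in> cone" "sum f I = 0" "i \<in> I"
  shows "f i = 0"
proof (rule cf_eqI)
  fix \<alpha> assume a: "\<alpha> \<in> \<Delta>"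
  have "(\<Sum>i\<in>I. cf (f i) \<alpha>) = 0"
    using assms cf_sum[of I f \<alpha>] by (simp add: cone_def cf_zero)
  then show "cf (f i) \<alpha> = cf 0 \<alpha>"
    using assms a by (subst (asm) sum_nonneg_eq_0_iff) (auto simp: cone_def cf_zero)
qed (use assms in \<open>auto simp: cone_def span_zero\<close>)

text \<open>Split off the last letter \<open>\<alpha>\<close>. If the rest of the word keeps
  \<open>\<alpha>\<close> positive, this letter subtracts a nonnegative multiple of a positive root;
  otherwise the exchange condition yields a shorter word with the same effect.\<close>

lemma dominant_minus_word_cone:
  assumes "dominant x" "set xs \<subseteq> \<Delta>"
  shows "x - word xs x \<in> cone"
  using assms(2)
proof (induction "length xs" arbitrary: xs rule: less_induct)
  case less
  have x: "x \<in> span \<Phi>" using assms(1) by (simp add: dominant_def)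
  show ?case
  proof (cases xs rule: rev_cases)
    case Nil
    then show ?thesis by (simp add: word_Nil cone_def span_zero cf_zero)
  next
    case (snoc ys \<alpha>)
    then have ys: "set ys \<subseteq> \<Delta>" and a: "\<alpha> \<in> \<Delta>" using less.prems by auto
    have eq: "word xs x = word ys (refl \<alpha> x)" by (simp add: snoc word_append word_Cons word_Nil)
    show ?thesis
    proof (cases "word ys \<alpha> \<in> pos")
      case True
      have "x - word ys x \<in> cone" using less.hyps[of ys] ys snoc by simp
      moreover have "(x \<bullet> coroot \<alpha>) *\<^sub>R word ys \<alpha> \<in> cone"
        using assms(1) a True by (intro cone_scale pos_cone) (auto simp: dominant_def)
      moreover have "x - word xs x = (x - word ys x) + (x \<bullet> coroot \<alpha>) *\<^sub>R word ys \<alpha>"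
        by (simp add: eq reflection_def word_linear)
      ultimately show ?thesis using cone_add by metis
    next
      case False
      then obtain zs where "set zs \<subseteq> \<Delta>" "length zs < length ys" "word ys (refl \<alpha> x) = word zs x"
        using word_exchange[OF ys a] by blast
      then show ?thesis using less.hyps[of zs] snoc eq by simp
    qed
  qed
qed

section \<open>Fundamental weights\<close>

lemma coroots_zero_imp_zero:
  assumes "x \<in> span \<Phi>" "\<And>\<alpha>. \<alpha> \<in> \<Delta> \<Longrightarrow> x \<bullet> coroot \<alpha> = 0"
  shows "x = 0"
proof -
  have "rform x \<alpha> = 0" if "\<alpha> \<in> \<Delta>" for \<alpha>
    using assms(2)[OF that] inner_coroot_rform[of \<alpha> x] that by (simp add: simple_root)
  then have "rform x x = 0" using rform_expand[OF assms(1), of x] by simp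
  then show ?thesis using rform_definite assms(1) by blast
qed

text \<open>The map \<open>T\<close> stores the pairings with the simple coroots as coefficients. It
  is injective on \<open>span \<Phi>\<close>, hence onto by dimension, and a preimage of
  \<open>\<alpha>\<close> is the weight.\<close>

lemma ex_fundamental_weight:
  assumes "\<alpha> \<in> \<Delta>"
  shows "\<exists>x\<in>span \<Phi>. \<forall>\<beta>\<in>\<Delta>. x \<bullet> coroot \<beta> = (if \<beta> = \<alpha> then 1 else 0)"
proof -
  define T where "T = (\<lambda>x. \<Sum>\<beta>\<in>\<Delta>. (x \<bullet> coroot \<beta>) *\<^sub>R \<beta>)"
  have lin: "linear T"
    by (rule linearI) (simp_all add: T_def inner_add_left scaleR_add_left sum.distrib scaleR_sum_right)
  have cfT: "cf (T x) \<beta> = x \<bullet> coroot \<beta>" if "\<beta> \<in> \<Delta>" for x \<beta>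
  proof -
    have "cf (T x) \<beta> = (\<Sum>\<gamma>\<in>\<Delta>. (x \<bullet> coroot \<gamma>) * (if \<beta> = \<gamma> then 1 else 0))"
      unfolding T_def by (subst cf_sum) (auto simp: span_scale simple_in_span cf_scale cf_simple intro!: sum.cong)
    also have "\<dots> = x \<bullet> coroot \<beta>" using that finite_simple by (simp add: if_distrib cong: if_cong)
    finally show ?thesis .
  qed
  have "inj_on T (span \<Phi>)"
  proof (rule inj_onI)
    fix x y assume xy: "x \<in> span \<Phi>" "y \<in> span \<Phi>" "T x = T y"
    have "x - y = 0" using xy cfT
      by (intro coroots_zero_imp_zero) (auto simp: span_diff inner_diff_left, metis)
    then show "x = y" by simp
  qed
  then have "dim (T ` span \<Phi>) = dim (span \<Phi>)"
    using dim_image_eq[OF lin, of "span \<Phi>"] by (simp add: span_span)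
  moreover have "T ` span \<Phi> \<subseteq> span \<Phi>"
    unfolding T_def by (intro image_subsetI span_sum span_scale) (rule simple_in_span)
  moreover have "subspace (T ` span \<Phi>)" using lin by (simp add: linear_subspace_image)
  ultimately have "T ` span \<Phi> = span \<Phi>"
    by (intro subspace_dim_equal) auto
  then obtain x where "x \<in> span \<Phi>" "T x = \<alpha>" using simple_in_span[OF assms] by (metis imageE)
  then show ?thesis using cfT[of _ x] assms by (intro bexI[of _ x]) (auto simp: cf_simple)
qed

definition wt :: "real ^ 'n \<Rightarrow> real ^ 'n"
  where "wt \<alpha> = (SOME x. x \<in> span \<Phi> \<and> (\<forall>\<beta>\<in>\<Delta>. x \<bullet> coroot \<beta> = (if \<beta> = \<alpha> then 1 else 0)))"

lemma wt:
  assumes "\<alpha> \<in> \<Delta>"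
  shows wt_in_span: "wt \<alpha> \<in> span \<Phi>"
    and wt_coroot: "\<beta> \<in> \<Delta> \<Longrightarrow> wt \<alpha> \<bullet> coroot \<beta> = (if \<beta> = \<alpha> then 1 else 0)"
  using someI_ex[of "\<lambda>x. x \<in> span \<Phi> \<and> (\<forall>\<beta>\<in>\<Delta>. x \<bullet> coroot \<beta> = (if \<beta> = \<alpha> then 1 else 0))"]
    ex_fundamental_weight[OF assms] unfolding wt_def by blast+

lemma dominant_wt: "\<alpha> \<in> \<Delta> \<Longrightarrow> dominant (wt \<alpha>)"
  by (simp add: dominant_def wt_in_span wt_coroot)

lemma wt_expand:
  assumes "x \<in> span \<Phi>"
  shows "x = (\<Sum>\<alpha>\<in>\<Delta>. (x \<bullet> coroot \<alpha>) *\<^sub>R wt \<alpha>)"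
proof -
  have "x - (\<Sum>\<alpha>\<in>\<Delta>. (x \<bullet> coroot \<alpha>) *\<^sub>R wt \<alpha>) = 0"
  proof (rule coroots_zero_imp_zero)
    fix \<beta> assume b: "\<beta> \<in> \<Delta>"
    have "(\<Sum>\<alpha>\<in>\<Delta>. (x \<bullet> coroot \<alpha>) * (wt \<alpha> \<bullet> coroot \<beta>))
        = (\<Sum>\<alpha>\<in>\<Delta>. (x \<bullet> coroot \<alpha>) * (if \<beta> = \<alpha> then 1 else 0))"
      using b by (intro sum.cong) (auto simp: wt_coroot)
    also have "\<dots> = x \<bullet> coroot \<beta>" using b finite_simple by (simp add: if_distrib cong: if_cong)
    finally show "(x - (\<Sum>\<alpha>\<in>\<Delta>. (x \<bullet> coroot \<alpha>) *\<^sub>R wt \<alpha>)) \<bullet> coroot \<beta> = 0"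
      by (simp add: inner_diff_left inner_sum_left)
  qed (use assms in \<open>auto intro!: span_diff span_sum span_scale wt_in_span\<close>)
  then show ?thesis by simp
qed

lemma rform_wt:
  assumes "\<alpha> \<in> \<Delta>" "x \<in> span \<Phi>"
  shows "rform (wt \<alpha>) x = cf x \<alpha> * rform \<alpha> \<alpha> / 2"
proof -
  have "cf x \<beta> * rform (wt \<alpha>) \<beta> = (if \<beta> = \<alpha> then cf x \<alpha> * rform \<alpha> \<alpha> / 2 else 0)" if "\<beta> \<in> \<Delta>" for \<beta>
    using inner_coroot_rform[of \<beta> "wt \<alpha>"] that assms by (auto simp: wt_coroot simple_root)
  then have "rform (wt \<alpha>) x = (\<Sum>\<beta>\<in>\<Delta>. if \<beta> = \<alpha> then cf x \<alpha> * rform \<alpha> \<alpha> / 2 else 0)"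
    using assms by (simp add: rform_expand cong: sum.cong)
  then show ?thesis using assms finite_simple by simp
qed

lemma word_wt:
  assumes "\<alpha> \<in> \<Delta>" "set xs \<subseteq> \<Delta>" "\<alpha> \<notin> set xs"
  shows "word xs (wt \<alpha>) = wt \<alpha>"
  using assms by (induction xs) (auto simp: word_Nil word_Cons reflection_def wt_coroot)

lemma wt_inj: "\<alpha> \<in> \<Delta> \<Longrightarrow> \<beta> \<in> \<Delta> \<Longrightarrow> wt \<alpha> = wt \<beta> \<Longrightarrow> \<alpha> = \<beta>"
  using wt_coroot[of \<alpha> \<alpha>] wt_coroot[of \<beta> \<alpha>] by (auto split: if_splits)

lemma word_fixed_imp_orthogonal:
  assumes "distinct xs" "set xs \<subseteq> \<Delta>" "x \<in> span \<Phi>" "word xs x = x" "\<alpha> \<in> set xs"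
  shows "x \<bullet> coroot \<alpha> = 0"
  using assms
proof (induction xs)
  case Nil
  then show ?case by simp
next
  case (Cons \<beta> xs)
  have b: "\<beta> \<in> \<Delta>" "set xs \<subseteq> \<Delta>" "\<beta> \<notin> set xs" using Cons.prems by auto
  have "refl \<beta> x = refl \<beta> (refl \<beta> (word xs x))" using Cons.prems by (simp add: word_Cons)
  then have eq: "word xs x = refl \<beta> x" using b by (simp add: reflection_reflection simple_root)
  then have "cf x \<beta> = cf (refl \<beta> x) \<beta>" using cf_word[of xs \<beta> x] b Cons.prems by simp
  then have z: "x \<bullet> coroot \<beta> = 0" using b Cons.prems by (simp add: cf_refl)
  then have "word xs x = x" using eq by (simp add: reflection_def)
  then show ?case using Cons z by auto
qed

text \<open>A simple reflection makes a negative root positive only if it maps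
  \<open>- \<alpha>\<close> to \<open>\<alpha>\<close>. At the last such change the value is the
  letter \<open>\<alpha>\<close>, and only the letters \<open>us\<close> remain to be
  applied.\<close>

lemma word_sign_change:
  assumes "set xs \<subseteq> \<Delta>" "\<delta> \<in> \<Phi>" "\<delta> \<notin> pos" "word xs \<delta> \<in> pos"
  shows "\<exists>us \<alpha> vs. xs = us @ \<alpha> # vs \<and> word xs \<delta> = word us \<alpha>"
  using assms
proof (induction xs)
  case Nil
  then show ?case by (simp add: word_Nil)
next
  case (Cons \<beta> xs)
  have b: "\<beta> \<in> \<Delta>" "set xs \<subseteq> \<Phi>" using Cons.prems simple_root by auto
  show ?case
  proof (cases "word xs \<delta> \<in> pos")
    case True
    then obtain us \<alpha> vs where "xs = us @ \<alpha> # vs" "word xs \<delta> = word us \<alpha>" using Cons by auto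
    then show ?thesis
      by (intro exI[of _ "\<beta> # us"] exI[of _ \<alpha>] exI[of _ vs]) (simp add: word_Cons)
  next
    case False
    then have n: "- word xs \<delta> \<in> pos" using not_pos_iff word_root b Cons.prems by blast
    have "- word xs \<delta> = \<beta>"
    proof (rule ccontr)
      assume "- word xs \<delta> \<noteq> \<beta>"
      then have "- word (\<beta> # xs) \<delta> \<in> pos"
        using refl_pos[OF b(1) n] by (simp add: word_Cons linear_neg[OF linear_reflection])
      then show False using Cons.prems not_pos_iff pos_root by blast
    qed
    then have "word (\<beta> # xs) \<delta> = \<beta>"
      using reflection_self[of \<beta>] b by (metis minus_minus linear_neg[OF linear_reflection] simple_root word_Cons)
    then show ?thesis by (intro exI[of _ "[]"] exI[of _ \<beta>] exI[of _ xs]) (simp add: word_Nil)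
  qed
qed

end

section \<open>The order of a Coxeter element\<close>

locale coxeter_word = based_root_datum \<Phi> coroot \<Delta>
  for \<Phi> :: "(real ^ 'n) set" and coroot :: "real ^ 'n \<Rightarrow> real ^ 'n" and \<Delta> +
  fixes \<alpha>s :: "(real ^ 'n) list"
  assumes distinct_word: "distinct \<alpha>s" and set_word: "set \<alpha>s = \<Delta>"
begin

abbreviation cox :: "real ^ 'n \<Rightarrow> real ^ 'n"
  where "cox \<equiv> word \<alpha>s"

abbreviation cox_inv :: "real ^ 'n \<Rightarrow> real ^ 'n"
  where "cox_inv \<equiv> word (rev \<alpha>s)"

lemma set_word_roots: "set \<alpha>s \<subseteq> \<Phi>"
  using set_word simple_root by auto

lemma set_power_word: "set (concat (replicate k \<alpha>s)) \<subseteq> \<Delta>"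
  using set_word by (cases "k = 0") auto

lemma linear_power: "linear (cox ^^ k)"
  using linear_word[of "concat (replicate k \<alpha>s)"] by (simp add: word_power[abs_def])

lemmas power_linear = linear_add[OF linear_power] linear_diff[OF linear_power]
  linear_neg[OF linear_power] linear_scale[OF linear_power] linear_sum[OF linear_power]
  linear_0[OF linear_power]

lemma power_root: "\<beta> \<in> \<Phi> \<Longrightarrow> (cox ^^ k) \<beta> \<in> \<Phi>"
  unfolding word_power by (intro word_root simple_subset_roots[OF set_power_word])

lemma power_in_span: "x \<in> span \<Phi> \<Longrightarrow> (cox ^^ k) x \<in> span \<Phi>"
  unfolding word_power by (intro word_in_span simple_subset_roots[OF set_power_word])

lemma power_inj: "(cox ^^ k) x = (cox ^^ k) y \<Longrightarrow> x = y"
  unfolding word_power by (metis word_rev_word simple_subset_roots[OF set_power_word])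

lemma cox_inv_cox: "cox_inv (cox x) = x"
  using word_rev_word set_word_roots by blast

lemma cox_cox_inv: "cox (cox_inv x) = x"
  using word_word_rev set_word_roots by blast

lemma cox_inv_root: "\<beta> \<in> \<Phi> \<Longrightarrow> cox_inv \<beta> \<in> \<Phi>"
  using word_root[of "rev \<alpha>s"] set_word_roots by simp

lemma cox_fixed_imp_zero: "x \<in> span \<Phi> \<Longrightarrow> cox x = x \<Longrightarrow> x = 0"
  using word_fixed_imp_orthogonal[OF distinct_word] set_word
  by (intro coroots_zero_imp_zero) auto

text \<open>There are finitely many maps from \<open>\<Phi>\<close> to itself, so two powers agree
  on the roots; cancel the smaller one and extend linearly.\<close>

lemma ex_power_identity: "\<exists>M>0. \<forall>x\<in>span \<Phi>. (cox ^^ M) x = x"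
proof -
  have "finite (\<Phi> \<rightarrow>\<^sub>E \<Phi>)" using finite_roots by (simp add: finite_PiE)
  moreover have "range (\<lambda>k. restrict (cox ^^ k) \<Phi>) \<subseteq> \<Phi> \<rightarrow>\<^sub>E \<Phi>" by (auto simp: power_root)
  ultimately have "finite (range (\<lambda>k. restrict (cox ^^ k) \<Phi>))" by (rule finite_subset[rotated])
  then have "\<not> inj (\<lambda>k. restrict (cox ^^ k) \<Phi>)" using finite_imageD infinite_UNIV_nat by blast
  then obtain i j where ij: "i < j" "restrict (cox ^^ i) \<Phi> = restrict (cox ^^ j) \<Phi>"
    unfolding inj_def by (metis linorder_neqE_nat)
  have fixd: "(cox ^^ (j - i)) \<beta> = \<beta>" if "\<beta> \<in> \<Phi>" for \<beta>
  proof -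
    have "(cox ^^ i) \<beta> = (cox ^^ j) \<beta>" using ij(2) that by (metis restrict_apply')
    also have "\<dots> = (cox ^^ i) ((cox ^^ (j - i)) \<beta>)"
      using ij(1) by (metis add_diff_inverse_nat funpow_add not_less_iff_gr_or_eq o_apply)
    finally show ?thesis using power_inj by metis
  qed
  have "(cox ^^ (j - i)) x = x" if "x \<in> span \<Phi>" for x
    using linear_expand[OF linear_power that, of "j - i"] fixd cf_expand[OF that]
    by (simp add: simple_root cong: sum.cong)
  then show ?thesis using ij(1) by (intro exI[of _ "j - i"]) auto
qed

text \<open>If the orbit stayed positive, its sum over a full cycle would be fixed by
  \<open>cox\<close>, hence zero, which is impossible for a sum of positive roots.\<close>

lemma ex_power_not_pos:
  assumes "\<beta> \<in> \<Phi>" shows "\<exists>k. (cox ^^ k) \<beta> \<notin> pos"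
proof (rule ccontr)
  assume "\<not> ?thesis"
  then have p: "(cox ^^ k) \<beta> \<in> pos" for k by blast
  obtain M where M: "M > 0" "\<And>x. x \<in> span \<Phi> \<Longrightarrow> (cox ^^ M) x = x" using ex_power_identity by blast
  define s where "s = (\<Sum>k<M. (cox ^^ k) \<beta>)"
  have "cox s + \<beta> = (\<Sum>k<Suc M. (cox ^^ k) \<beta>)"
    unfolding sum.lessThan_Suc_shift by (simp add: s_def word_linear)
  also have "\<dots> = s + \<beta>" using M(2)[OF root_in_span[OF assms]] by (simp add: s_def)
  finally have "cox s = s" by simp
  then have "s = 0"
    using assms by (intro cox_fixed_imp_zero) (auto simp: s_def power_in_span root_in_span intro!: span_sum)
  then have "(cox ^^ 0) \<beta> = 0"
    using cone_sum_eq_0[of "{..<M}" "\<lambda>k. (cox ^^ k) \<beta>" 0] p pos_cone M(1) by (simp add: s_def)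
  then show False using root_nonzero[OF assms] by simp
qed

section \<open>Runs of positive roots in the orbits of the Coxeter element\<close>

definition gam :: "real ^ 'n \<Rightarrow> real ^ 'n"
  where "gam \<alpha> = wt \<alpha> - cox (wt \<alpha>)"

text \<open>The letters of \<open>ys\<close> fix \<open>wt \<alpha>\<close>, the letter
  \<open>\<alpha>\<close> subtracts \<open>\<alpha>\<close>, and the letters of \<open>xs\<close>
  again fix \<open>wt \<alpha>\<close> while moving \<open>\<alpha>\<close>.\<close>

lemma gam_prefix:
  assumes "\<alpha>s = xs @ \<alpha> # ys"
  shows "gam \<alpha> = word xs \<alpha>"
proof -
  have a: "\<alpha> \<in> \<Delta>" "set xs \<subseteq> \<Delta>" "set ys \<subseteq> \<Delta>" "\<alpha> \<notin> set xs" "\<alpha> \<notin> set ys"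
    using assms set_word distinct_word by auto
  have "cox (wt \<alpha>) = word xs (refl \<alpha> (wt \<alpha>))"
    using a by (simp add: assms word_append word_Cons word_wt)
  also have "\<dots> = wt \<alpha> - word xs \<alpha>"
    using a by (simp add: reflection_def wt_coroot word_linear word_wt)
  finally show ?thesis by (simp add: gam_def)
qed

lemma ex_prefix: "\<alpha> \<in> \<Delta> \<Longrightarrow> \<exists>xs ys. \<alpha>s = xs @ \<alpha> # ys"
  using set_word split_list by metis

lemma gam_pos:
  assumes "\<alpha> \<in> \<Delta>" shows "gam \<alpha> \<in> pos"
proof -
  obtain xs ys where xs: "\<alpha>s = xs @ \<alpha> # ys" using ex_prefix[OF assms] by blast
  then have "set xs \<subseteq> \<Phi>" using set_word_roots by auto
  then have "gam \<alpha> \<in> \<Phi>" using gam_prefix[OF xs] word_root simple_root assms by metis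
  moreover have "gam \<alpha> \<in> cone"
    unfolding gam_def using dominant_minus_word_cone dominant_wt assms set_word by blast
  ultimately show ?thesis by (simp add: root_pos_iff_cone)
qed

lemma gam_inj: "\<alpha> \<in> \<Delta> \<Longrightarrow> \<beta> \<in> \<Delta> \<Longrightarrow> gam \<alpha> = gam \<beta> \<Longrightarrow> \<alpha> = \<beta>"
proof -
  assume ab: "\<alpha> \<in> \<Delta>" "\<beta> \<in> \<Delta>" "gam \<alpha> = gam \<beta>"
  then have "cox (wt \<alpha> - wt \<beta>) = wt \<alpha> - wt \<beta>" by (simp add: gam_def word_linear algebra_simps)
  then have "wt \<alpha> - wt \<beta> = 0" using ab by (intro cox_fixed_imp_zero) (auto simp: span_diff wt_in_span)
  then show ?thesis using wt_inj ab by simp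
qed

text \<open>The root equals \<open>cox_inv (wt \<alpha>) - wt \<alpha>\<close>, whose negative lies
  in the cone because \<open>wt \<alpha>\<close> is dominant. So \<open>gam \<alpha>\<close> starts
  a run.\<close>

lemma cox_inv_gam_not_pos:
  assumes "\<alpha> \<in> \<Delta>" shows "cox_inv (gam \<alpha>) \<notin> pos"
proof
  assume p: "cox_inv (gam \<alpha>) \<in> pos"
  have "wt \<alpha> - cox_inv (wt \<alpha>) \<in> cone"
    using dominant_minus_word_cone[OF dominant_wt[OF assms], of "rev \<alpha>s"] set_word by simp
  then have "- cox_inv (gam \<alpha>) \<in> cone" by (simp add: gam_def word_linear cox_inv_cox)
  then have "cox_inv (gam \<alpha>) = 0" using cone_antisym pos_cone[OF p] by blast
  then show False using root_nonzero pos_root[OF p] by blast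
qed

lemma entering_pos:
  assumes "\<delta> \<in> \<Phi>" "\<delta> \<notin> pos" "cox \<delta> \<in> pos"
  shows "\<exists>\<alpha>\<in>\<Delta>. cox \<delta> = gam \<alpha>"
proof -
  obtain us \<alpha> vs where "\<alpha>s = us @ \<alpha> # vs" "cox \<delta> = word us \<alpha>"
    using word_sign_change[of \<alpha>s \<delta>] assms set_word by auto
  then show ?thesis using gam_prefix set_word by (metis in_set_conv_decomp)
qed

text \<open>The length of the run of positive roots starting at \<open>gam \<alpha>\<close>.\<close>

definition dur :: "real ^ 'n \<Rightarrow> nat"
  where "dur \<alpha> = (LEAST k. (cox ^^ k) (gam \<alpha>) \<notin> pos)"

lemma dur_not_pos: "\<alpha> \<in> \<Delta> \<Longrightarrow> (cox ^^ dur \<alpha>) (gam \<alpha>) \<notin> pos"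
  unfolding dur_def by (rule LeastI_ex) (intro ex_power_not_pos pos_root gam_pos)

lemma less_dur_pos: "k < dur \<alpha> \<Longrightarrow> (cox ^^ k) (gam \<alpha>) \<in> pos"
  unfolding dur_def using not_less_Least by blast

lemma dur_positive: "\<alpha> \<in> \<Delta> \<Longrightarrow> dur \<alpha> > 0"
  using dur_not_pos[of \<alpha>] gam_pos[of \<alpha>] by (cases "dur \<alpha>") auto

text \<open>The negative of the last root of the run is a negative root that \<open>cox\<close>
  makes positive, so \<open>entering_pos\<close> identifies its image.\<close>

lemma ex_partner: "\<alpha> \<in> \<Delta> \<Longrightarrow> \<exists>\<beta>\<in>\<Delta>. (cox ^^ dur \<alpha>) (gam \<alpha>) = - gam \<beta>"
proof -
  assume a: "\<alpha> \<in> \<Delta>"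
  obtain k where k: "dur \<alpha> = Suc k" using dur_positive[OF a] by (cases "dur \<alpha>") auto
  define \<delta> where "\<delta> = - (cox ^^ k) (gam \<alpha>)"
  have r: "(cox ^^ k) (gam \<alpha>) \<in> pos" using less_dur_pos k by simp
  have d: "\<delta> \<in> \<Phi>" "\<delta> \<notin> pos"
    using r not_pos_iff[of "- \<delta>"] uminus_root pos_root by (auto simp: \<delta>_def)
  have eq: "cox \<delta> = - (cox ^^ dur \<alpha>) (gam \<alpha>)" by (simp add: \<delta>_def k word_linear)
  have "cox \<delta> \<in> pos"
    using dur_not_pos[OF a] not_pos_iff power_root pos_root[OF gam_pos[OF a]] by (metis eq)
  then obtain \<beta> where "\<beta> \<in> \<Delta>" "cox \<delta> = gam \<beta>" using entering_pos d by blast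
  then show ?thesis using eq by (metis minus_minus)
qed

definition partner :: "real ^ 'n \<Rightarrow> real ^ 'n"
  where "partner \<alpha> = (SOME \<beta>. \<beta> \<in> \<Delta> \<and> (cox ^^ dur \<alpha>) (gam \<alpha>) = - gam \<beta>)"

lemma partner:
  assumes "\<alpha> \<in> \<Delta>"
  shows partner_simple: "partner \<alpha> \<in> \<Delta>"
    and power_dur_gam: "(cox ^^ dur \<alpha>) (gam \<alpha>) = - gam (partner \<alpha>)"
  using someI_ex[of "\<lambda>\<beta>. \<beta> \<in> \<Delta> \<and> (cox ^^ dur \<alpha>) (gam \<alpha>) = - gam \<beta>"]
    ex_partner[OF assms] unfolding partner_def by blast+

lemma cox_power_commute: "cox ((cox ^^ k) x) = (cox ^^ k) (cox x)"
  by (simp add: funpow_swap1)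

lemma power_dur_wt:
  assumes a: "\<alpha> \<in> \<Delta>"
  shows "(cox ^^ dur \<alpha>) (wt \<alpha>) = - wt (partner \<alpha>)"
proof -
  let ?x = "(cox ^^ dur \<alpha>) (wt \<alpha>) + wt (partner \<alpha>)"
  have "(cox ^^ dur \<alpha>) (wt \<alpha>) - cox ((cox ^^ dur \<alpha>) (wt \<alpha>)) = - (wt (partner \<alpha>) - cox (wt (partner \<alpha>)))"
    using power_dur_gam[OF a] unfolding gam_def by (simp add: power_linear cox_power_commute)
  moreover have "q + s = p + r" if "p - q = - (r - s)" for p q r s :: "real ^ 'n"
    using that by (simp add: algebra_simps)
  ultimately have "cox ?x = ?x" unfolding word_linear by blast
  then have "?x = 0"
    using a by (intro cox_fixed_imp_zero) (auto simp: span_add power_in_span wt_in_span partner_simple)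
  then show ?thesis by (simp add: eq_neg_iff_add_eq_0)
qed

lemma power_two_durs_wt:
  assumes "\<alpha> \<in> \<Delta>"
  shows "(cox ^^ (dur (partner \<alpha>) + dur \<alpha>)) (wt \<alpha>) = wt (partner (partner \<alpha>))"
  using assms by (simp add: funpow_add power_dur_wt partner_simple power_linear)

text \<open>A power of \<open>cox\<close> carries \<open>wt \<alpha>\<close> to
  \<open>wt (partner (partner \<alpha>))\<close>. Both are dominant, so each minus the other lies in
  the cone and they coincide.\<close>

lemma partner_partner:
  assumes a: "\<alpha> \<in> \<Delta>" shows "partner (partner \<alpha>) = \<alpha>"
proof -
  let ?N = "dur (partner \<alpha>) + dur \<alpha>" and ?\<beta> = "partner (partner \<alpha>)"
  let ?xs = "concat (replicate ?N \<alpha>s)"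
  have b: "?\<beta> \<in> \<Delta>" using a by (simp add: partner_simple)
  have eq: "word ?xs (wt \<alpha>) = wt ?\<beta>" using power_two_durs_wt[OF a] by (simp only: word_power)
  have eq': "word (rev ?xs) (wt ?\<beta>) = wt \<alpha>"
    using word_rev_word[OF simple_subset_roots[OF set_power_word]] by (simp only: eq[symmetric])
  have "wt \<alpha> - wt ?\<beta> \<in> cone"
    using dominant_minus_word_cone[OF dominant_wt[OF a] set_power_word[of ?N]] by (simp only: eq)
  moreover have "wt ?\<beta> - wt \<alpha> \<in> cone"
    using dominant_minus_word_cone[OF dominant_wt[OF b], of "rev ?xs"] set_power_word[of ?N]
    by (simp only: eq' set_rev)
  ultimately have "wt ?\<beta> - wt \<alpha> = 0" using cone_antisym[of "wt ?\<beta> - wt \<alpha>"] by simp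
  then show ?thesis using wt_inj[OF b a] by simp
qed

section \<open>The common period of the runs and the order of the Coxeter element\<close>

definition period :: "real ^ 'n \<Rightarrow> nat"
  where "period \<alpha> = dur (partner \<alpha>) + dur \<alpha>"

lemma power_period_wt: "\<alpha> \<in> \<Delta> \<Longrightarrow> (cox ^^ period \<alpha>) (wt \<alpha>) = wt \<alpha>"
  unfolding period_def using power_two_durs_wt partner_partner by simp

text \<open>
  Rotating the word so that it starts with \<open>\<alpha>\<close> conjugates the Coxeter element. The \<open>N\<close>-th power of
  the rotated element \<open>c\<close> fixes \<open>wt \<alpha>\<close> and \<open>c (wt \<alpha>) = wt \<alpha> - \<alpha>\<close>, hence \<open>\<alpha>\<close>, which is \<open>2 wt \<alpha>\<close>
  minus a nonnegative combination of the weights at the neighbours of \<open>\<alpha>\<close>.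
\<close>

lemma power_fixes_adjacent_wt:
  assumes a: "\<alpha> \<in> \<Delta>" and fixd: "(cox ^^ N) (wt \<alpha>) = wt \<alpha>"
    and b: "\<beta> \<in> \<Delta>" and adj: "\<alpha> \<bullet> coroot \<beta> \<noteq> 0"
  shows "(cox ^^ N) (wt \<beta>) = wt \<beta>"
proof (cases "\<beta> = \<alpha>")
  case True
  then show ?thesis using fixd by simp
next
  case neq: False
  obtain xs ys where xs: "\<alpha>s = xs @ \<alpha> # ys" using ex_prefix[OF a] by blast
  have sub: "set xs \<subseteq> \<Delta>" "set ys \<subseteq> \<Delta>" "\<alpha> \<notin> set xs" "\<alpha> \<notin> set ys"
    using xs set_word distinct_word by auto
  define zs where "zs = \<alpha> # ys @ xs"
  have zs: "set zs \<subseteq> \<Delta>" using sub a by (auto simp: zs_def)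
  have conj1: "cox (word xs x) = word xs (word zs x)" for x
    by (simp add: xs zs_def word_append word_Cons)
  have conj: "(cox ^^ k) (word xs x) = word xs ((word zs ^^ k) x)" for k x
    by (induction k) (auto simp: conj1)
  have inj: "word xs x = word xs y \<Longrightarrow> x = y" for x y
    using word_rev_word[OF simple_subset_roots[OF sub(1)]] by metis
  have lin: "linear (word zs ^^ N)"
    using linear_word[of "concat (replicate N zs)"] by (simp add: word_power[abs_def])
  have xa: "word xs (wt \<alpha>) = wt \<alpha>" using word_wt a sub by blast
  have f1: "(word zs ^^ N) (wt \<alpha>) = wt \<alpha>" using conj[of N "wt \<alpha>"] fixd xa inj by metis
  have "word zs (wt \<alpha>) = wt \<alpha> - \<alpha>"
    using a sub by (simp add: zs_def word_Cons word_append word_wt reflection_def wt_coroot)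
  moreover have "(word zs ^^ N) (word zs (wt \<alpha>)) = word zs (wt \<alpha>)" using f1 by (metis funpow_swap1)
  ultimately have "(word zs ^^ N) (wt \<alpha> - \<alpha>) = wt \<alpha> - \<alpha>" by simp
  then have f2: "(word zs ^^ N) \<alpha> = \<alpha>" using f1 by (simp add: linear_diff[OF lin])
  define g where "g = (\<lambda>\<gamma>. wt \<gamma> - (word zs ^^ N) (wt \<gamma>))"
  have g: "g \<gamma> \<in> cone" if "\<gamma> \<in> \<Delta>" for \<gamma>
    unfolding g_def word_power using that zs
    by (intro dominant_minus_word_cone dominant_wt) auto
  have "\<alpha> - (word zs ^^ N) \<alpha> = (\<Sum>\<gamma>\<in>\<Delta>. (\<alpha> \<bullet> coroot \<gamma>) *\<^sub>R g \<gamma>)"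
  proof -
    have e: "\<alpha> = (\<Sum>\<gamma>\<in>\<Delta>. (\<alpha> \<bullet> coroot \<gamma>) *\<^sub>R wt \<gamma>)" using wt_expand simple_in_span a by blast
    have "(word zs ^^ N) \<alpha> = (\<Sum>\<gamma>\<in>\<Delta>. (\<alpha> \<bullet> coroot \<gamma>) *\<^sub>R (word zs ^^ N) (wt \<gamma>))"
      by (subst e) (simp only: linear_sum[OF lin] linear_scale[OF lin])
    then show ?thesis using e by (simp add: g_def scaleR_diff_right sum_subtractf)
  qed
  then have "(\<Sum>\<gamma>\<in>\<Delta>. (\<alpha> \<bullet> coroot \<gamma>) *\<^sub>R g \<gamma>) = 0" using f2 by simp
  moreover have "g \<alpha> = 0" by (simp add: g_def f1)
  ultimately have "(\<Sum>\<gamma>\<in>\<Delta> - {\<alpha>}. (- (\<alpha> \<bullet> coroot \<gamma>)) *\<^sub>R g \<gamma>) = 0"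
    using a finite_simple by (simp add: sum.remove[of \<Delta> \<alpha>] sum_negf)
  moreover have "(- (\<alpha> \<bullet> coroot \<gamma>)) *\<^sub>R g \<gamma> \<in> cone" if "\<gamma> \<in> \<Delta> - {\<alpha>}" for \<gamma>
    using that g simple_inner_coroot_nonpos[OF a, of \<gamma>] by (intro cone_scale) auto
  ultimately have "(- (\<alpha> \<bullet> coroot \<beta>)) *\<^sub>R g \<beta> = 0"
    using cone_sum_eq_0[of "\<Delta> - {\<alpha>}" "\<lambda>\<gamma>. (- (\<alpha> \<bullet> coroot \<gamma>)) *\<^sub>R g \<gamma>" \<beta>] finite_simple b neq by blast
  then have "(word zs ^^ N) (wt \<beta>) = wt \<beta>" using adj by (simp add: g_def)
  then have f3: "(cox ^^ N) (word xs (wt \<beta>)) = word xs (wt \<beta>)" using conj by simp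
  show ?thesis
  proof (cases "\<beta> \<in> set xs")
    case False
    then show ?thesis using f3 word_wt[OF b sub(1)] by simp
  next
    case True
    then have "\<beta> \<notin> set (\<alpha> # ys)" using distinct_word xs by auto
    then have "cox (wt \<beta>) = word xs (wt \<beta>)"
      using b sub a word_wt[of \<beta> "\<alpha> # ys"] by (simp add: xs word_append)
    then have "cox ((cox ^^ N) (wt \<beta>)) = cox (wt \<beta>)" using f3 by (simp add: cox_power_commute)
    then show ?thesis using cox_inv_cox by metis
  qed
qed

lemma power_period:
  assumes a: "\<alpha> \<in> \<Delta>" shows "cox ^^ period \<alpha> = id"
proof
  fix x
  define J where "J = {\<beta>\<in>\<Delta>. (cox ^^ period \<alpha>) (wt \<beta>) = wt \<beta>}"
  have "J = \<Delta>"
  proof (rule simple_connected)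
    show "J \<noteq> {}" using power_period_wt[OF a] a by (auto simp: J_def)
    show "rform \<beta> \<gamma> = 0" if "\<beta> \<in> J" "\<gamma> \<in> \<Delta> - J" for \<beta> \<gamma>
    proof -
      have "\<beta> \<bullet> coroot \<gamma> = 0"
        using power_fixes_adjacent_wt[of \<beta> "period \<alpha>" \<gamma>] that by (auto simp: J_def)
      then show ?thesis using inner_coroot_rform[of \<gamma> \<beta>] that simple_root by auto
    qed
  qed (auto simp: J_def)
  then have fixd: "(cox ^^ period \<alpha>) (wt \<beta>) = wt \<beta>" if "\<beta> \<in> \<Delta>" for \<beta> using that by (auto simp: J_def)
  \<comment> \<open>\<open>x\<close> need not lie in \<open>span \<Phi>\<close>. Its weight part
    \<open>v\<close> is fixed by what precedes, and \<open>x - v\<close> is killed by all simple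
    coroots, so every word fixes it. The power is thus the identity on the whole space, as
    \<open>elt_order\<close> demands.\<close>
  define v where "v = (\<Sum>\<beta>\<in>\<Delta>. (x \<bullet> coroot \<beta>) *\<^sub>R wt \<beta>)"
  have "(x - v) \<bullet> coroot \<beta> = 0" if b: "\<beta> \<in> \<Delta>" for \<beta>
  proof -
    have "(\<Sum>\<alpha>\<in>\<Delta>. (x \<bullet> coroot \<alpha>) * (wt \<alpha> \<bullet> coroot \<beta>))
        = (\<Sum>\<alpha>\<in>\<Delta>. (x \<bullet> coroot \<alpha>) * (if \<beta> = \<alpha> then 1 else 0))"
      using b by (intro sum.cong) (auto simp: wt_coroot)
    also have "\<dots> = x \<bullet> coroot \<beta>" using b finite_simple by (simp add: if_distrib cong: if_cong)
    finally show ?thesis by (simp add: v_def inner_diff_left inner_sum_left)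
  qed
  then have "word xs (x - v) = x - v" if "set xs \<subseteq> \<Delta>" for xs
    using that by (induction xs) (auto simp: word_Nil word_Cons reflection_def)
  then have "(cox ^^ period \<alpha>) (x - v) = x - v" unfolding word_power using set_power_word by blast
  moreover have "(cox ^^ period \<alpha>) v = v" by (simp add: v_def power_linear fixd cong: sum.cong)
  ultimately show "(cox ^^ period \<alpha>) x = id x" by (simp add: power_linear)
qed

text \<open>The order \<open>h\<close> cannot exceed the period. After \<open>h\<close> steps
  \<open>gam \<alpha>\<close> returns; since the root before \<open>gam \<alpha>\<close> is not
  positive, the positive run is over by then, so \<open>dur \<alpha> < h\<close>. If
  \<open>h\<close> were below the period, the following negative run would still be in progress at
  step \<open>h\<close>, and \<open>gam \<alpha>\<close> would be negative.\<close>

lemma period_eq_order: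
  assumes a: "\<alpha> \<in> \<Delta>" shows "period \<alpha> = elt_order cox"
proof -
  let ?P = "\<lambda>k. k > 0 \<and> cox ^^ k = id" and ?h = "elt_order cox"
  have P: "?P (period \<alpha>)" using power_period[OF a] dur_positive[OF a] by (simp add: period_def)
  have le: "?h \<le> period \<alpha>" unfolding elt_order_def by (rule Least_le) (rule P)
  have h: "?P ?h" unfolding elt_order_def by (rule LeastI) (rule P)
  then have fixg: "(cox ^^ ?h) (gam \<alpha>) = gam \<alpha>" by simp
  have "dur \<alpha> < ?h"
  proof (rule ccontr)
    assume "\<not> ?thesis"
    then have "(cox ^^ (?h - 1)) (gam \<alpha>) \<in> pos" using h by (intro less_dur_pos) auto
    moreover have "cox ((cox ^^ (?h - 1)) (gam \<alpha>)) = gam \<alpha>"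
      using h fixg by (metis Suc_diff_1 funpow.simps(2) o_apply)
    ultimately show False using cox_inv_gam_not_pos[OF a] cox_inv_cox by metis
  qed
  have "\<not> ?h < period \<alpha>"
  proof
    assume "?h < period \<alpha>"
    then have "?h - dur \<alpha> < dur (partner \<alpha>)" using \<open>dur \<alpha> < ?h\<close> by (simp add: period_def)
    then have p: "(cox ^^ (?h - dur \<alpha>)) (gam (partner \<alpha>)) \<in> pos" by (rule less_dur_pos)
    have "gam \<alpha> = (cox ^^ (?h - dur \<alpha>)) ((cox ^^ dur \<alpha>) (gam \<alpha>))"
      using fixg \<open>dur \<alpha> < ?h\<close> by (metis funpow_add le_add_diff_inverse2 less_imp_le o_apply)
    then have "- gam \<alpha> = (cox ^^ (?h - dur \<alpha>)) (gam (partner \<alpha>))"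
      using a by (simp add: power_dur_gam power_linear)
    then show False using p gam_pos[OF a] not_pos_iff pos_root by metis
  qed
  then show ?thesis using le by simp
qed

text \<open>Going backwards along the orbit, stop at the first root that is not positive; by
  \<open>entering_pos\<close> its successor is some \<open>gam \<alpha>\<close>.\<close>

lemma ex_gam_orbit:
  assumes "\<beta> \<in> pos"
  shows "\<exists>\<alpha>\<in>\<Delta>. \<exists>k<dur \<alpha>. \<beta> = (cox ^^ k) (gam \<alpha>)"
proof -
  obtain M where M: "M > 0" "\<And>x. x \<in> span \<Phi> \<Longrightarrow> (cox ^^ M) x = x" using ex_power_identity by blast
  have inv_root: "(cox_inv ^^ k) \<beta> \<in> \<Phi>" for k
    using assms by (induction k) (auto simp: cox_inv_root pos_root)
  have pw: "(cox ^^ k) ((cox_inv ^^ (k + l)) \<beta>) = (cox_inv ^^ l) \<beta>" for k l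
  proof (induction k)
    case (Suc k)
    have "(cox ^^ Suc k) ((cox_inv ^^ (Suc k + l)) \<beta>) = (cox ^^ k) (cox (cox_inv ((cox_inv ^^ (k + l)) \<beta>)))"
      by (simp only: cox_power_commute[symmetric] add_Suc funpow.simps(2) o_apply)
    then show ?case by (simp only: cox_cox_inv Suc)
  qed simp
  have "\<exists>k. (cox_inv ^^ k) \<beta> \<notin> pos"
  proof -
    obtain k where k: "(cox ^^ k) \<beta> \<notin> pos" using ex_power_not_pos assms pos_root by blast
    have mult: "(cox ^^ (M * j)) x = x" if "x \<in> span \<Phi>" for x j
      using that M by (induction j) (auto simp: funpow_add)
    have "(cox ^^ (M * k)) \<beta> = \<beta>" using mult assms by (simp add: root_in_span pos_root)
    \<comment> \<open>Since \<open>cox\<close> has period \<open>M\<close> on the span,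
      \<open>M * k - k\<close> steps backwards amount to \<open>k\<close> steps forwards, where a
      root that is not positive is known.\<close>
    moreover have "M * k = (M * k - k) + k" using M(1) by (cases M) auto
    ultimately have "(cox ^^ (M * k - k)) ((cox ^^ k) \<beta>) = \<beta>" by (metis funpow_add o_apply)
    moreover have "(cox ^^ (M * k - k)) ((cox_inv ^^ (M * k - k)) \<beta>) = \<beta>" using pw[of _ 0] by simp
    ultimately have "(cox_inv ^^ (M * k - k)) \<beta> = (cox ^^ k) \<beta>" using power_inj by metis
    then show ?thesis using k by metis
  qed
  then obtain k where k: "(cox_inv ^^ k) \<beta> \<notin> pos" "\<And>j. j < k \<Longrightarrow> (cox_inv ^^ j) \<beta> \<in> pos"
    using exists_least_iff[of "\<lambda>k. (cox_inv ^^ k) \<beta> \<notin> pos"] by blast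
  then obtain j where j: "k = Suc j" using assms by (cases k) auto
  have cj: "cox ((cox_inv ^^ k) \<beta>) = (cox_inv ^^ j) \<beta>" by (simp add: j cox_cox_inv)
  then have "cox ((cox_inv ^^ k) \<beta>) \<in> pos" using k(2)[of j] j by simp
  then obtain \<alpha> where a: "\<alpha> \<in> \<Delta>" "(cox_inv ^^ j) \<beta> = gam \<alpha>"
    using entering_pos[OF inv_root k(1)] cj by metis
  have "(cox ^^ i) (gam \<alpha>) \<in> pos" if "i \<le> j" for i
    using pw[of i "j - i"] k(2)[of "j - i"] that j a by simp
  then have "j < dur \<alpha>" using dur_not_pos[OF a(1)] by (meson not_less)
  moreover have "\<beta> = (cox ^^ j) (gam \<alpha>)" using pw[of j 0] a by simp
  ultimately show ?thesis using a by blast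
qed

text \<open>After cancelling the smaller power, \<open>gam \<alpha>\<close> lies in the run of
  \<open>gam \<beta>\<close>. If it were not the start of that run, its predecessor would be
  positive, against \<open>cox_inv_gam_not_pos\<close>.\<close>

lemma gam_orbit_inj:
  assumes "\<alpha> \<in> \<Delta>" "\<beta> \<in> \<Delta>" "l < dur \<beta>" "k \<le> l" and eq: "(cox ^^ k) (gam \<alpha>) = (cox ^^ l) (gam \<beta>)"
  shows "k = l \<and> \<alpha> = \<beta>"
proof -
  have "(cox ^^ l) (gam \<beta>) = (cox ^^ k) ((cox ^^ (l - k)) (gam \<beta>))"
    using assms(4) by (metis funpow_add le_add_diff_inverse o_apply)
  then have g: "gam \<alpha> = (cox ^^ (l - k)) (gam \<beta>)" using eq power_inj by metis
  have "l = k"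
  proof (rule ccontr)
    assume "l \<noteq> k"
    then obtain m where m: "l - k = Suc m" using assms(4) by (cases "l - k") auto
    then have "cox_inv (gam \<alpha>) = (cox ^^ m) (gam \<beta>)" using g by (simp add: cox_inv_cox)
    moreover have "(cox ^^ m) (gam \<beta>) \<in> pos" using m assms(3) by (intro less_dur_pos) auto
    ultimately show False using cox_inv_gam_not_pos[OF assms(1)] by simp
  qed
  then show ?thesis using g gam_inj assms by simp
qed

lemma card_pos_dur: "card pos = (\<Sum>\<alpha>\<in>\<Delta>. dur \<alpha>)"
proof -
  let ?D = "SIGMA \<alpha>:\<Delta>. {..<dur \<alpha>}"
  have "bij_betw (\<lambda>(\<alpha>, k). (cox ^^ k) (gam \<alpha>)) ?D pos"
  proof (rule bij_betw_imageI)
    show "inj_on (\<lambda>(\<alpha>, k). (cox ^^ k) (gam \<alpha>)) ?D"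
    proof (rule inj_onI, clarsimp)
      fix \<alpha> k \<beta> l
      assume "\<alpha> \<in> \<Delta>" "k < dur \<alpha>" "\<beta> \<in> \<Delta>" "l < dur \<beta>" "(cox ^^ k) (gam \<alpha>) = (cox ^^ l) (gam \<beta>)"
      then show "\<alpha> = \<beta> \<and> k = l"
        using gam_orbit_inj[of \<alpha> \<beta> l k] gam_orbit_inj[of \<beta> \<alpha> k l] by (metis linear)
    qed
    show "(\<lambda>(\<alpha>, k). (cox ^^ k) (gam \<alpha>)) ` ?D = pos"
      using ex_gam_orbit less_dur_pos by (force simp: image_iff)
  qed
  then have "card pos = card ?D" by (metis bij_betw_same_card)
  then show ?thesis using finite_simple by simp
qed

text \<open>Summing \<open>period\<close> over \<open>\<Delta>\<close> counts every run twice,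
  because \<open>partner\<close> permutes \<open>\<Delta>\<close>.\<close>

lemma card_pos_order: "2 * card pos = card \<Delta> * elt_order cox"
proof -
  have "bij_betw partner \<Delta> \<Delta>"
    by (rule bij_betw_byWitness[where f' = partner]) (auto simp: partner_simple partner_partner)
  then have "(\<Sum>\<alpha>\<in>\<Delta>. dur (partner \<alpha>)) = (\<Sum>\<alpha>\<in>\<Delta>. dur \<alpha>)" by (rule sum.reindex_bij_betw)
  then have "2 * card pos = (\<Sum>\<alpha>\<in>\<Delta>. period \<alpha>)"
    by (simp add: card_pos_dur period_def sum.distrib)
  then show ?thesis by (simp add: period_eq_order)
qed

end

lemma (in based_root_datum) card_pos_coxeter_number:
  "2 * card pos = card \<Delta> * coxeter_number coroot \<Delta>"
proof -
  obtain xs where "set xs = \<Delta>" "distinct xs" using finite_distinct_list[OF finite_simple] by blast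
  then have "\<exists>u. coxeter_element coroot \<Delta> u" by (auto simp: coxeter_element_def)
  then have "coxeter_element coroot \<Delta> (SOME u. coxeter_element coroot \<Delta> u)" by (rule someI_ex)
  then obtain \<alpha>s where s: "distinct \<alpha>s" "set \<alpha>s = \<Delta>"
      "(SOME u. coxeter_element coroot \<Delta> u) = foldr (\<circ>) (map refl \<alpha>s) id"
    unfolding coxeter_element_def by blast
  interpret coxeter_word \<Phi> coroot \<Delta> \<alpha>s by unfold_locales (use s in auto)
  show ?thesis using card_pos_order s(3) by (simp add: coxeter_number_def word_def)
qed

section \<open>The stabilizer of the alcove\<close>

context based_root_datum
begin

lemma weyl_group_word: "u \<in> weyl_group \<Phi> coroot \<Longrightarrow> \<exists>xs. set xs \<subseteq> \<Phi> \<and> u = word xs"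
proof (induction rule: weyl_group.induct)
  case one
  then show ?case by (intro exI[of _ "[]"]) (auto simp: word_Nil)
next
  case (step \<alpha> u)
  then obtain xs where "set xs \<subseteq> \<Phi>" "u = word xs" by blast
  then show ?case using step by (intro exI[of _ "\<alpha> # xs"]) (auto simp: word_Cons)
qed

lemma inv_word: "set xs \<subseteq> \<Phi> \<Longrightarrow> inv (word xs) x = word (rev xs) x"
  by (metis inj_on_inverseI inv_f_f word_rev_word word_word_rev)

lemma height_one_simple:
  assumes b: "\<beta> \<in> \<Phi>" and "height \<Delta> \<beta> = 1"
  shows "\<beta> \<in> \<Delta>"
proof -
  have p: "\<beta> \<in> pos"
    using pos_height_pos[of "- \<beta>"] not_pos_iff[OF b] assms by (force simp: height_minus root_in_span)
  obtain \<alpha> where a: "\<alpha> \<in> \<Delta>" "cf \<beta> \<alpha> \<noteq> 0" using root_cf_nonzero[OF b] by blast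
  then have "cf \<beta> \<alpha> \<ge> 1" using p b by (intro Ints_ge_one cf_Ints) (auto simp: pos_iff less_le)
  moreover have "height \<Delta> \<beta> = cf \<beta> \<alpha> + (\<Sum>\<gamma>\<in>\<Delta> - {\<alpha>}. cf \<beta> \<gamma>)"
    using a finite_simple by (simp add: height_def sum.remove)
  moreover have "(\<Sum>\<gamma>\<in>\<Delta> - {\<alpha>}. cf \<beta> \<gamma>) \<ge> 0" using p by (intro sum_nonneg) (auto simp: pos_iff)
  ultimately have "(\<Sum>\<gamma>\<in>\<Delta> - {\<alpha>}. cf \<beta> \<gamma>) = 0" using assms by simp
  then have "\<forall>\<gamma>\<in>\<Delta> - {\<alpha>}. cf \<beta> \<gamma> = 0"
    using p finite_simple by (subst (asm) sum_nonneg_eq_0_iff) (auto simp: pos_iff)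
  then have "\<beta> = \<alpha>" using pos_other_cf[OF a(1) p] by (metis less_irrefl)
  then show ?thesis using a by simp
qed

lemma height_le_highest: "\<beta> \<in> \<Phi> \<Longrightarrow> height \<Delta> \<beta> \<le> height \<Delta> \<eta>"
  unfolding height_def by (intro sum_mono highest_root_ge)

lemma height_eq_highest:
  assumes "\<beta> \<in> \<Phi>" "height \<Delta> \<beta> = height \<Delta> \<eta>"
  shows "\<beta> = \<eta>"
proof (rule cf_eqI)
  have "(\<Sum>\<alpha>\<in>\<Delta>. cf \<eta> \<alpha> - cf \<beta> \<alpha>) = 0" using assms by (simp add: height_def sum_subtractf)
  then have "\<forall>\<alpha>\<in>\<Delta>. cf \<eta> \<alpha> - cf \<beta> \<alpha> = 0"
    using highest_root_ge assms finite_simple by (subst (asm) sum_nonneg_eq_0_iff) auto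
  then show "cf \<beta> \<alpha> = cf \<eta> \<alpha>" if "\<alpha> \<in> \<Delta>" for \<alpha> using that by auto
qed (use assms highest_root in \<open>auto simp: root_in_span\<close>)

text \<open>With \<open>m = 1 + Ht \<eta>\<close>, root heights lie between \<open>1 - m\<close> and
  \<open>m - 1\<close>, so \<open>k\<close> is 0 or 1. The first case gives a root of height 1, the
  second the root of lowest height.\<close>

lemma height_mod_affine_simple:
  assumes b: "\<beta> \<in> \<Phi>" and k: "k \<in> \<int>" and eq: "height \<Delta> \<beta> + (1 + height \<Delta> \<eta>) * k = 1"
  shows "\<beta> \<in> insert (- \<eta>) \<Delta>"
proof -
  define m where "m = 1 + height \<Delta> \<eta>"
  have m: "m \<ge> 2" using pos_height_pos[OF highest_root_pos] by (simp add: m_def)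
  have "height \<Delta> \<beta> \<le> m - 1" using height_le_highest[OF b] by (simp add: m_def)
  moreover have "- height \<Delta> \<beta> \<le> m - 1"
    using height_le_highest[OF uminus_root[OF b]] b by (simp add: m_def height_minus root_in_span)
  ultimately have "1 - m * k \<le> m - 1" "m * k - 1 \<le> m - 1" using eq by (auto simp: m_def)
  then have "m * k \<le> m * 1" "m * (-1) < m * k" using m by auto
  then have "k \<le> 1" "-1 < k" using m mult_le_cancel_left_pos[of m k 1] mult_less_cancel_left_pos[of m "-1" k] by auto
  then have "k = 0 \<or> k = 1" using k by (auto elim!: Ints_cases)
  then show ?thesis
  proof
    assume "k = 0"
    then show ?thesis using eq height_one_simple[OF b] by simp
  next
    assume "k = 1"
    then have "height \<Delta> (- \<beta>) = height \<Delta> \<eta>" using eq b by (simp add: height_minus root_in_span)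
    then have "- \<beta> = \<eta>" using height_eq_highest uminus_root b by blast
    then have "\<beta> = - \<eta>" by (metis minus_minus)
    then show ?thesis by blast
  qed
qed

text \<open>
  The point \<open>x \<mapsto> Ht x / m\<close> with \<open>m = 1 + Ht \<eta>\<close> takes the value \<open>1/m\<close> on all simple affine roots,
  and no affine root takes a smaller positive value there. As the simple affine roots weighted by
  the coefficients of \<open>\<eta>\<close> add up to the constant \<open>1\<close>, an affine transformation preserving the alcove
  must fix this point.
\<close>

lemma stabilizer_inv_affine_simple:
  assumes st: "(y, w) \<in> alcove_stabilizer \<Phi> coroot \<Delta>" and w: "w = word xs" "set xs \<subseteq> \<Phi>"
    and b: "\<beta> \<in> insert (- \<eta>) \<Delta>"
  shows "word (rev xs) \<beta> \<in> insert (- \<eta>) \<Delta>"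
proof -
  define m where "m = 1 + height \<Delta> \<eta>"
  have m: "m \<ge> 2" using pos_height_pos[OF highest_root_pos] by (simp add: m_def)
  let ?u = "word (rev xs)"
  have rev: "set (rev xs) \<subseteq> \<Phi>" using w by simp
  define f where "f = (\<lambda>x\<in>span \<Phi>. height \<Delta> x / m)"
  have "f \<in> dual_space (span \<Phi>)"
    unfolding dual_space_def
    by (auto simp: f_def height_add height_scale span_add span_scale add_divide_distrib)
  moreover have "\<forall>\<alpha>\<in>\<Delta>. f \<alpha> > 0" using m by (simp add: f_def simple_in_span height_simple)
  moreover have "f \<eta> < 1" using m by (simp add: f_def root_in_span highest_root m_def divide_less_eq)
  ultimately have "f \<in> alcove \<Phi> \<Delta>" by (simp add: alcove_def)
  then have "affine_action (span \<Phi>) (y, w) f \<in> alcove \<Phi> \<Delta>"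
    using st by (auto simp: alcove_stabilizer_def)
  moreover have val: "affine_action (span \<Phi>) (y, w) f x = height \<Delta> (?u x) / m + x \<bullet> y"
    if "x \<in> span \<Phi>" for x
    using that word_in_span[OF rev] by (simp add: affine_action_def f_def w(1) inv_word[OF w(2)])
  ultimately have A: "\<And>\<alpha>. \<alpha> \<in> \<Delta> \<Longrightarrow> height \<Delta> (?u \<alpha>) / m + \<alpha> \<bullet> y > 0"
      "height \<Delta> (?u \<eta>) / m + \<eta> \<bullet> y < 1"
    by (auto simp: alcove_def simple_in_span root_in_span highest_root)
  have y: "\<gamma> \<bullet> y \<in> \<int>" if "\<gamma> \<in> \<Phi>" for \<gamma>
    using that st roots_integral
    by (auto simp: alcove_stabilizer_def ext_affine_weyl_group_def intro!: integral_vectors_inner)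
  \<comment> \<open>\<open>g\<close> is \<open>m\<close> times the linear functional obtained by
    moving \<open>f\<close>. Its integrality on roots sharpens the strict alcove inequalities to
    \<open>g \<alpha> \<ge> 1\<close> and \<open>g \<eta> \<le> m - 1\<close>, and
    \<open>m - 1\<close> being the sum of the \<open>cf \<eta> \<alpha>\<close> leaves only
    equality.\<close>
  define g where "g = (\<lambda>x. height \<Delta> (?u x) + m * (x \<bullet> y))"
  have gI: "g \<gamma> \<in> \<int>" if "\<gamma> \<in> \<Phi>" for \<gamma>
    using that by (auto simp: g_def m_def intro!: Ints_add Ints_mult height_Ints y highest_root word_root rev)
  have g1: "g \<alpha> \<ge> 1" if "\<alpha> \<in> \<Delta>" for \<alpha>
    using A(1)[OF that] m that by (intro Ints_ge_one gI) (auto simp: g_def field_simps simple_root)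
  have "m - g \<eta> \<ge> 1"
    using A(2) m by (intro Ints_ge_one Ints_diff gI highest_root)
      (auto simp: g_def field_simps, auto simp: m_def intro!: Ints_add height_Ints highest_root)
  then have g2: "g \<eta> \<le> (\<Sum>\<alpha>\<in>\<Delta>. cf \<eta> \<alpha>)" by (simp add: m_def height_def)
  have g3: "g \<eta> = (\<Sum>\<alpha>\<in>\<Delta>. cf \<eta> \<alpha> * g \<alpha>)"
  proof -
    have e: "x \<in> span \<Phi> \<Longrightarrow> y \<in> span \<Phi> \<Longrightarrow> g (x + y) = g x + g y" "x \<in> span \<Phi> \<Longrightarrow> g (r *\<^sub>R x) = r * g x" for x y r
      by (auto simp: g_def word_linear height_add height_scale word_in_span[OF rev] inner_add_left algebra_simps)
    have "g (\<Sum>\<alpha>\<in>D. cf \<eta> \<alpha> *\<^sub>R \<alpha>) = (\<Sum>\<alpha>\<in>D. cf \<eta> \<alpha> * g \<alpha>)" if "D \<subseteq> \<Delta>" for D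
      using finite_subset[OF that finite_simple] that
    proof (induction D)
      case empty
      then show ?case by (simp add: g_def word_linear height_def cf_zero)
    next
      case (insert \<alpha> D)
      then show ?case
        by (simp add: e span_scale simple_in_span span_sum subset_iff)
    qed
    then have "g (\<Sum>\<alpha>\<in>\<Delta>. cf \<eta> \<alpha> *\<^sub>R \<alpha>) = (\<Sum>\<alpha>\<in>\<Delta>. cf \<eta> \<alpha> * g \<alpha>)" by blast
    then show ?thesis by (simp only: cf_expand[OF root_in_span[OF highest_root]])
  qed
  have "(\<Sum>\<alpha>\<in>\<Delta>. cf \<eta> \<alpha> * (g \<alpha> - 1)) = g \<eta> - (\<Sum>\<alpha>\<in>\<Delta>. cf \<eta> \<alpha>)"
    by (simp add: g3 right_diff_distrib sum_subtractf)
  moreover have nn: "cf \<eta> \<alpha> * (g \<alpha> - 1) \<ge> 0" if "\<alpha> \<in> \<Delta>" for \<alpha>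
    using g1[OF that] highest_root_cf[OF that] by simp
  then have "(\<Sum>\<alpha>\<in>\<Delta>. cf \<eta> \<alpha> * (g \<alpha> - 1)) \<ge> 0" by (rule sum_nonneg)
  ultimately have z: "(\<Sum>\<alpha>\<in>\<Delta>. cf \<eta> \<alpha> * (g \<alpha> - 1)) = 0" and ge: "g \<eta> = m - 1"
    using g2 by (auto simp: m_def height_def)
  have "\<forall>\<alpha>\<in>\<Delta>. cf \<eta> \<alpha> * (g \<alpha> - 1) = 0" using z nn finite_simple by (subst (asm) sum_nonneg_eq_0_iff) auto
  then have gs: "g \<alpha> = 1" if "\<alpha> \<in> \<Delta>" for \<alpha> using that highest_root_cf[OF that] by auto
  show ?thesis
  proof (cases "\<beta> \<in> \<Delta>")
    case True
    then show ?thesis using gs[OF True]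
      by (intro height_mod_affine_simple[of _ "\<beta> \<bullet> y"]) (auto simp: g_def m_def simple_root word_root[OF rev] y)
  next
    case False
    then have "\<beta> = - \<eta>" using b by simp
    \<comment> \<open>Here \<open>- \<eta>\<close> stands for the affine root
      \<open>1 - \<eta>\<close>, which accounts for the shift of the integer by 1.\<close>
    moreover have "height \<Delta> (?u (- \<eta>)) + m * (1 - \<eta> \<bullet> y) = 1"
      using ge by (simp add: g_def word_linear height_minus word_in_span[OF rev] root_in_span highest_root algebra_simps)
    ultimately show ?thesis
      by (intro height_mod_affine_simple[of _ "1 - \<eta> \<bullet> y"])
        (auto simp: m_def word_root[OF rev] uminus_root highest_root y intro!: Ints_diff)
  qed
qed

text \<open>The preceding lemma concerns the inverse of \<open>w\<close>. An injective self-map of a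
  finite set is onto, so \<open>w\<close> preserves the set too.\<close>

lemma stabilizer_affine_simple:
  assumes st: "(y, w) \<in> alcove_stabilizer \<Phi> coroot \<Delta>"
  obtains xs where "set xs \<subseteq> \<Phi>" "w = word xs"
    "\<And>\<beta>. \<beta> \<in> insert (- \<eta>) \<Delta> \<Longrightarrow> w \<beta> \<in> insert (- \<eta>) \<Delta>"
proof -
  have "w \<in> weyl_group \<Phi> coroot"
    using st by (simp add: alcove_stabilizer_def ext_affine_weyl_group_def)
  then obtain xs where xs: "set xs \<subseteq> \<Phi>" "w = word xs" using weyl_group_word by blast
  have "word (rev xs) ` insert (- \<eta>) \<Delta> \<subseteq> insert (- \<eta>) \<Delta>"
    using stabilizer_inv_affine_simple[OF st xs(2,1)] by blast
  moreover have "inj_on (word (rev xs)) (insert (- \<eta>) \<Delta>)"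
    using word_word_rev[OF xs(1)] by (metis inj_on_inverseI)
  ultimately have eq: "word (rev xs) ` insert (- \<eta>) \<Delta> = insert (- \<eta>) \<Delta>"
    using finite_simple by (intro endo_inj_surj) auto
  have "w \<beta> \<in> insert (- \<eta>) \<Delta>" if "\<beta> \<in> insert (- \<eta>) \<Delta>" for \<beta>
  proof -
    from that have "\<beta> \<in> word (rev xs) ` insert (- \<eta>) \<Delta>" by (simp only: eq)
    then obtain \<gamma> where "\<gamma> \<in> insert (- \<eta>) \<Delta>" "\<beta> = word (rev xs) \<gamma>" by (rule imageE)
    then show ?thesis by (simp only: xs(2) word_word_rev[OF xs(1)])
  qed
  then show thesis using that xs by blast
qed

end

section \<open>Root sums for a rotation of the affine diagram\<close>

context based_root_datum
begin

section \<open>The normalized form and pairings with long roots\<close>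

definition ip :: "real ^ 'n \<Rightarrow> real ^ 'n \<Rightarrow> real"
  where "ip x y = 2 * rform x y / rform \<eta> \<eta>"

lemma rform_highest_pos: "rform \<eta> \<eta> > 0"
  by (rule rform_root_pos[OF highest_root])

lemma ip_commute: "ip x y = ip y x"
  by (simp add: ip_def rform_commute)

lemma ip_add_left: "ip (x + y) z = ip x z + ip y z"
  by (simp add: ip_def rform_linear add_divide_distrib)

lemma ip_diff_left: "ip (x - y) z = ip x z - ip y z"
  by (simp add: ip_def rform_linear diff_divide_distrib)

lemma ip_diff_right: "ip z (x - y) = ip z x - ip z y"
  by (simp add: ip_def rform_linear diff_divide_distrib)

lemma ip_add_right: "ip z (x + y) = ip z x + ip z y"
  by (simp add: ip_def rform_linear add_divide_distrib)

lemma ip_minus_left: "ip (- x) z = - ip x z"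
  by (simp add: ip_def rform_linear)

lemma ip_minus_right: "ip z (- x) = - ip z x"
  by (simp add: ip_def rform_linear)

lemma ip_sum_left: "ip (sum f A) z = (\<Sum>i\<in>A. ip (f i) z)"
  by (simp add: ip_def rform_sum_left sum_divide_distrib sum_distrib_left)

lemma ip_sum_right: "ip z (sum f A) = (\<Sum>i\<in>A. ip z (f i))"
  by (simp add: ip_commute[of z] ip_sum_left)

lemmas ip_linear = ip_add_left ip_diff_left ip_minus_left ip_add_right ip_diff_right ip_minus_right

lemma ip_expand: "x \<in> span \<Phi> \<Longrightarrow> ip z x = (\<Sum>\<alpha>\<in>\<Delta>. cf x \<alpha> * ip z \<alpha>)"
  by (simp add: ip_def rform_expand sum_divide_distrib sum_distrib_left mult_ac)

lemma ip_highest: "ip \<eta> \<eta> = 2"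
  using rform_highest_pos by (simp add: ip_def)

lemma ip_root_le: "\<beta> \<in> \<Phi> \<Longrightarrow> ip \<beta> \<beta> \<le> 2"
  using highest_root_long[of \<beta>] rform_highest_pos by (simp add: ip_def pos_divide_le_eq)

lemma ip_pos: "x \<in> span \<Phi> \<Longrightarrow> x \<noteq> 0 \<Longrightarrow> ip x x > 0"
  using rform_pos[of x] rform_highest_pos by (simp add: ip_def)

lemma ip_root_pos: "\<beta> \<in> \<Phi> \<Longrightarrow> ip \<beta> \<beta> > 0"
  using ip_pos root_in_span root_nonzero by blast

lemma ip_word: "set xs \<subseteq> \<Phi> \<Longrightarrow> ip (word xs x) (word xs y) = ip x y"
  by (simp add: ip_def rform_word)

lemma ip_diff_root: "\<beta> \<in> \<Phi> \<Longrightarrow> \<gamma> \<in> \<Phi> \<Longrightarrow> \<beta> \<noteq> \<gamma> \<Longrightarrow> ip \<beta> \<gamma> > 0 \<Longrightarrow> \<beta> - \<gamma> \<in> \<Phi>"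
  using rform_highest_pos by (intro diff_root) (auto simp: ip_def zero_less_divide_iff)

lemma inner_coroot_ip: "\<alpha> \<in> \<Phi> \<Longrightarrow> x \<bullet> coroot \<alpha> = 2 * ip x \<alpha> / ip \<alpha> \<alpha>"
  using rform_highest_pos rform_root_pos[of \<alpha>] by (simp add: inner_coroot_eq ip_def)

lemma inner_coroot_ip_long: "\<alpha> \<in> \<Phi> \<Longrightarrow> ip \<alpha> \<alpha> = 2 \<Longrightarrow> x \<bullet> coroot \<alpha> = ip x \<alpha>"
  by (simp add: inner_coroot_ip)

lemma ip_long_le_1:
  assumes "\<beta> \<in> \<Phi>" "\<nu> \<in> \<Phi>" "\<beta> \<noteq> \<nu>" "ip \<nu> \<nu> = 2"
  shows "ip \<beta> \<nu> \<le> 1"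
proof -
  have "rform \<beta> \<beta> \<le> rform \<nu> \<nu>"
    using assms(4) highest_root_long[OF assms(1)] rform_highest_pos by (simp add: ip_def field_simps)
  then show ?thesis using inner_coroot_long_le[OF assms(1-3)] assms by (simp add: inner_coroot_ip_long)
qed

text \<open>For long \<open>\<nu>\<close> the form is a Cartan integer, at most 1, and it is
  nonnegative because \<open>\<beta> + \<nu>\<close> is not a root. If
  \<open>\<beta> - \<nu>\<close> is a root, its square length is at most 2, which forces a positive
  value. This converts sums of inner products into counts of roots.\<close>

lemma ip_long_nonneg:
  assumes "\<beta> \<in> \<Phi>" "\<nu> \<in> \<Phi>" "\<beta> \<noteq> \<nu>" "ip \<nu> \<nu> = 2" "\<beta> \<noteq> - \<nu>" "\<beta> + \<nu> \<notin> \<Phi>"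
  shows "ip \<beta> \<nu> = (if \<beta> - \<nu> \<in> \<Phi> then 1 else 0)"
proof -
  have "ip \<beta> \<nu> \<ge> 0"
    using ip_diff_root[of \<beta> "- \<nu>"] assms by (force simp: uminus_root ip_linear)
  moreover have "ip \<beta> \<nu> \<in> \<int>"
    using inner_coroot_Ints[of \<beta> \<nu>] assms by (simp add: inner_coroot_ip_long)
  moreover have "ip \<beta> \<nu> \<le> 1" using ip_long_le_1 assms by blast
  ultimately have c: "ip \<beta> \<nu> = 0 \<or> ip \<beta> \<nu> = 1" using Ints_ge_one by (metis less_le order_antisym)
  show ?thesis
  proof (cases "\<beta> - \<nu> \<in> \<Phi>")
    case True
    then have "ip (\<beta> - \<nu>) (\<beta> - \<nu>) \<le> 2" by (rule ip_root_le)
    then have "ip \<beta> \<nu> > 0" using assms(4) ip_root_pos[OF assms(1)] by (simp add: ip_linear ip_commute[of \<nu> \<beta>])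
    then show ?thesis using c True by simp
  next
    case False
    then show ?thesis using c ip_diff_root[of \<beta> \<nu>] assms by auto
  qed
qed

lemma ip_long_nonpos:
  assumes "\<beta> \<in> \<Phi>" "\<nu> \<in> \<Phi>" "\<beta> \<noteq> \<nu>" "ip \<nu> \<nu> = 2" "\<beta> \<noteq> - \<nu>" "\<beta> - \<nu> \<notin> \<Phi>"
  shows "ip \<beta> \<nu> = - (if \<beta> + \<nu> \<in> \<Phi> then 1 else 0)"
  using ip_long_nonneg[of \<beta> "- \<nu>"] assms by (auto simp: uminus_root ip_linear split: if_splits)

lemma ip_wt:
  assumes "\<alpha> \<in> \<Delta>" "ip \<alpha> \<alpha> = 2" "x \<in> span \<Phi>"
  shows "ip (wt \<alpha>) x = cf x \<alpha>"
  using assms rform_highest_pos by (simp add: ip_def rform_wt field_simps)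

lemma sum_refl_stable_orthogonal:
  assumes "\<alpha> \<in> \<Delta>" "finite F" "\<And>\<beta>. \<beta> \<in> F \<Longrightarrow> refl \<alpha> \<beta> \<in> F"
  shows "ip (\<Sum>F) \<alpha> = 0"
proof -
  have a: "\<alpha> \<in> \<Phi>" using assms(1) by (rule simple_root)
  have "bij_betw (refl \<alpha>) F F"
    by (rule bij_betw_byWitness[where f' = "refl \<alpha>"]) (auto simp: reflection_reflection[OF a] assms(3))
  then have "(\<Sum>\<beta>\<in>F. refl \<alpha> \<beta>) = \<Sum>F" using sum.reindex_bij_betw[of "refl \<alpha>" F F "\<lambda>x. x"] by simp
  then have "refl \<alpha> (\<Sum>F) = \<Sum>F" by (simp add: linear_sum[OF linear_reflection])
  then have "\<Sum>F \<bullet> coroot \<alpha> = 0" using root_nonzero[OF a] by (simp add: reflection_def)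
  then have "rform (\<Sum>F) \<alpha> = 0" using inner_coroot_rform[OF a, of "\<Sum>F"] by simp
  then show ?thesis by (simp add: ip_def)
qed

end

locale affine_rotation = based_root_datum \<Phi> coroot \<Delta>
  for \<Phi> :: "(real ^ 'n) set" and coroot :: "real ^ 'n \<Rightarrow> real ^ 'n" and \<Delta> +
  fixes w :: "real ^ 'n \<Rightarrow> real ^ 'n" and ws :: "(real ^ 'n) list" and R S :: "real ^ 'n"
  assumes w_word: "w = word ws" and ws_roots: "set ws \<subseteq> \<Phi>"
    and w_affine_simple: "\<And>\<beta>. \<beta> \<in> insert (- \<eta>) \<Delta> \<Longrightarrow> w \<beta> \<in> insert (- \<eta>) \<Delta>"
    and R: "R \<in> \<Delta>" and S: "S \<in> \<Delta>" and wS: "w S = R" and wR: "w R = - \<eta>"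
begin

section \<open>The action of \<open>w\<close> on simple roots, heights and signs\<close>

lemma w_inj: "w x = w y \<Longrightarrow> x = y"
  using word_rev_word[OF ws_roots] by (metis w_word)

lemma w_root: "\<beta> \<in> \<Phi> \<Longrightarrow> w \<beta> \<in> \<Phi>"
  using word_root[OF ws_roots] by (simp add: w_word)

lemma w_in_span: "x \<in> span \<Phi> \<Longrightarrow> w x \<in> span \<Phi>"
  using word_in_span[OF ws_roots] by (simp add: w_word)

lemma linear_w: "linear w"
  by (simp add: w_word linear_word)

lemma ip_w: "ip (w x) (w y) = ip x y"
  using ip_word[OF ws_roots] by (simp add: w_word)

lemma minus_highest_not_simple: "- \<eta> \<notin> \<Delta>"
  using simple_pos not_pos_iff[OF highest_root] highest_root_pos by blast

lemma R_neq_S: "R \<noteq> S"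
  using wR wS R minus_highest_not_simple by metis

lemma w_simple: "\<alpha> \<in> \<Delta> \<Longrightarrow> \<alpha> \<noteq> R \<Longrightarrow> w \<alpha> \<in> \<Delta>"
  using w_affine_simple[of \<alpha>] w_inj[of \<alpha> R] wR by auto

text \<open>The next vertex of the extended diagram on the orbit of \<open>S\<close>, which runs
  through \<open>S\<close>, \<open>R\<close>, \<open>- \<eta>\<close>, \<open>P\<close>.\<close>

definition P :: "real ^ 'n" where "P = w (- \<eta>)"

lemma P_simple: "P \<in> \<Delta>"
  using w_affine_simple[of "- \<eta>"] w_inj[of "- \<eta>" R] wR minus_highest_not_simple R
  by (auto simp: P_def)

lemma P_neq_R: "P \<noteq> R"
  using wS w_inj S minus_highest_not_simple unfolding P_def by metis

lemma w_neq_P: "\<alpha> \<in> \<Delta> \<Longrightarrow> w \<alpha> \<noteq> P"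
  using w_inj minus_highest_not_simple unfolding P_def by metis

lemma cf_w: "x \<in> span \<Phi> \<Longrightarrow> cf (w x) \<delta> = (\<Sum>\<alpha>\<in>\<Delta>. cf x \<alpha> * cf (w \<alpha>) \<delta>)"
  by (subst linear_expand[OF linear_w], assumption, subst cf_sum)
    (auto simp: span_scale cf_scale w_in_span simple_in_span)

text \<open>Every simple root other than \<open>R\<close> goes to a simple root, so height is lost
  only at \<open>R\<close>, which goes to \<open>- \<eta>\<close>.\<close>

lemma height_w: "x \<in> span \<Phi> \<Longrightarrow> height \<Delta> x - height \<Delta> (w x) = (1 + height \<Delta> \<eta>) * cf x R"
proof -
  assume x: "x \<in> span \<Phi>"
  have "height \<Delta> (w x) = (\<Sum>\<alpha>\<in>\<Delta>. \<Sum>\<delta>\<in>\<Delta>. cf x \<alpha> * cf (w \<alpha>) \<delta>)"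
    unfolding height_def using x by (simp add: cf_w) (rule sum.swap)
  also have "\<dots> = (\<Sum>\<alpha>\<in>\<Delta>. cf x \<alpha> * height \<Delta> (w \<alpha>))" by (simp add: height_def sum_distrib_left)
  finally have "height \<Delta> x - height \<Delta> (w x) = (\<Sum>\<alpha>\<in>\<Delta>. cf x \<alpha> * (1 - height \<Delta> (w \<alpha>)))"
    by (simp add: height_def[of _ x] right_diff_distrib sum_subtractf)
  also have "\<dots> = (\<Sum>\<alpha>\<in>\<Delta>. if \<alpha> = R then (1 + height \<Delta> \<eta>) * cf x R else 0)"
    by (intro sum.cong) (auto simp: wR height_simple w_simple height_minus root_in_span highest_root)
  finally show ?thesis using R finite_simple by simp
qed

lemma cf_w_R_aux: "x \<in> span \<Phi> \<Longrightarrow> cf (w x) R = cf x S - cf x R * cf \<eta> R"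
proof -
  assume x: "x \<in> span \<Phi>"
  have "cf x \<alpha> * cf (w \<alpha>) R = (if \<alpha> = S then cf x S else 0) - (if \<alpha> = R then cf x R * cf \<eta> R else 0)"
    if a: "\<alpha> \<in> \<Delta>" for \<alpha>
  proof (cases "\<alpha> = R \<or> \<alpha> = S")
    case True
    then show ?thesis
      using R_neq_S R by (auto simp: wR wS cf_minus root_in_span highest_root cf_simple)
  next
    case False
    then have "w \<alpha> \<in> \<Delta>" "w \<alpha> \<noteq> R" using a w_simple w_inj[of \<alpha> S] wS by auto
    then show ?thesis using False by (simp add: cf_simple)
  qed
  then have "cf (w x) R = (\<Sum>\<alpha>\<in>\<Delta>. (if \<alpha> = S then cf x S else 0) - (if \<alpha> = R then cf x R * cf \<eta> R else 0))"
    by (simp add: cf_w[OF x])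
  then show ?thesis using R S finite_simple by (simp add: sum_subtractf)
qed

text \<open>No simple root maps to \<open>P\<close>, the image of \<open>- \<eta>\<close>; so
  \<open>P\<close> enters only through the image \<open>- \<eta>\<close> of
  \<open>R\<close>.\<close>

lemma cf_w_P: "x \<in> span \<Phi> \<Longrightarrow> cf (w x) P = - (cf x R * cf \<eta> P)"
proof -
  assume x: "x \<in> span \<Phi>"
  have "cf x \<alpha> * cf (w \<alpha>) P = (if \<alpha> = R then - (cf x R * cf \<eta> P) else 0)" if a: "\<alpha> \<in> \<Delta>" for \<alpha>
    using w_simple[OF a] w_neq_P[OF a] by (auto simp: wR cf_minus root_in_span highest_root cf_simple)
  then have "cf (w x) P = (\<Sum>\<alpha>\<in>\<Delta>. if \<alpha> = R then - (cf x R * cf \<eta> P) else 0)"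
    by (simp add: cf_w[OF x])
  then show ?thesis using R finite_simple by simp
qed

lemma w_highest: "w \<eta> = - P"
  by (simp add: P_def linear_neg[OF linear_w])

text \<open>Comparing \<open>P\<close>-coefficients in \<open>w \<eta> = - P\<close> gives
  \<open>cf \<eta> R * cf \<eta> P = 1\<close>, with both factors at least 1.\<close>

lemma cf_highest_R: "cf \<eta> R = 1"
proof -
  have "cf (w \<eta>) P = - 1"
    using P_simple by (simp add: w_highest cf_minus simple_in_span cf_simple)
  then have "cf \<eta> R * cf \<eta> P = 1" using cf_w_P[of \<eta>] by (simp add: root_in_span highest_root)
  moreover have "cf \<eta> R \<ge> 1" "cf \<eta> P \<ge> 1" using highest_root_cf R P_simple by auto
  ultimately show ?thesis by (metis mult.right_neutral mult_left_mono order_antisym order_trans zero_le_one)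
qed

lemma cf_w_R: "x \<in> span \<Phi> \<Longrightarrow> cf (w x) R = cf x S - cf x R"
  by (simp add: cf_w_R_aux cf_highest_R)

lemma cf_highest_S: "cf \<eta> S = 1"
  using cf_w_R[of \<eta>] P_simple P_neq_R cf_highest_R
  by (simp add: w_highest cf_minus simple_in_span cf_simple root_in_span highest_root)

lemma cf_R_cases: "\<beta> \<in> pos \<Longrightarrow> cf \<beta> R = 0 \<or> cf \<beta> R = 1"
  using highest_root_ge[of \<beta> R] Ints_ge_one[OF cf_Ints[of \<beta> R]] cf_highest_R R
  by (force simp: pos_iff less_le)

lemma cf_S_cases: "\<beta> \<in> pos \<Longrightarrow> cf \<beta> S = 0 \<or> cf \<beta> S = 1"
  using highest_root_ge[of \<beta> S] Ints_ge_one[OF cf_Ints[of \<beta> S]] cf_highest_S S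
  by (force simp: pos_iff less_le)

text \<open>If \<open>R\<close> occurs in \<open>\<beta>\<close>, the \<open>P\<close>-coefficient
  of \<open>w \<beta>\<close> is negative; otherwise \<open>w\<close> sends the whole support of
  \<open>\<beta>\<close> to simple roots.\<close>

lemma w_pos_iff:
  assumes b: "\<beta> \<in> pos" shows "w \<beta> \<in> pos \<longleftrightarrow> cf \<beta> R = 0"
proof
  assume "w \<beta> \<in> pos"
  then have "cf (w \<beta>) P \<ge> 0" using P_simple by (simp add: pos_iff)
  then show "cf \<beta> R = 0"
    using cf_R_cases[OF b] cf_w_P[of \<beta>] highest_root_cf[OF P_simple] b by (auto simp: pos_root root_in_span)
next
  assume z: "cf \<beta> R = 0"
  have "cf \<beta> \<alpha> * cf (w \<alpha>) \<delta> \<ge> 0" if "\<alpha> \<in> \<Delta>" for \<alpha> \<delta>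
    using z b that w_simple by (cases "\<alpha> = R") (auto simp: cf_simple pos_iff)
  then show "w \<beta> \<in> pos" using b by (auto simp: pos_iff w_root cf_w root_in_span intro!: sum_nonneg)
qed

text \<open>The same argument for the square of \<open>w\<close>: here \<open>S\<close> is the
  simple root sent to \<open>- \<eta>\<close>, and the coefficient at \<open>w P\<close>, which is
  no image of a simple root, detects it.\<close>

lemma w_w_pos_iff:
  assumes b: "\<beta> \<in> pos" shows "w (w \<beta>) \<in> pos \<longleftrightarrow> cf \<beta> S = 0"
proof -
  have ww: "w (w \<alpha>) \<in> \<Delta>" if "\<alpha> \<in> \<Delta>" "\<alpha> \<noteq> S" for \<alpha>
  proof (cases "\<alpha> = R")
    case True
    then show ?thesis using P_simple by (simp add: wR P_def)
  next
    case False
    then show ?thesis using that w_simple[of \<alpha>] w_simple[of "w \<alpha>"] w_inj[of \<alpha> S] wS by auto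
  qed
  have lin: "linear (\<lambda>x. w (w x))" using linear_compose[OF linear_w linear_w] by (simp add: o_def)
  have e: "cf (w (w \<beta>)) \<delta> = (\<Sum>\<alpha>\<in>\<Delta>. cf \<beta> \<alpha> * cf (w (w \<alpha>)) \<delta>)" for \<delta>
    using b by (subst linear_expand[OF lin], simp add: pos_root root_in_span, subst cf_sum)
      (auto simp: span_scale cf_scale w_in_span simple_in_span)
  show ?thesis
  proof
    assume p: "w (w \<beta>) \<in> pos"
    have Q: "w P \<in> \<Delta>" using w_simple P_simple P_neq_R by blast
    have "cf \<beta> \<alpha> * cf (w (w \<alpha>)) (w P) = (if \<alpha> = S then - (cf \<beta> S * cf \<eta> (w P)) else 0)"
      if a: "\<alpha> \<in> \<Delta>" for \<alpha>
    proof (cases "\<alpha> = S")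
      case True
      then show ?thesis by (simp add: wS wR cf_minus root_in_span highest_root)
    next
      case False
      have "w (w \<alpha>) \<noteq> w P" using w_inj w_neq_P[OF a] by blast
      then show ?thesis using False ww[OF a] by (simp add: cf_simple)
    qed
    then have "cf (w (w \<beta>)) (w P) = - (cf \<beta> S * cf \<eta> (w P))" using S finite_simple by (simp add: e)
    moreover have "cf (w (w \<beta>)) (w P) \<ge> 0" using p Q by (simp add: pos_iff)
    ultimately show "cf \<beta> S = 0" using cf_S_cases[OF b] highest_root_cf[OF Q] by auto
  next
    assume z: "cf \<beta> S = 0"
    have "cf \<beta> \<alpha> * cf (w (w \<alpha>)) \<delta> \<ge> 0" if "\<alpha> \<in> \<Delta>" for \<alpha> \<delta>
      using z b that ww by (cases "\<alpha> = S") (auto simp: cf_simple pos_iff)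
    then show "w (w \<beta>) \<in> pos" using b by (auto simp: pos_iff w_root e intro!: sum_nonneg)
  qed
qed

section \<open>The root sets \<open>F i j\<close> and the fibres of the projections\<close>

abbreviation F :: "nat \<Rightarrow> nat \<Rightarrow> (real ^ 'n) set"
  where "F \<equiv> coeff_roots \<Phi> \<Delta> R S"

lemma F_iff: "\<beta> \<in> F i j \<longleftrightarrow> \<beta> \<in> pos \<and> cf \<beta> R = real i \<and> cf \<beta> S = real j"
  by (simp add: coeff_roots_def)

lemma finite_F: "finite (F i j)"
  by (rule finite_subset[OF _ finite_pos]) (auto simp: F_iff)

lemma F_root: "\<beta> \<in> F i j \<Longrightarrow> \<beta> \<in> \<Phi>"
  by (simp add: F_iff pos_root)

lemma F_span: "\<beta> \<in> F i j \<Longrightarrow> \<beta> \<in> span \<Phi>"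
  by (simp add: F_root root_in_span)

lemma sign_roots_eq: "sign_roots \<Phi> \<Delta> w = F 1 0"
proof -
  have "\<beta> \<in> sign_roots \<Phi> \<Delta> w \<longleftrightarrow> \<beta> \<in> pos \<and> cf \<beta> R \<noteq> 0 \<and> cf \<beta> S = 0" for \<beta>
    using w_pos_iff w_w_pos_iff not_pos_iff[OF w_root] pos_root
    by (auto simp: sign_roots_def neg_roots_iff)
  moreover have "cf \<beta> R \<noteq> 0 \<longleftrightarrow> cf \<beta> R = 1" if "\<beta> \<in> pos" for \<beta> using cf_R_cases[OF that] by auto
  ultimately show ?thesis by (auto simp: F_iff)
qed

lemma ip_R: "ip R R = 2"
  using ip_w[of R R] ip_highest by (simp add: wR ip_linear)

lemma ip_S: "ip S S = 2"
  using ip_w[of S S] ip_R by (simp add: wS)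

lemma height_w_w: "x \<in> span \<Phi> \<Longrightarrow>
    height \<Delta> x - 2 * height \<Delta> (w x) + height \<Delta> (w (w x)) = (1 + height \<Delta> \<eta>) * (2 * cf x R - cf x S)"
  using height_w[of x] height_w[of "w x"] by (simp add: w_in_span cf_w_R algebra_simps)

lemma root_coeff_mixed: "\<beta> \<in> \<Phi> \<Longrightarrow> \<alpha> \<in> \<Delta> \<Longrightarrow> \<gamma> \<in> \<Delta> \<Longrightarrow> cf \<beta> \<alpha> > 0 \<Longrightarrow> cf \<beta> \<gamma> \<ge> 0"
  using pos_cf_pos[of \<beta> \<alpha>] by (simp add: pos_iff)

lemma R_in_F: "R \<in> F 1 0" and S_in_F: "S \<in> F 0 1" and highest_in_F: "\<eta> \<in> F 1 1"
  using R S R_neq_S simple_pos highest_root_pos cf_highest_R cf_highest_S by (auto simp: F_iff cf_simple)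

text \<open>The coefficients at \<open>R\<close> and \<open>S\<close> come out right automatically,
  and a positive coefficient gives positivity, so being a root is the only condition.\<close>

lemma sum_in_F_iff: "\<alpha> \<in> F 0 1 \<Longrightarrow> \<beta> \<in> F 1 0 \<Longrightarrow> \<alpha> + \<beta> \<in> F 1 1 \<longleftrightarrow> \<alpha> + \<beta> \<in> \<Phi>"
  using pos_cf_pos[of "\<alpha> + \<beta>" R] R F_span F_root by (auto simp: F_iff cf_add root_in_span pos_root)

lemma diff_in_F10_iff: "\<gamma> \<in> F 1 1 \<Longrightarrow> \<alpha> \<in> F 0 1 \<Longrightarrow> \<gamma> - \<alpha> \<in> F 1 0 \<longleftrightarrow> \<gamma> - \<alpha> \<in> \<Phi>"
  using pos_cf_pos[of "\<gamma> - \<alpha>" R] R by (auto simp: F_iff cf_diff root_in_span pos_root)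

lemma diff_in_F01_iff: "\<gamma> \<in> F 1 1 \<Longrightarrow> \<beta> \<in> F 1 0 \<Longrightarrow> \<gamma> - \<beta> \<in> F 0 1 \<longleftrightarrow> \<gamma> - \<beta> \<in> \<Phi>"
  using pos_cf_pos[of "\<gamma> - \<beta>" S] S by (auto simp: F_iff cf_diff root_in_span pos_root)

abbreviation T :: "((real ^ 'n) \<times> (real ^ 'n) \<times> (real ^ 'n)) set"
  where "T \<equiv> root_triples \<Phi> \<Delta> R S"

lemma card_fibre_01:
  assumes "\<alpha> \<in> F 0 1"
  shows "card {t \<in> T. fst t = \<alpha>} = card {\<beta> \<in> F 1 0. \<alpha> + \<beta> \<in> \<Phi>}"
proof -
  have "{t \<in> T. fst t = \<alpha>} = (\<lambda>\<beta>. (\<alpha>, \<beta>, \<alpha> + \<beta>)) ` {\<beta> \<in> F 1 0. \<alpha> + \<beta> \<in> \<Phi>}"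
    using assms sum_in_F_iff[of \<alpha>] by (auto simp: root_triples_def F_root)
  then show ?thesis by (simp add: card_image inj_on_def)
qed

lemma card_fibre_10:
  assumes "\<beta> \<in> F 1 0"
  shows "card {t \<in> T. fst (snd t) = \<beta>} = card {\<alpha> \<in> F 0 1. \<alpha> + \<beta> \<in> \<Phi>}"
proof -
  have "{t \<in> T. fst (snd t) = \<beta>} = (\<lambda>\<alpha>. (\<alpha>, \<beta>, \<alpha> + \<beta>)) ` {\<alpha> \<in> F 0 1. \<alpha> + \<beta> \<in> \<Phi>}"
    using assms sum_in_F_iff[of _ \<beta>] by (auto simp: root_triples_def F_root)
  then show ?thesis by (simp add: card_image inj_on_def)
qed

lemma card_fibre_11:
  assumes "\<gamma> \<in> F 1 1"
  shows card_fibre_11_01: "card {t \<in> T. snd (snd t) = \<gamma>} = card {\<alpha> \<in> F 0 1. \<gamma> - \<alpha> \<in> \<Phi>}"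
    and card_fibre_11_10: "card {t \<in> T. snd (snd t) = \<gamma>} = card {\<beta> \<in> F 1 0. \<gamma> - \<beta> \<in> \<Phi>}"
proof -
  have "{t \<in> T. snd (snd t) = \<gamma>} = (\<lambda>\<alpha>. (\<alpha>, \<gamma> - \<alpha>, \<gamma>)) ` {\<alpha> \<in> F 0 1. \<gamma> - \<alpha> \<in> \<Phi>}"
    using assms diff_in_F10_iff[of \<gamma>] by (auto simp: root_triples_def F_root image_iff)
  then show "card {t \<in> T. snd (snd t) = \<gamma>} = card {\<alpha> \<in> F 0 1. \<gamma> - \<alpha> \<in> \<Phi>}"
    by (simp add: card_image inj_on_def)
  have "{t \<in> T. snd (snd t) = \<gamma>} = (\<lambda>\<beta>. (\<gamma> - \<beta>, \<beta>, \<gamma>)) ` {\<beta> \<in> F 1 0. \<gamma> - \<beta> \<in> \<Phi>}"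
    using assms diff_in_F01_iff[of \<gamma>] by (auto simp: root_triples_def F_root image_iff)
  then show "card {t \<in> T. snd (snd t) = \<gamma>} = card {\<beta> \<in> F 1 0. \<gamma> - \<beta> \<in> \<Phi>}"
    by (simp add: card_image inj_on_def)
qed

section \<open>Root sums and their inner products\<close>

abbreviation E :: "nat \<Rightarrow> nat \<Rightarrow> real ^ 'n"
  where "E i j \<equiv> \<Sum>(F i j)"

lemma E_in_span: "E i j \<in> span \<Phi>"
  by (rule span_sum) (rule F_span)

text \<open>The reflection in \<open>\<alpha>\<close> leaves the coefficients at \<open>R\<close>
  and \<open>S\<close> alone and keeps \<open>F i j\<close> positive, since \<open>\<alpha>\<close>
  itself lies in \<open>F 0 0\<close>.\<close>

lemma ip_E_orthogonal:
  assumes "\<alpha> \<in> \<Delta>" "\<alpha> \<noteq> R" "\<alpha> \<noteq> S" "(i, j) \<noteq> (0, 0)"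
  shows "ip (E i j) \<alpha> = 0"
proof (rule sum_refl_stable_orthogonal)
  show "refl \<alpha> \<beta> \<in> F i j" if "\<beta> \<in> F i j" for \<beta>
  proof -
    have "\<beta> \<noteq> \<alpha>" using that assms by (auto simp: F_iff cf_simple)
    then show ?thesis using that assms refl_pos by (auto simp: F_iff cf_refl pos_root root_in_span)
  qed
qed (use assms finite_F in auto)

lemma ip_E_expand:
  assumes "(i, j) \<noteq> (0, 0)" "v \<in> span \<Phi>"
  shows "ip (E i j) v = ip (E i j) R * cf v R + ip (E i j) S * cf v S"
proof -
  have "cf v \<alpha> * ip (E i j) \<alpha> = (if \<alpha> = R then ip (E i j) R * cf v R else 0)
      + (if \<alpha> = S then ip (E i j) S * cf v S else 0)" if "\<alpha> \<in> \<Delta>" for \<alpha>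
    using that R_neq_S ip_E_orthogonal[OF that _ _ assms(1)] by auto
  then have "ip (E i j) v = (\<Sum>\<alpha>\<in>\<Delta>. (if \<alpha> = R then ip (E i j) R * cf v R else 0)
      + (if \<alpha> = S then ip (E i j) S * cf v S else 0))"
    using assms(2) by (simp add: ip_expand)
  then show ?thesis using R S finite_simple by (simp add: sum.distrib)
qed

text \<open>For \<open>\<beta>\<close> in \<open>F 1 0\<close> the difference
  \<open>\<beta> - S\<close> has coefficients of both signs and is no root. So
  \<open>\<beta>\<close> contributes -1 exactly when \<open>S + \<beta>\<close> is a root, which
  counts the fibre over \<open>S\<close>.\<close>

lemma ip_E10_S: "ip (E 1 0) S = - real (card {t \<in> T. fst t = S})"
proof -
  have "ip \<beta> S = - (if S + \<beta> \<in> \<Phi> then 1 else 0)" if b: "\<beta> \<in> F 1 0" for \<beta>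
  proof -
    have "\<beta> - S \<notin> \<Phi>"
      using root_coeff_mixed[of "\<beta> - S" R S] b R S R_neq_S F_span[OF b]
      by (auto simp: F_iff cf_diff simple_in_span cf_simple)
    moreover have "\<beta> \<noteq> S" "\<beta> \<noteq> - S"
      using b S R_neq_S by (auto simp: F_iff cf_simple cf_minus simple_in_span)
    ultimately show ?thesis using ip_long_nonpos[of \<beta> S] F_root[OF b] S ip_S
      by (simp add: simple_root add.commute)
  qed
  then have "ip (E 1 0) S = (\<Sum>\<beta>\<in>F 1 0. - (if S + \<beta> \<in> \<Phi> then 1 else 0))" by (simp add: ip_sum_left)
  then show ?thesis using finite_F by (simp add: sum_negf card_fibre_01[OF S_in_F] sum.If_cases Int_def)
qed

lemma ip_E01_R: "ip (E 0 1) R = - real (card {t \<in> T. fst (snd t) = R})"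
proof -
  have "ip \<alpha> R = - (if \<alpha> + R \<in> \<Phi> then 1 else 0)" if b: "\<alpha> \<in> F 0 1" for \<alpha>
  proof -
    have "\<alpha> - R \<notin> \<Phi>"
      using root_coeff_mixed[of "\<alpha> - R" S R] b R S R_neq_S F_span[OF b]
      by (auto simp: F_iff cf_diff simple_in_span cf_simple)
    moreover have "\<alpha> \<noteq> R" "\<alpha> \<noteq> - R"
      using b R R_neq_S by (auto simp: F_iff cf_simple cf_minus simple_in_span)
    ultimately show ?thesis using ip_long_nonpos[of \<alpha> R] F_root[OF b] R ip_R
      by (simp add: simple_root)
  qed
  then have "ip (E 0 1) R = (\<Sum>\<alpha>\<in>F 0 1. - (if \<alpha> + R \<in> \<Phi> then 1 else 0))" by (simp add: ip_sum_left)
  then show ?thesis using finite_F by (simp add: sum_negf card_fibre_10[OF R_in_F] sum.If_cases Int_def)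
qed

lemma ip_pos_highest:
  assumes "\<beta> \<in> pos" "\<beta> \<noteq> \<eta>"
  shows "ip \<beta> \<eta> = (if \<eta> - \<beta> \<in> \<Phi> then 1 else 0)"
proof -
  have "\<beta> + \<eta> \<notin> \<Phi>"
  proof
    assume "\<beta> + \<eta> \<in> \<Phi>"
    then have "cf (\<beta> + \<eta>) \<alpha> \<le> cf \<eta> \<alpha>" if "\<alpha> \<in> \<Delta>" for \<alpha> using highest_root_ge that by blast
    then have "cf \<beta> \<alpha> = 0" if "\<alpha> \<in> \<Delta>" for \<alpha>
      using that assms by (force simp: cf_add pos_iff root_in_span highest_root intro: order_antisym)
    then show False using root_cf_nonzero pos_root[OF assms(1)] by blast
  qed
  moreover have "\<beta> \<noteq> - \<eta>" using assms not_pos_iff[OF highest_root] highest_root_pos by blast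
  moreover have "\<beta> - \<eta> \<in> \<Phi> \<longleftrightarrow> \<eta> - \<beta> \<in> \<Phi>" using uminus_root_iff[of "\<beta> - \<eta>"] by simp
  ultimately show ?thesis
    using ip_long_nonneg[of \<beta> \<eta>] assms highest_root ip_highest by (simp add: pos_root)
qed

lemma ip_E01_highest: "ip (E 0 1) \<eta> = real (card {t \<in> T. snd (snd t) = \<eta>})"
proof -
  have "ip \<alpha> \<eta> = (if \<eta> - \<alpha> \<in> \<Phi> then 1 else 0)" if "\<alpha> \<in> F 0 1" for \<alpha>
    using that cf_highest_R by (intro ip_pos_highest) (auto simp: F_iff)
  then have "ip (E 0 1) \<eta> = (\<Sum>\<alpha>\<in>F 0 1. if \<eta> - \<alpha> \<in> \<Phi> then 1 else 0)" by (simp add: ip_sum_left)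
  then show ?thesis using finite_F by (simp add: card_fibre_11_01[OF highest_in_F] sum.If_cases Int_def)
qed

lemma ip_E10_highest: "ip (E 1 0) \<eta> = real (card {t \<in> T. snd (snd t) = \<eta>})"
proof -
  have "ip \<alpha> \<eta> = (if \<eta> - \<alpha> \<in> \<Phi> then 1 else 0)" if "\<alpha> \<in> F 1 0" for \<alpha>
    using that cf_highest_S by (intro ip_pos_highest) (auto simp: F_iff)
  then have "ip (E 1 0) \<eta> = (\<Sum>\<alpha>\<in>F 1 0. if \<eta> - \<alpha> \<in> \<Phi> then 1 else 0)" by (simp add: ip_sum_left)
  then show ?thesis using finite_F by (simp add: card_fibre_11_10[OF highest_in_F] sum.If_cases Int_def)
qed

end

section \<open>Fibre sizes and the Coxeter number\<close>

context based_root_datum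
begin

text \<open>When all roots are long, pairing with a coroot is \<open>ip\<close>, so
  \<open>rform\<close> is a sum over \<open>\<Phi>\<close> and hence twice the sum over the positive
  roots.\<close>

lemma sum_ip_squares:
  assumes laced: "\<And>\<beta>. \<beta> \<in> \<Phi> \<Longrightarrow> ip \<beta> \<beta> = 2"
  shows "(\<Sum>\<beta>\<in>pos. ip x \<beta> * ip y \<beta>) = rform \<eta> \<eta> / 4 * ip x y"
proof -
  have un: "\<Phi> = pos \<union> uminus ` pos"
  proof
    show "\<Phi> \<subseteq> pos \<union> uminus ` pos"
    proof
      fix \<beta> assume "\<beta> \<in> \<Phi>"
      then show "\<beta> \<in> pos \<union> uminus ` pos"
        using not_pos_iff[of \<beta>] by (cases "\<beta> \<in> pos") (auto simp: image_iff, metis minus_minus)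
    qed
  qed (auto simp: pos_root uminus_root)
  have dis: "pos \<inter> uminus ` pos = {}" using not_pos_iff pos_root uminus_root by fastforce
  have "rform x y = (\<Sum>\<beta>\<in>\<Phi>. ip x \<beta> * ip y \<beta>)"
    unfolding rform_def by (intro sum.cong) (auto simp: inner_coroot_ip_long laced)
  also have "\<dots> = (\<Sum>\<beta>\<in>pos. ip x \<beta> * ip y \<beta>) + (\<Sum>\<beta>\<in>uminus ` pos. ip x \<beta> * ip y \<beta>)"
    by (subst un, rule sum.union_disjoint) (use finite_pos dis in auto)
  also have "(\<Sum>\<beta>\<in>uminus ` pos. ip x \<beta> * ip y \<beta>) = (\<Sum>\<beta>\<in>pos. ip x \<beta> * ip y \<beta>)"
    by (subst sum.reindex) (auto simp: inj_on_def ip_linear)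
  finally show ?thesis using rform_highest_pos by (simp add: ip_def)
qed

text \<open>The trace of \<open>sum_ip_squares\<close>, computed with the simple roots and their
  dual basis \<open>wt \<alpha>\<close>.\<close>

lemma card_pos_ip:
  assumes laced: "\<And>\<beta>. \<beta> \<in> \<Phi> \<Longrightarrow> ip \<beta> \<beta> = 2"
  shows "2 * real (card pos) = rform \<eta> \<eta> / 4 * real (card \<Delta>)"
proof -
  have e: "ip \<beta> \<beta> = (\<Sum>\<alpha>\<in>\<Delta>. ip (wt \<alpha>) \<beta> * ip \<alpha> \<beta>)" if "\<beta> \<in> \<Phi>" for \<beta>
  proof -
    have "ip \<beta> \<beta> = (\<Sum>\<alpha>\<in>\<Delta>. cf \<beta> \<alpha> * ip \<beta> \<alpha>)" by (rule ip_expand[OF root_in_span[OF that]])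
    also have "\<dots> = (\<Sum>\<alpha>\<in>\<Delta>. ip (wt \<alpha>) \<beta> * ip \<alpha> \<beta>)"
    proof (rule sum.cong[OF HOL.refl])
      fix \<alpha> assume "\<alpha> \<in> \<Delta>"
      then have "ip (wt \<alpha>) \<beta> = cf \<beta> \<alpha>" using that by (intro ip_wt laced) (auto simp: simple_root root_in_span)
      then show "cf \<beta> \<alpha> * ip \<beta> \<alpha> = ip (wt \<alpha>) \<beta> * ip \<alpha> \<beta>" by (simp add: ip_commute[of \<beta> \<alpha>])
    qed
    finally show ?thesis .
  qed
  have "2 * real (card pos) = (\<Sum>\<beta>\<in>pos. ip \<beta> \<beta>)" using laced by (simp add: pos_root)
  also have "\<dots> = (\<Sum>\<beta>\<in>pos. \<Sum>\<alpha>\<in>\<Delta>. ip (wt \<alpha>) \<beta> * ip \<alpha> \<beta>)"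
    by (rule sum.cong) (auto simp: e pos_root)
  also have "\<dots> = (\<Sum>\<alpha>\<in>\<Delta>. \<Sum>\<beta>\<in>pos. ip (wt \<alpha>) \<beta> * ip \<alpha> \<beta>)" by (rule sum.swap)
  also have "\<dots> = (\<Sum>\<alpha>\<in>\<Delta>. rform \<eta> \<eta> / 4)"
    by (intro sum.cong) (auto simp: sum_ip_squares[OF laced] ip_wt laced simple_root simple_in_span cf_simple)
  finally show ?thesis by (simp add: mult.commute)
qed

text \<open>The reflection in a simple root permutes the other positive roots, so the sum of all
  positive roots pairs to 2 with every simple root.\<close>

lemma sum_ip_pos:
  assumes laced: "\<And>\<beta>. \<beta> \<in> \<Phi> \<Longrightarrow> ip \<beta> \<beta> = 2" and v: "v \<in> span \<Phi>"
  shows "(\<Sum>\<beta>\<in>pos. ip v \<beta>) = 2 * height \<Delta> v"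
proof -
  have s: "ip (\<Sum>pos) \<alpha> = 2" if a: "\<alpha> \<in> \<Delta>" for \<alpha>
  proof -
    have "ip (\<Sum>(pos - {\<alpha>})) \<alpha> = 0"
    proof (rule sum_refl_stable_orthogonal[OF a])
      show "refl \<alpha> \<beta> \<in> pos - {\<alpha>}" if "\<beta> \<in> pos - {\<alpha>}" for \<beta>
      proof -
        have "refl \<alpha> \<beta> \<noteq> \<alpha>"
        proof
          assume "refl \<alpha> \<beta> = \<alpha>"
          then have "\<beta> = - \<alpha>"
            using reflection_reflection[of \<alpha> \<beta>] reflection_self[of \<alpha>] a by (simp add: simple_root)
          then show False using that not_pos_iff[of \<alpha>] simple_pos[OF a] simple_root[OF a] by auto
        qed
        then show ?thesis using refl_pos a that by simp
      qed
    qed (use finite_pos in auto)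
    moreover have "\<Sum>pos = \<alpha> + \<Sum>(pos - {\<alpha>})"
      using sum.remove[OF finite_pos simple_pos[OF a], of "\<lambda>x. x"] by simp
    ultimately show ?thesis using laced a by (simp add: ip_linear simple_root)
  qed
  have "(\<Sum>\<beta>\<in>pos. ip v \<beta>) = ip (\<Sum>pos) v" by (simp only: ip_sum_left ip_commute[of v])
  also have "\<dots> = (\<Sum>\<alpha>\<in>\<Delta>. cf v \<alpha> * 2)" using v by (simp add: ip_expand s)
  finally show ?thesis by (simp add: height_def sum_distrib_left mult.commute)
qed

text \<open>The shorter root pairs to at most 1 with the coroot of the longer one, so
  \<open>ip \<alpha> \<gamma>\<close> is at most half the larger square length. As
  \<open>\<gamma>\<close> is short, the value 1 requires \<open>\<alpha>\<close> to be long.\<close>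

lemma short_pair:
  assumes "\<alpha> \<in> \<Phi>" "\<gamma> \<in> \<Phi>" "\<alpha> \<noteq> \<gamma>" and short: "ip \<gamma> \<gamma> < 2"
  shows "ip \<alpha> \<gamma> \<le> 1" and "ip \<alpha> \<gamma> = 1 \<Longrightarrow> ip \<alpha> \<alpha> = 2"
proof -
  have "ip \<alpha> \<gamma> < 1 \<or> ip \<alpha> \<gamma> \<le> ip \<alpha> \<alpha> / 2"
  proof (cases "rform \<alpha> \<alpha> \<le> rform \<gamma> \<gamma>")
    case True
    then have "\<alpha> \<bullet> coroot \<gamma> \<le> 1" using inner_coroot_long_le assms by blast
    then show ?thesis using short ip_root_pos[OF assms(2)] assms by (simp add: inner_coroot_ip field_simps)
  next
    case False
    then have "\<gamma> \<bullet> coroot \<alpha> \<le> 1" using inner_coroot_long_le[of \<gamma> \<alpha>] assms by auto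
    then show ?thesis using ip_root_pos[OF assms(1)] assms
      by (simp add: inner_coroot_ip field_simps ip_commute[of \<gamma> \<alpha>])
  qed
  then show "ip \<alpha> \<gamma> \<le> 1" and "ip \<alpha> \<gamma> = 1 \<Longrightarrow> ip \<alpha> \<alpha> = 2"
    using ip_root_le[OF assms(1)] by auto
qed

text \<open>An element of \<open>X\<close> contributes at most 1 if
  \<open>\<gamma> - \<alpha>\<close> is a root and at most 0 otherwise. The total reaches this
  bound, so each contribution does.\<close>

lemma short_fibre:
  assumes "finite X" "X \<subseteq> \<Phi>" "\<gamma> \<in> \<Phi>" "\<gamma> \<notin> X" "ip \<gamma> \<gamma> < 2"
    and sum: "ip (\<Sum>X) \<gamma> = real (card {\<alpha>\<in>X. \<gamma> - \<alpha> \<in> \<Phi>})"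
    and a: "\<alpha> \<in> X" "\<gamma> - \<alpha> \<in> \<Phi>"
  shows "ip \<alpha> \<gamma> = 1"
proof -
  let ?g = "\<lambda>\<alpha>. (if \<gamma> - \<alpha> \<in> \<Phi> then 1 else 0) - ip \<alpha> \<gamma>"
  have nn: "?g \<alpha> \<ge> 0" if "\<alpha> \<in> X" for \<alpha>
  proof -
    have "\<alpha> \<in> \<Phi>" "\<alpha> \<noteq> \<gamma>" using that assms by auto
    then show ?thesis
      using short_pair(1)[of \<alpha> \<gamma>] ip_diff_root[of \<gamma> \<alpha>] ip_commute[of \<gamma> \<alpha>] assms(3,5) by force
  qed
  have "(\<Sum>\<alpha>\<in>X. ?g \<alpha>) = 0"
    using sum assms(1) by (simp add: sum_subtractf ip_sum_left sum.If_cases Int_def)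
  then have "\<forall>\<alpha>\<in>X. ?g \<alpha> = 0" using nn assms(1) by (subst (asm) sum_nonneg_eq_0_iff) auto
  then show ?thesis using a by auto
qed

end

locale affine_rotation_fibres = affine_rotation \<Phi> coroot \<Delta> w ws R S
  for \<Phi> :: "(real ^ 'n) set" and coroot :: "real ^ 'n \<Rightarrow> real ^ 'n" and \<Delta> w ws R S +
  fixes a b c :: nat
  assumes fibre_01: "\<alpha> \<in> F 0 1 \<Longrightarrow> card {t \<in> T. fst t = \<alpha>} = a"
    and fibre_10: "\<beta> \<in> F 1 0 \<Longrightarrow> card {t \<in> T. fst (snd t) = \<beta>} = b"
    and fibre_11: "\<gamma> \<in> F 1 1 \<Longrightarrow> card {t \<in> T. snd (snd t) = \<gamma>} = c"
begin

lemma ip_E01: "v \<in> span \<Phi> \<Longrightarrow> ip (E 0 1) v = - b * cf v R + (b + c) * cf v S"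
proof -
  assume v: "v \<in> span \<Phi>"
  have R': "ip (E 0 1) R = - real b" using ip_E01_R fibre_10[OF R_in_F] by simp
  have "ip (E 0 1) R + ip (E 0 1) S = c"
    using ip_E01_highest fibre_11[OF highest_in_F] ip_E_expand[of 0 1 \<eta>]
    by (simp add: cf_highest_R cf_highest_S root_in_span highest_root)
  then have "ip (E 0 1) S = b + c" using R' by simp
  then show ?thesis using ip_E_expand[of 0 1 v] R' v by simp
qed

lemma ip_E10: "v \<in> span \<Phi> \<Longrightarrow> ip (E 1 0) v = (a + c) * cf v R - a * cf v S"
proof -
  assume v: "v \<in> span \<Phi>"
  have S': "ip (E 1 0) S = - real a" using ip_E10_S fibre_01[OF S_in_F] by simp
  have "ip (E 1 0) R + ip (E 1 0) S = c"
    using ip_E10_highest fibre_11[OF highest_in_F] ip_E_expand[of 1 0 \<eta>]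
    by (simp add: cf_highest_R cf_highest_S root_in_span highest_root)
  then have "ip (E 1 0) R = a + c" using S' by simp
  then show ?thesis using ip_E_expand[of 1 0 v] S' v by simp
qed

text \<open>By \<open>cf_w_R\<close>, \<open>wt S\<close> is \<open>wt R + u\<close>, where
  \<open>w u = wt R\<close>. Since \<open>u\<close> and \<open>wt R\<close> have the same length,
  \<open>wt S\<close> pairs equally with both.\<close>

lemma ip_wt_S_wt_S: "ip (wt S) (wt S) = 2 * ip (wt R) (wt S)"
proof -
  have s: "ip (wt S) v = ip (wt R) v + ip (wt R) (w v)" if "v \<in> span \<Phi>" for v
    using that S R by (simp add: ip_wt ip_S ip_R w_in_span cf_w_R)
  define u where "u = word (rev ws) (wt R)"
  have wu: "w u = wt R" using word_word_rev[OF ws_roots] by (simp add: u_def w_word)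
  have us: "u \<in> span \<Phi>" using word_in_span[of "rev ws"] ws_roots R by (simp add: u_def wt_in_span)
  have "ip (wt S) (wt S) = ip (wt R) (wt S) + ip (w u) (w (wt S))"
    using s[of "wt S"] S by (simp add: wt_in_span wu)
  also have "ip (w u) (w (wt S)) = ip (wt S) u" by (simp add: ip_w ip_commute)
  also have "\<dots> = ip (wt R) u + ip (wt R) (wt R)" using s[OF us] by (simp only: wu)
  also have "ip (wt R) u = ip (wt R) (w (wt R))" by (metis ip_w wu ip_commute)
  also have "ip (wt R) (w (wt R)) + ip (wt R) (wt R) = ip (wt S) (wt R)"
    using s[OF wt_in_span[OF R]] by simp
  finally show ?thesis by (simp add: ip_commute[of "wt S" "wt R"])
qed

text \<open>The coefficients of \<open>E 1 0\<close> are pinned down by its orthogonality to \<open>wt S\<close>.\<close>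

lemma a_eq_c: "a = c"
proof -
  have "ip (wt S) (E 1 0) = cf (E 1 0) S" using S by (simp add: ip_wt ip_S E_in_span)
  also have "\<dots> = 0" by (simp add: cf_sum F_span) (simp add: F_iff)
  finally have "(a + c) * cf (wt S) R - a * cf (wt S) S = 0"
    using ip_E10[of "wt S"] S by (simp add: wt_in_span ip_commute)
  moreover have "cf (wt S) R = ip (wt R) (wt S)" "cf (wt S) S = ip (wt S) (wt S)"
    using R S by (simp_all add: ip_wt ip_R ip_S wt_in_span)
  ultimately have "(real c - real a) * ip (wt R) (wt S) = 0"
    by (simp add: ip_wt_S_wt_S algebra_simps)
  moreover have "wt S \<noteq> 0" using wt_coroot[OF S S] by auto
  then have "ip (wt S) (wt S) > 0" using ip_pos wt_in_span S by blast
  then have "ip (wt R) (wt S) \<noteq> 0" by (simp add: ip_wt_S_wt_S)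
  ultimately show ?thesis by simp
qed

text \<open>If \<open>a = c = 0\<close>, the \<open>R\<close>-coefficient of \<open>E 1 0\<close>,
  which counts the elements of \<open>F 1 0\<close>, would vanish; but \<open>R\<close> is one of
  them.\<close>

lemma c_positive: "c > 0"
proof (rule ccontr)
  assume "\<not> c > 0"
  then have "ip (E 1 0) (wt R) = 0" using ip_E10[of "wt R"] a_eq_c R by (simp add: wt_in_span)
  then have "cf (E 1 0) R = 0" using R by (simp add: ip_commute[of _ "wt R"] ip_wt ip_R E_in_span)
  moreover have "cf (E 1 0) R = (\<Sum>\<beta>\<in>F 1 0. 1)" by (simp add: cf_sum F_span) (simp add: F_iff)
  ultimately show False using R_in_F finite_F by auto
qed

text \<open>Both \<open>E 0 1\<close> and \<open>E 1 0\<close> pair with \<open>\<gamma>\<close> to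
  the fibre size \<open>c\<close>. For a short \<open>\<gamma>\<close>, \<open>short_fibre\<close>
  would make both summands of some decomposition
  \<open>\<gamma> = \<alpha> + (\<gamma> - \<alpha>)\<close> pair to 1 with \<open>\<gamma>\<close>,
  giving it square length 2 after all.\<close>

lemma F11_long:
  assumes g: "\<gamma> \<in> F 1 1" shows "ip \<gamma> \<gamma> = 2"
proof (rule ccontr)
  assume "ip \<gamma> \<gamma> \<noteq> 2"
  then have short: "ip \<gamma> \<gamma> < 2" using ip_root_le[OF F_root[OF g]] by simp
  have "ip (E 0 1) \<gamma> = c" "ip (E 1 0) \<gamma> = c"
    using ip_E01[OF F_span[OF g]] ip_E10[OF F_span[OF g]] g by (auto simp: F_iff)
  then have s: "ip (E 0 1) \<gamma> = card {\<alpha>\<in>F 0 1. \<gamma> - \<alpha> \<in> \<Phi>}" "ip (E 1 0) \<gamma> = card {\<alpha>\<in>F 1 0. \<gamma> - \<alpha> \<in> \<Phi>}"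
    using fibre_11[OF g] card_fibre_11_01[OF g] card_fibre_11_10[OF g] by simp_all
  have "card {\<alpha>\<in>F 0 1. \<gamma> - \<alpha> \<in> \<Phi>} > 0"
    using c_positive fibre_11[OF g] card_fibre_11_01[OF g] by simp
  then obtain \<alpha> where al: "\<alpha> \<in> F 0 1" "\<gamma> - \<alpha> \<in> \<Phi>" by (auto simp: card_gt_0_iff)
  have "\<gamma> \<notin> F 0 1" "\<gamma> \<notin> F 1 0" using g by (auto simp: F_iff)
  then have one: "ip \<alpha> \<gamma> = 1" "ip (\<gamma> - \<alpha>) \<gamma> = 1"
    using short_fibre[OF finite_F _ _ _ short s(1), of \<alpha>] short_fibre[OF finite_F _ _ _ short s(2), of "\<gamma> - \<alpha>"]
      al diff_in_F10_iff[OF g al(1)] F_root g by auto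
  then have "ip \<gamma> \<gamma> = 2" by (simp add: ip_linear)
  then show False using short by simp
qed

text \<open>Every root length occurs for a dominant root, which has full support and so lies in
  \<open>F 1 1\<close>.\<close>

lemma simply_laced:
  assumes "\<beta> \<in> \<Phi>" shows "ip \<beta> \<beta> = 2"
proof -
  obtain \<mu> where m: "\<mu> \<in> \<Phi>" "dominant \<mu>" "rform \<mu> \<mu> = rform \<beta> \<beta>"
    using ex_dominant_root_same_length[OF assms] .
  have full: "cf \<mu> \<alpha> \<ge> 1" if "\<alpha> \<in> \<Delta>" for \<alpha> using dominant_root_full_support m that by blast
  have "\<mu> \<in> pos" using full m by (force simp: pos_iff)
  then have "\<mu> \<in> F 1 1"
    using full[OF R] full[OF S] cf_R_cases[of \<mu>] cf_S_cases[of \<mu>] by (auto simp: F_iff)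
  then show ?thesis using F11_long[of \<mu>] m by (simp add: ip_def)
qed

text \<open>The union of \<open>F 1 0\<close> and \<open>F 1 1\<close> is stable under the
  reflection in \<open>S\<close>, that of \<open>F 0 1\<close> and \<open>F 1 1\<close> under the
  one in \<open>R\<close>. This determines the pairings of \<open>E 1 1\<close> with
  \<open>S\<close> and \<open>R\<close>.\<close>

lemma ip_E10_E11:
  assumes v: "v \<in> span \<Phi>"
  shows "ip (E 1 0 + E 1 1) v = (a + b + c) * cf v R"
proof -
  have st: "ip (E 1 0 + E 1 1) S = 0"
  proof -
    have "E 1 0 + E 1 1 = \<Sum>(F 1 0 \<union> F 1 1)"
      using finite_F by (subst sum.union_disjoint) (auto simp: F_iff)
    moreover have "ip (\<Sum>(F 1 0 \<union> F 1 1)) S = 0"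
    proof (rule sum_refl_stable_orthogonal[OF S])
      fix \<beta> assume "\<beta> \<in> F 1 0 \<union> F 1 1"
      then have b: "\<beta> \<in> pos" "cf \<beta> R = 1" by (auto simp: F_iff)
      then have "\<beta> \<noteq> S" using S R_neq_S by (auto simp: cf_simple)
      then have "refl S \<beta> \<in> pos" using refl_pos S b by blast
      moreover have "cf (refl S \<beta>) R = 1" using b R_neq_S S by (simp add: cf_refl pos_root root_in_span)
      ultimately show "refl S \<beta> \<in> F 1 0 \<union> F 1 1" using cf_S_cases by (auto simp: F_iff)
    qed (use finite_F in auto)
    ultimately show ?thesis by simp
  qed
  have rt: "ip (E 0 1 + E 1 1) R = 0"
  proof -
    have "E 0 1 + E 1 1 = \<Sum>(F 0 1 \<union> F 1 1)"
      using finite_F by (subst sum.union_disjoint) (auto simp: F_iff)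
    moreover have "ip (\<Sum>(F 0 1 \<union> F 1 1)) R = 0"
    proof (rule sum_refl_stable_orthogonal[OF R])
      fix \<beta> assume "\<beta> \<in> F 0 1 \<union> F 1 1"
      then have b: "\<beta> \<in> pos" "cf \<beta> S = 1" by (auto simp: F_iff)
      then have "\<beta> \<noteq> R" using R R_neq_S by (auto simp: cf_simple)
      then have "refl R \<beta> \<in> pos" using refl_pos R b by blast
      moreover have "cf (refl R \<beta>) S = 1" using b R_neq_S R by (simp add: cf_refl pos_root root_in_span)
      ultimately show "refl R \<beta> \<in> F 0 1 \<union> F 1 1" using cf_R_cases by (auto simp: F_iff)
    qed (use finite_F in auto)
    ultimately show ?thesis by simp
  qed
  have "ip (E 1 1) S = a" using st ip_E10[of S] S R_neq_S by (simp add: ip_linear simple_in_span cf_simple)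
  moreover have "ip (E 1 1) R = b" using rt ip_E01[of R] R R_neq_S by (simp add: ip_linear simple_in_span cf_simple)
  ultimately show ?thesis using ip_E_expand[of 1 1 v] v ip_E10[OF v]
    by (simp add: ip_linear algebra_simps)
qed

text \<open>Evaluate \<open>sum_ip_squares\<close> at \<open>wt R\<close> and \<open>R\<close>: only
  roots with \<open>R\<close>-coefficient 1 contribute, and these add up to
  \<open>E 1 0 + E 1 1\<close>.\<close>

lemma rform_highest: "rform \<eta> \<eta> / 4 = a + b + c"
proof -
  have "rform \<eta> \<eta> / 4 = (\<Sum>\<beta>\<in>pos. ip (wt R) \<beta> * ip R \<beta>)"
    using R by (simp add: sum_ip_squares[OF simply_laced] ip_wt ip_R simple_in_span cf_simple)
  also have "\<dots> = (\<Sum>\<beta>\<in>pos. if cf \<beta> R = 1 then ip R \<beta> else 0)"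
    using R cf_R_cases by (intro sum.cong) (auto simp: ip_wt ip_R pos_root root_in_span)
  also have "\<dots> = (\<Sum>\<beta>\<in>{\<beta>\<in>pos. cf \<beta> R = 1}. ip R \<beta>)"
    using finite_pos by (simp add: sum.inter_filter)
  also have "{\<beta>\<in>pos. cf \<beta> R = 1} = F 1 0 \<union> F 1 1" by (auto simp: F_iff dest: cf_S_cases)
  also have "(\<Sum>\<beta>\<in>F 1 0 \<union> F 1 1. ip R \<beta>) = ip R (E 1 0 + E 1 1)"
    by (subst sum.union_disjoint[OF finite_F finite_F])
      (force simp: F_iff, simp only: ip_add_right ip_sum_right)
  also have "\<dots> = ip (E 1 0 + E 1 1) R" by (rule ip_commute)
  also have "\<dots> = a + b + c" using ip_E10_E11[of R] R by (simp add: simple_in_span cf_simple)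
  finally show ?thesis .
qed

lemma sum_eq_coxeter_number: "a + b + c = coxeter_number coroot \<Delta>"
proof -
  have "2 * real (card pos) = real (a + b + c) * real (card \<Delta>)"
    using card_pos_ip[OF simply_laced] by (simp only: rform_highest)
  moreover have "2 * real (card pos) = real (card \<Delta>) * real (coxeter_number coroot \<Delta>)"
    using card_pos_coxeter_number by (metis of_nat_mult of_nat_numeral)
  ultimately have "real (card \<Delta>) * real (a + b + c) = real (card \<Delta>) * real (coxeter_number coroot \<Delta>)"
    by (metis mult.commute)
  moreover have "card \<Delta> > 0" using simple_nonempty finite_simple by (simp add: card_gt_0_iff)
  ultimately show ?thesis by (metis mult_left_cancel of_nat_0_less_iff of_nat_eq_iff less_irrefl)
qed

text \<open>\<open>\<eta>\<close> pairs to 0 or 1 with every positive root except itself, where it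
  gives 2. So its squared pairings, with sum \<open>2 * (a + b + c)\<close>, exceed its pairings,
  with sum \<open>2 * height \<Delta> \<eta>\<close>, by exactly 2.\<close>

lemma height_highest: "1 + height \<Delta> \<eta> = a + b + c"
proof -
  have "ip \<eta> \<beta> * ip \<eta> \<beta> - ip \<eta> \<beta> = (if \<beta> = \<eta> then 2 else 0)" if "\<beta> \<in> pos" for \<beta>
    using ip_pos_highest[OF that] ip_commute[of \<eta> \<beta>] ip_highest by auto
  then have "(\<Sum>\<beta>\<in>pos. ip \<eta> \<beta> * ip \<eta> \<beta> - ip \<eta> \<beta>) = (\<Sum>\<beta>\<in>pos. if \<beta> = \<eta> then 2 else 0)"
    by (rule sum.cong[OF HOL.refl])
  also have "\<dots> = 2" using finite_pos highest_root_pos by simp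
  finally have "(\<Sum>\<beta>\<in>pos. ip \<eta> \<beta> * ip \<eta> \<beta>) - (\<Sum>\<beta>\<in>pos. ip \<eta> \<beta>) = 2" by (simp add: sum_subtractf)
  then show ?thesis
    by (simp add: sum_ip_squares[OF simply_laced] sum_ip_pos[OF simply_laced] rform_highest ip_highest
        root_in_span highest_root)
qed

text \<open>The functional is pairing with \<open>E 1 0\<close>, which \<open>a = c\<close> turns
  into \<open>c * (2 * cf v R - cf v S)\<close>; \<open>height_w_w\<close> has the same combination
  with factor \<open>1 + height \<Delta> \<eta>\<close>.\<close>

lemma sign_functional_eq:
  assumes v: "v \<in> span \<Phi>"
  shows "real (a + b + c) * sign_functional \<Phi> coroot \<Delta> w v =
    real c * (height \<Delta> v - 2 * height \<Delta> (w v) + height \<Delta> (w (w v)))"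
proof -
  have "sign_functional \<Phi> coroot \<Delta> w v = (\<Sum>\<beta>\<in>F 1 0. ip v \<beta>)"
    unfolding sign_functional_def sign_roots_eq
    by (intro sum.cong) (auto simp: inner_coroot_ip_long F_root simply_laced)
  also have "\<dots> = ip (E 1 0) v" by (simp only: ip_sum_left ip_commute[of v])
  also have "\<dots> = c * (2 * cf v R - cf v S)" 
    using ip_E10[OF v] by (simp add: a_eq_c algebra_simps)
  finally show ?thesis by (simp only: height_w_w[OF v] height_highest) simp
qed

end

theorem theorem3p3p10:
  fixes \<Phi> \<Delta> :: "(real ^ 'n) set" and coroot w :: "real ^ 'n \<Rightarrow> real ^ 'n"
    and R S :: "real ^ 'n" and a b c h :: nat
  assumes "root_datum \<Phi> coroot"
    and "irreducible_roots \<Phi> coroot"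
    and "simple_system \<Phi> \<Delta>"
    and "w \<in> snd ` alcove_stabilizer \<Phi> coroot \<Delta>"
    and "elt_order w \<ge> 3"
    and "R \<in> \<Delta>" and "S \<in> \<Delta>" and "w S = R" and "w R = - highest_root \<Phi> \<Delta>"
    and "\<forall>\<alpha> \<in> coeff_roots \<Phi> \<Delta> R S 0 1. card {t \<in> root_triples \<Phi> \<Delta> R S. fst t = \<alpha>} = a"
    and "\<forall>\<beta> \<in> coeff_roots \<Phi> \<Delta> R S 1 0. card {t \<in> root_triples \<Phi> \<Delta> R S. fst (snd t) = \<beta>} = b"
    and "\<forall>\<gamma> \<in> coeff_roots \<Phi> \<Delta> R S 1 1. card {t \<in> root_triples \<Phi> \<Delta> R S. snd (snd t) = \<gamma>} = c"
    and "h = coxeter_number coroot \<Delta>"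
  shows "a + b + c = h \<and> a = c \<and>
    (\<forall>v \<in> span \<Phi>. real h * sign_functional \<Phi> coroot \<Delta> w v =
       real c * (height \<Delta> v - 2 * height \<Delta> (w v) + height \<Delta> (w (w v))))"
proof -
  interpret based_root_datum \<Phi> coroot \<Delta>
    by (intro based_root_datum.intro based_root_datum_axioms.intro assms(1-3))
  obtain y where "(y, w) \<in> alcove_stabilizer \<Phi> coroot \<Delta>" using assms(4) by auto
  then obtain ws where ws: "set ws \<subseteq> \<Phi>" "w = word ws"
      "\<And>\<beta>. \<beta> \<in> insert (- \<eta>) \<Delta> \<Longrightarrow> w \<beta> \<in> insert (- \<eta>) \<Delta>"
    using stabilizer_affine_simple by blast
  interpret affine_rotation_fibres \<Phi> coroot \<Delta> w ws R S a b c
    by unfold_locales (use ws assms in auto)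
  have h: "a + b + c = h" using sum_eq_coxeter_number assms(13) by simp
  then have "\<forall>v \<in> span \<Phi>. real h * sign_functional \<Phi> coroot \<Delta> w v =
      real c * (height \<Delta> v - 2 * height \<Delta> (w v) + height \<Delta> (w (w v)))"
    using sign_functional_eq by simp
  then show ?thesis using h a_eq_c by blast
qed

end
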